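(* Let $k\in\mathbb{N}\cup\{\infty\}$ and let $X$ be a separable Banach space with a $C^k$-smooth norm. Then $X$ admits an equivalent $C^k$-smooth norm $|||\cdot|||$ which is not uniformly Gâteaux in any direction, that is, for every $h\in X\setminus\{0\}$ the norm $|||\cdot|||$ is not uniformly Gâteaux in the direction of $h$. Moreover, the unit ball of $X$ in this norm $|||\cdot|||$ is dentable.
   Context: All Banach spaces are real. $\mathbb{N}=\{1,2,\dots\}$. A norm on $X$ is $C^k$-smooth if it is $k$ times continuously Fréchet differentiable on $X\setminus\{0\}$ (for every finite order if $k=\infty$). For a norm $|||\cdot|||$ on $X$, $x\in X\setminus\{0\}$, $h\in X\setminus\{0\}$ and $t\neq 0$, put $$D(|||\cdot|||,x,h,t)=\frac{|||x+th|||+|||x-th|||-2|||x|||}{t}.$$ The norm $|||\cdot|||$ is uniformly Gâteaux in the direction of $h\in X\setminus\{0\}$ if $D(|||\cdot|||,x,h,t)\to 0$ as $t\to 0$, uniformly in $x$ when $x$ ranges over the unit sphere of an equivalent norm on $X$. For a convex set $C\subset X$, $f\in X^*$ and $a>0$, the slice of $C$ defined by $f$ and $a$ is $S(C,f,a)=\{x\in C\colon \langle f,x\rangle>a\}$. A convex set $C$ is dentable if it admits non-empty slices of arbitrarily small diameter in an equivalent norm.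
   Formalization: The space X is additionally assumed infinite-dimensional: in nonzero finite dimension every C^1 norm is uniformly Gâteaux in all directions by compactness of the sphere, and for X = {0} the unit ball has no non-empty slice with a > 0, so the claim fails there. *)

theory Defs
  imports "HOL-Analysis.Analysis" "HOL-Library.Extended_Nat"
begin

text \<open>
  A Banach space is a type of class \<open>banach\<close>; a further norm on it is a function
  \<open>N :: 'a \<Rightarrow> real\<close>.
\<close>

definition equivalent_norm :: "('a::real_normed_vector \<Rightarrow> real) \<Rightarrow> bool" where
  "equivalent_norm N \<longleftrightarrow>
     (\<forall>x. N x \<ge> 0) \<and> (\<forall>x. N x = 0 \<longleftrightarrow> x = 0) \<and>
     (\<forall>c x. N (c *\<^sub>R x) = \<bar>c\<bar> * N x) \<and>
     (\<forall>x y. N (x + y) \<le> N x + N y) \<and>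
     (\<exists>a>0. \<exists>b>0. \<forall>x. a * norm x \<le> N x \<and> N x \<le> b * norm x)"

text \<open>
  The iterated spaces of operators \<open>L(X, L(X, \<dots>, L(X, \<real>)))\<close> have a type that depends on the
  order. They are identified, isometrically, with spaces of bounded \<open>j\<close>-linear forms on \<open>X\<close>;
  such a form is a function on lists, of which only the values on lists of length \<open>j\<close> matter.
\<close>

definition bounded_multilinear_form :: "nat \<Rightarrow> ('a::real_normed_vector list \<Rightarrow> real) \<Rightarrow> bool" where
  "bounded_multilinear_form j A \<longleftrightarrow>
     (\<forall>vs. length vs = j \<longrightarrow> (\<forall>i<j. linear (\<lambda>v. A (vs[i := v])))) \<and>
     (\<exists>C. \<forall>vs. length vs = j \<longrightarrow> \<bar>A vs\<bar> \<le> C * prod_list (map norm vs))"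

definition multilinear_norm :: "nat \<Rightarrow> ('a::real_normed_vector list \<Rightarrow> real) \<Rightarrow> real" where
  "multilinear_norm j A = (SUP vs\<in>{vs. length vs = j \<and> (\<forall>v\<in>set vs. norm v \<le> 1)}. \<bar>A vs\<bar>)"

text \<open>
  \<open>F\<close> takes \<open>j\<close>-linear forms as values; its derivative at \<open>x\<close>, an operator from \<open>X\<close> to
  \<open>j\<close>-linear forms, is the \<open>(j+1)\<close>-linear form \<open>G\<close> whose first argument is the increment.
\<close>

definition has_multilinear_derivative ::
  "nat \<Rightarrow> ('a::real_normed_vector \<Rightarrow> 'a list \<Rightarrow> real) \<Rightarrow> ('a list \<Rightarrow> real) \<Rightarrow> 'a \<Rightarrow> bool" where
  "has_multilinear_derivative j F G x \<longleftrightarrow>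
     bounded_multilinear_form (Suc j) G \<and>
     ((\<lambda>h. multilinear_norm j (\<lambda>vs. F (x + h) vs - F x vs - G (h # vs)) / norm h) \<longlongrightarrow> 0) (at 0)"

text \<open>\<open>F j x\<close> is the \<open>j\<close>-th derivative of \<open>f\<close> at \<open>x\<close>; the set \<open>S\<close> is meant to be open.\<close>

definition times_cont_frechet_differentiable_on ::
  "nat \<Rightarrow> ('a::real_normed_vector \<Rightarrow> real) \<Rightarrow> 'a set \<Rightarrow> bool" where
  "times_cont_frechet_differentiable_on n f S \<longleftrightarrow>
     (\<exists>F :: nat \<Rightarrow> 'a \<Rightarrow> 'a list \<Rightarrow> real.
        (\<forall>x\<in>S. F 0 x [] = f x) \<and>
        (\<forall>j\<le>n. \<forall>x\<in>S. bounded_multilinear_form j (F j x)) \<and>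
        (\<forall>j<n. \<forall>x\<in>S. has_multilinear_derivative j (F j) (F (Suc j) x) x) \<and>
        (\<forall>x\<in>S. ((\<lambda>y. multilinear_norm n (\<lambda>vs. F n y vs - F n x vs)) \<longlongrightarrow> 0) (at x)))"

definition Ck_smooth_norm :: "enat \<Rightarrow> ('a::real_normed_vector \<Rightarrow> real) \<Rightarrow> bool" where
  "Ck_smooth_norm k N \<longleftrightarrow>
     (case k of
        enat n \<Rightarrow> times_cont_frechet_differentiable_on n N (- {0})
      | \<infinity> \<Rightarrow> \<forall>n. times_cont_frechet_differentiable_on n N (- {0}))"

text \<open>For one derivative, this is the usual notion.\<close>

lemma bounded_multilinear_form_1:
  "bounded_multilinear_form (Suc 0) A \<longleftrightarrow> bounded_linear (\<lambda>v. A [v])"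
proof
  assume A: "bounded_multilinear_form (Suc 0) A"
  then have "linear (\<lambda>v. A ([0][0 := v]))"
    unfolding bounded_multilinear_form_def by (metis length_Cons list.size(3) lessI)
  moreover obtain C where "\<And>vs. length vs = Suc 0 \<Longrightarrow> \<bar>A vs\<bar> \<le> C * prod_list (map norm vs)"
    using A unfolding bounded_multilinear_form_def by blast
  from this[of "[_]"] have "\<And>v. norm (A [v]) \<le> norm v * C" by (simp add: mult.commute)
  ultimately show "bounded_linear (\<lambda>v. A [v])"
    by (auto simp: bounded_linear_def bounded_linear_axioms_def)
next
  assume A: "bounded_linear (\<lambda>v. A [v])"
  then obtain C where "\<And>v. norm (A [v]) \<le> norm v * C"
    using bounded_linear.bounded by blast
  then show "bounded_multilinear_form (Suc 0) A"
    using bounded_linear.linear[OF A] unfolding bounded_multilinear_form_def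
    by (auto simp: length_Suc_conv mult.commute intro!: exI[of _ C])
qed

lemma multilinear_norm_0: "multilinear_norm 0 A = \<bar>A []\<bar>"
proof -
  have "{vs::'a list. length vs = 0 \<and> (\<forall>v\<in>set vs. norm v \<le> 1)} = {[]}" by auto
  then show ?thesis by (simp add: multilinear_norm_def)
qed

lemma multilinear_norm_1:
  fixes L :: "'a::real_normed_vector \<Rightarrow>\<^sub>L real"
  assumes "\<And>v. A [v] = blinfun_apply L v"
  shows "multilinear_norm (Suc 0) A = norm L"
proof -
  have "{vs::'a list. length vs = Suc 0 \<and> (\<forall>v\<in>set vs. norm v \<le> 1)} = (\<lambda>v. [v]) ` {v. norm v \<le> 1}"
    by (auto simp: length_Suc_conv)
  then have eq: "multilinear_norm (Suc 0) A = (SUP v\<in>{v. norm v \<le> 1}. \<bar>blinfun_apply L v\<bar>)"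
    by (simp add: multilinear_norm_def image_image assms)
  have le: "\<bar>blinfun_apply L v\<bar> \<le> norm L" if "norm v \<le> 1" for v
    using norm_blinfun[of L v] mult_left_mono[OF that, of "norm L"] by simp
  have bdd: "bdd_above ((\<lambda>v. \<bar>blinfun_apply L v\<bar>) ` {v. norm v \<le> 1})"
    using le by (auto intro!: bdd_aboveI2)
  let ?s = "SUP v\<in>{v. norm v \<le> 1}. \<bar>blinfun_apply L v\<bar>"
  have "?s \<le> norm L"
    by (rule cSUP_least) (auto simp: le intro!: exI[of _ 0])
  moreover have "norm L \<le> ?s"
  proof (rule norm_blinfun_bound)
    show "0 \<le> ?s" using cSUP_upper[OF _ bdd, of 0] by (simp add: blinfun.zero_right)
    fix x
    show "norm (blinfun_apply L x) \<le> ?s * norm x"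
    proof (cases "x = 0")
      case False
      then have "\<bar>blinfun_apply L ((1 / norm x) *\<^sub>R x)\<bar> \<le> ?s"
        by (intro cSUP_upper[OF _ bdd]) simp
      with False show ?thesis by (simp add: blinfun.scaleR_right field_simps abs_mult)
    qed (simp add: blinfun.zero_right)
  qed
  ultimately show ?thesis by (simp add: eq)
qed

lemma has_multilinear_derivative_0:
  "has_multilinear_derivative 0 F G x \<longleftrightarrow>
     ((\<lambda>y. F y []) has_derivative (\<lambda>h. G [h])) (at x)"
  unfolding has_multilinear_derivative_def has_derivative_at
    bounded_multilinear_form_1 multilinear_norm_0
  by (subst (2) tendsto_norm_zero_iff[symmetric]) (simp add: norm_divide)

lemma times_cont_frechet_differentiable_on_1:
  assumes "open S"
  shows "times_cont_frechet_differentiable_on 1 f S \<longleftrightarrow>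
    (\<exists>f'. continuous_on S f' \<and> (\<forall>x\<in>S. (f has_derivative blinfun_apply (f' x)) (at x)))"
    (is "?l \<longleftrightarrow> ?r")
proof
  assume ?l
  then obtain F where F: "\<forall>x\<in>S. F 0 x [] = f x"
      "\<forall>x\<in>S. bounded_multilinear_form (Suc 0) (F (Suc 0) x)"
      "\<forall>x\<in>S. has_multilinear_derivative 0 (F 0) (F (Suc 0) x) x"
      "\<forall>x\<in>S. ((\<lambda>y. multilinear_norm (Suc 0) (\<lambda>vs. F (Suc 0) y vs - F (Suc 0) x vs)) \<longlongrightarrow> 0) (at x)"
    unfolding times_cont_frechet_differentiable_on_def by auto
  define f' where "f' x = Blinfun (\<lambda>v. F (Suc 0) x [v])" for x
  have f': "blinfun_apply (f' x) = (\<lambda>v. F (Suc 0) x [v])" if "x \<in> S" for x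
    using F(2) that by (simp add: f'_def bounded_multilinear_form_1 bounded_linear_Blinfun_apply)
  have "(f has_derivative blinfun_apply (f' x)) (at x)" if "x \<in> S" for x
    using F(3) that unfolding has_multilinear_derivative_0 f'[OF that]
    by (metis (mono_tags, lifting) F(1) assms has_derivative_transform_within_open)
  moreover have "(f' \<longlongrightarrow> f' x) (at x)" if x: "x \<in> S" for x
  proof -
    have "eventually (\<lambda>y. y \<in> S) (at x)" using assms x by (rule eventually_at_in_open')
    then have "eventually (\<lambda>y. multilinear_norm (Suc 0) (\<lambda>vs. F (Suc 0) y vs - F (Suc 0) x vs)
        = norm (f' y - f' x)) (at x)"
      by eventually_elim (rule multilinear_norm_1, simp add: f' x blinfun.diff_left)
    then have "((\<lambda>y. norm (f' y - f' x)) \<longlongrightarrow> 0) (at x)"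
      using bspec[OF F(4) x] by (rule Lim_transform_eventually[rotated])
    then show ?thesis by (simp only: tendsto_norm_zero_iff LIM_zero_iff)
  qed
  ultimately show ?r
    using assms by (intro exI[of _ f']) (simp add: continuous_on_eq_continuous_at continuous_at)
next
  assume ?r
  then obtain f' where f': "continuous_on S f'"
    "\<And>x. x \<in> S \<Longrightarrow> (f has_derivative blinfun_apply (f' x)) (at x)" by blast
  define F where "F j x vs = (if j = 0 then f x else blinfun_apply (f' x) (hd vs))"
    for j :: nat and x and vs :: "'a list"
  have F0: "bounded_multilinear_form 0 (F 0 x)" for x
    by (auto simp: bounded_multilinear_form_def F_def)
  have F1: "bounded_multilinear_form (Suc 0) (F (Suc 0) x)" for x
    by (simp add: bounded_multilinear_form_1 F_def blinfun.bounded_linear_right)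
  have "((\<lambda>y. multilinear_norm (Suc 0) (\<lambda>vs. F (Suc 0) y vs - F (Suc 0) x vs)) \<longlongrightarrow> 0) (at x)"
    if "x \<in> S" for x
  proof -
    have "multilinear_norm (Suc 0) (\<lambda>vs. F (Suc 0) y vs - F (Suc 0) x vs) = norm (f' y - f' x)" for y
      by (rule multilinear_norm_1) (simp add: F_def blinfun.diff_left)
    moreover have "(f' \<longlongrightarrow> f' x) (at x)"
      using f'(1) assms that by (simp add: continuous_on_eq_continuous_at continuous_at)
    ultimately show ?thesis by (simp add: tendsto_norm_zero_iff LIM_zero_iff)
  qed
  moreover have "has_multilinear_derivative 0 (F 0) (F (Suc 0) x) x" if "x \<in> S" for x
    using f'(2)[OF that] by (simp add: has_multilinear_derivative_0 F_def)
  ultimately show ?l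
    unfolding times_cont_frechet_differentiable_on_def
    using F0 F1 by (intro exI[of _ F]) (auto simp: F_def[of 0] le_Suc_eq)
qed

definition gateaux_quotient ::
  "('a::real_normed_vector \<Rightarrow> real) \<Rightarrow> 'a \<Rightarrow> 'a \<Rightarrow> real \<Rightarrow> real" where
  "gateaux_quotient N x h t = (N (x + t *\<^sub>R h) + N (x - t *\<^sub>R h) - 2 * N x) / t"

definition uniformly_gateaux_in_direction :: "('a::real_normed_vector \<Rightarrow> real) \<Rightarrow> 'a \<Rightarrow> bool" where
  "uniformly_gateaux_in_direction N h \<longleftrightarrow>
     (\<exists>M. equivalent_norm M \<and>
        uniform_limit {x. M x = 1} (\<lambda>t x. gateaux_quotient N x h t) (\<lambda>x. 0) (at 0))"

definition slice :: "'a::real_normed_vector set \<Rightarrow> ('a \<Rightarrow>\<^sub>L real) \<Rightarrow> real \<Rightarrow> 'a set" where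
  "slice C f a = {x \<in> C. blinfun_apply f x > a}"

text \<open>The diameter takes values in \<open>ereal\<close>, so that it is \<open>\<infinity>\<close> for unbounded sets.\<close>

definition diameter_in_norm :: "('a::real_normed_vector \<Rightarrow> real) \<Rightarrow> 'a set \<Rightarrow> ereal" where
  "diameter_in_norm M A = (SUP x\<in>A. SUP y\<in>A. ereal (M (x - y)))"

definition dentable :: "'a::real_normed_vector set \<Rightarrow> bool" where
  "dentable C \<longleftrightarrow> convex C \<and>
     (\<exists>M. equivalent_norm M \<and>
        (\<forall>\<epsilon>>0. \<exists>f a. a > 0 \<and> slice C f a \<noteq> {} \<and> diameter_in_norm M (slice C f a) < ereal \<epsilon>))"

end

theory Submission
  imports Defs
begin

text \<open>
  Why the theorem is true. Suppose that an equivalent norm \<open>N\<close>, points \<open>e j\<close> and functionals \<open>u j\<close>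
  form a bounded biorthogonal system with \<open>u j \<longlonglongrightarrow> 0\<close> pointwise. The gauge
  \<open>2 \<bar>u j v\<bar> + N (v - u j v *\<^sub>R e j) / 2\<close> has as its unit ball a double cone with apex \<open>\<plusminus> e j / 2\<close>. Two
  features of it are useful. Along any direction \<open>h\<close> the apex is a corner, whose angle is governed
  by \<open>N (h - u j h *\<^sub>R e j)\<close>, and this tends to \<open>N h\<close>. And a slice of the double cone by \<open>u j\<close> near
  the apex is small. So if the new norm is, up to factors tending to 1, the maximum of \<open>N\<close> and of
  all these gauges, then its second differences at \<open>e j\<close> do not become small uniformly in \<open>j\<close>,
  whatever \<open>h\<close> is, and its ball has arbitrarily small slices. A single family of corners serves
  all directions and dentability at once.

  The maximum has to be taken smoothly. Because \<open>u j v\<close> tends to 0 and \<open>\<bar>u i\<bar> \<le> 3 N\<close>, near any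
  nonzero \<open>v\<close> all but finitely many gauges are below \<open>N\<close>; so an infinite iteration of a binary
  smooth maximum that is exactly equal to its first argument where that one dominates
  (\<open>smooth_max_absorb\<close>) is locally a finite iteration. This maximum is built from the flat function
  \<open>t \<mapsto> exp (- 1 / t)\<close>; it yields a norm because it is a pointwise maximum of nonnegative
  combinations of its arguments (\<open>smooth_max_supporting_form\<close>). A gauge enters only where it exceeds
  the current norm. It is not smooth on \<open>u j v = 0\<close>, but there it equals \<open>N v / 2\<close>, which is below
  \<open>N\<close>; and it is not smooth on the axis through \<open>e j\<close>, for which reason the slightly larger seminorm
  \<open>2 (1 + tol j)\<^sup>2 \<bar>u j v\<bar>\<close> is inserted first: it hides the very tip of the cone
  (\<open>Ck_on_stage\<close>). The size of the hidden tip shrinks with \<open>tol j\<close>, so corners become sharper and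
  sharper as \<open>j\<close> grows but each of them is smooth.

  The biorthogonal system (\<open>weak_star_null_biorthogonal_sequence\<close>) comes from the differentiability
  of \<open>N\<close> itself: derivatives of \<open>N\<close> are norming functionals, and the derivative at a vector that
  realises the distance to a finite-dimensional subspace vanishes on this subspace. This supplies
  the functionals that otherwise the Hahn-Banach theorem would give.

  Smoothness of order \<open>n\<close> is handled through families of real functions indexed by lists of
  directions, uniformly on bounded lists; this makes the product rule a statement on real functions
  and turns permutations of the arguments of multilinear forms into reindexing. The theorem
  \<open>times_cont_frechet_iff_smooth_family\<close> relates this to iterated derivatives that are multilinear
  forms.
\<close>

section \<open>Seminorms\<close>

definition seminorm :: "('a::real_vector \<Rightarrow> real) \<Rightarrow> bool" where
  "seminorm p \<longleftrightarrow> (\<forall>x. 0 \<le> p x) \<and> (\<forall>c x. p (c *\<^sub>R x) = \<bar>c\<bar> * p x) \<and> (\<forall>x y. p (x + y) \<le> p x + p y)"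

lemma seminorm_nonneg: "seminorm p \<Longrightarrow> 0 \<le> p x"
  and seminorm_scaleR: "seminorm p \<Longrightarrow> p (c *\<^sub>R x) = \<bar>c\<bar> * p x"
  and seminorm_triangle: "seminorm p \<Longrightarrow> p (x + y) \<le> p x + p y"
  by (auto simp: seminorm_def)

lemma seminorm_zero: "seminorm p \<Longrightarrow> p 0 = 0"
  using seminorm_scaleR[of p 0 0] by simp

lemma seminorm_minus: "seminorm p \<Longrightarrow> p (- x) = p x"
  using seminorm_scaleR[of p "-1" x] by simp

lemma seminorm_diff_commute: "seminorm p \<Longrightarrow> p (x - y) = p (y - x)"
  using seminorm_minus[of p "x - y"] by simp

lemma seminorm_triangle_diff: "seminorm p \<Longrightarrow> p (x - y) \<le> p x + p y"
  using seminorm_triangle[of p x "- y"] seminorm_minus[of p y] by simp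

lemma seminorm_reverse_triangle: "seminorm p \<Longrightarrow> p x - p y \<le> p (x - y)"
  using seminorm_triangle[of p "x - y" y] by simp

lemma seminorm_continuous:
  fixes p :: "'a::real_normed_vector \<Rightarrow> real"
  assumes p: "seminorm p" and b: "\<And>x. p x \<le> b * norm x"
  shows "continuous_on S p"
proof -
  have b': "p x \<le> max 0 b * norm x" for x
    using b[of x] by (smt (verit) mult_right_mono norm_ge_zero)
  have "(max 0 b)-lipschitz_on S p"
  proof (rule lipschitz_onI)
    fix x y
    have "\<bar>p x - p y\<bar> \<le> p (x - y)"
      using seminorm_reverse_triangle[OF p, of x y] seminorm_reverse_triangle[OF p, of y x]
        seminorm_diff_commute[OF p, of x y] by linarith
    then show "dist (p x) (p y) \<le> max 0 b * dist x y"
      using b'[of "x - y"] by (simp add: dist_real_def dist_norm)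
  qed simp
  then show ?thesis by (rule lipschitz_on_continuous_on)
qed

lemma equivalent_norm_iff:
  "equivalent_norm N \<longleftrightarrow> seminorm N \<and> (\<exists>a>0. \<exists>b>0. \<forall>x. a * norm x \<le> N x \<and> N x \<le> b * norm x)"
    (is "?l \<longleftrightarrow> ?r")
proof
  assume ?l then show ?r by (simp add: equivalent_norm_def seminorm_def)
next
  assume r: ?r
  then obtain a where a: "a > 0" "\<And>x. a * norm x \<le> N x" by blast
  have "N x = 0 \<longleftrightarrow> x = 0" for x
    using a(1) a(2)[of x] seminorm_zero[of N] r
    by (metis less_eq_real_def mult_eq_0_iff mult_pos_pos norm_eq_zero not_less zero_less_norm_iff)
  then show ?l using r by (simp add: equivalent_norm_def seminorm_def)
qed

lemma equivalent_norm_seminorm: "equivalent_norm N \<Longrightarrow> seminorm N"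
  by (simp add: equivalent_norm_iff)

lemma equivalent_norm_continuous: "equivalent_norm N \<Longrightarrow> continuous_on S N"
  by (auto simp: equivalent_norm_iff intro: seminorm_continuous)

lemma equivalent_norm_pos: "equivalent_norm N \<Longrightarrow> x \<noteq> 0 \<Longrightarrow> 0 < N x"
  unfolding equivalent_norm_def by (metis less_eq_real_def)

lemma equivalent_norm_zero: "equivalent_norm N \<Longrightarrow> N 0 = 0"
  unfolding equivalent_norm_def by blast

section \<open>A bounded biorthogonal sequence with pointwise null functionals\<close>

text \<open>
  Induction on the number of generators. A new generator \<open>a\<close> outside the closed subspace \<open>span B\<close> has
  positive distance \<open>\<delta>\<close> from it, so the coefficient of \<open>a\<close> in a vector of norm at most \<open>r\<close> is bounded by
  \<open>r / \<delta>\<close>, and the ball lies in the continuous image of a compact product.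
\<close>

lemma compact_span_cball:
  fixes B :: "'a::real_normed_vector set"
  assumes "finite B"
  shows "compact (span B \<inter> cball 0 r)"
  using assms
proof (induction B arbitrary: r)
  case empty
  have "({0} \<inter> cball 0 r :: 'a set) = (if r \<ge> 0 then {0} else {})" by auto
  then show ?case by simp
next
  case (insert a B)
  show ?case
  proof (cases "a \<in> span B")
    case True
    then show ?thesis using insert.IH by (simp add: span_redundant)
  next
    case False
    have "closed (span B)"
      unfolding closed_sequential_limits
    proof (intro allI impI, elim conjE)
      fix X l assume X: "\<forall>n. X n \<in> span B" "X \<longlonglongrightarrow> l"
      obtain K where K: "\<And>n. norm (X n) \<le> K"
        using convergent_imp_Bseq[of X] X(2) unfolding convergent_def Bseq_def by blast
      have "closed (span B \<inter> cball 0 K)" by (rule compact_imp_closed[OF insert.IH])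
      moreover have "\<forall>n. X n \<in> span B \<inter> cball 0 K" using X(1) K by simp
      ultimately have "l \<in> span B \<inter> cball 0 K" using X(2) by (meson closed_sequentially)
      then show "l \<in> span B" by simp
    qed
    then have "open (- span B)" by (rule open_Compl)
    then obtain \<delta> where "\<delta> > 0" "ball a \<delta> \<subseteq> - span B"
      using False open_contains_ball by blast
    then have \<delta>: "\<delta> > 0" "\<And>y. y \<in> span B \<Longrightarrow> \<delta> \<le> norm (a - y)"
      by (auto simp: subset_iff dist_norm not_less[symmetric])
    \<comment> \<open>The bound for the coefficient of \<open>a\<close>.\<close>
    define R where "R = \<bar>r\<bar> / \<delta>"
    define K where "K = (\<lambda>(t, y). t *\<^sub>R a + y) ` ({-R..R} \<times> (span B \<inter> cball 0 (\<bar>r\<bar> + R * norm a)))"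
    have "compact K"
      unfolding K_def case_prod_beta
      by (intro compact_continuous_image compact_Times insert.IH continuous_intros compact_Icc)
    have "t *\<^sub>R a + y \<in> span (insert a B)" if "y \<in> span B" for t y
      using that span_mono[OF subset_insertI, of B a] by (intro span_add span_scale) (auto simp: span_base)
    then have KS: "K \<subseteq> span (insert a B)"
      unfolding K_def by auto
    have "x \<in> K" if x: "x \<in> span (insert a B)" "norm x \<le> r" for x
    proof -
      obtain t where t: "x - t *\<^sub>R a \<in> span B"
        using x(1) by (auto simp: span_insert)
      have "\<bar>t\<bar> \<le> R"
      proof (cases "t = 0")
        case False
        have "\<delta> \<le> norm (a - (- (1 / t)) *\<^sub>R (x - t *\<^sub>R a))"
          by (intro \<delta>(2) span_scale t)
        also have "a - (- (1 / t)) *\<^sub>R (x - t *\<^sub>R a) = (1/t) *\<^sub>R x"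
          using False by (simp add: scaleR_diff_right)
        finally have "\<bar>t\<bar> * \<delta> \<le> norm x"
          using False by (simp add: field_simps)
        then show ?thesis using x(2) \<delta>(1) by (simp add: R_def field_simps)
      qed (use \<delta>(1) in \<open>simp add: R_def\<close>)
      moreover have "norm (x - t *\<^sub>R a) \<le> \<bar>r\<bar> + R * norm a"
        using norm_triangle_ineq4[of x "t *\<^sub>R a"] x(2)
          mult_right_mono[OF \<open>\<bar>t\<bar> \<le> R\<close> norm_ge_zero[of a]] by simp
      ultimately have "(t, x - t *\<^sub>R a) \<in> {-R..R} \<times> (span B \<inter> cball 0 (\<bar>r\<bar> + R * norm a))"
        using t by auto
      then show ?thesis unfolding K_def by (rule rev_image_eqI) simp
    qed
    then have "span (insert a B) \<inter> cball 0 r = K \<inter> cball 0 r"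
      using KS by auto
    then show ?thesis using \<open>compact K\<close> by (simp add: compact_Int_closed)
  qed
qed

lemma nearest_point_in_span:
  fixes N :: "'a::real_normed_vector \<Rightarrow> real"
  assumes N: "equivalent_norm N" and "finite B"
  obtains e where "e \<in> span B" "\<And>e'. e' \<in> span B \<Longrightarrow> N (x - e) \<le> N (x - e')"
proof -
  obtain a where a: "a > 0" "\<And>x. a * norm x \<le> N x"
    using N by (auto simp: equivalent_norm_iff)
  note s = equivalent_norm_seminorm[OF N]
  \<comment> \<open>A point \<open>e'\<close> of norm above \<open>2 N x / a\<close> is at distance at least \<open>N x\<close> from \<open>x\<close>, so 0 is at least as near.\<close>
  define r where "r = 2 * N x / a"
  let ?K = "span B \<inter> cball 0 r"
  have r0: "r \<ge> 0" using a(1) seminorm_nonneg[OF s] by (simp add: r_def)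
  then have "0 \<in> ?K" by (simp add: span_zero)
  have "\<exists>e\<in>?K. \<forall>e'\<in>?K. N (x - e) \<le> N (x - e')"
  proof (rule continuous_attains_inf[OF compact_span_cball[OF \<open>finite B\<close>]])
    show "?K \<noteq> {}" using \<open>0 \<in> ?K\<close> by blast
    show "continuous_on ?K (\<lambda>e. N (x - e))"
      by (intro continuous_on_compose2[OF equivalent_norm_continuous[OF N, of UNIV]] continuous_intros) auto
  qed
  then obtain e where e: "e \<in> ?K" "\<And>e'. e' \<in> ?K \<Longrightarrow> N (x - e) \<le> N (x - e')" by blast
  have "N (x - e) \<le> N (x - e')" if "e' \<in> span B" for e'
  proof (cases "norm e' \<le> r")
    case True then show ?thesis using e(2) that by simp
  next
    case False
    then have "2 * N x \<le> a * norm e'" using a(1) by (simp add: r_def field_simps)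
    then have "2 * N x \<le> N e'" using a(2)[of e'] by linarith
    moreover have "N e' - N x \<le> N (x - e')"
      using seminorm_reverse_triangle[OF s, of e' x] seminorm_diff_commute[OF s, of x e'] by simp
    moreover have "N (x - e) \<le> N x" using e(2)[OF \<open>0 \<in> ?K\<close>] by simp
    ultimately show ?thesis by linarith
  qed
  with e(1) show ?thesis using that by blast
qed

text \<open>
  All three claims are read off the one-sided difference quotient of \<open>N\<close> at \<open>w\<close>, which homogeneity and
  the triangle inequality control. The third one is Fermat's rule; it produces functionals that vanish
  on a prescribed subspace.
\<close>

lemma norming_functional:
  fixes N :: "'a::real_normed_vector \<Rightarrow> real"
  assumes N: "seminorm N" and f: "(N has_derivative f) (at w)"
  shows "f w = N w" and "\<bar>f v\<bar> \<le> N v"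
    and "(\<And>t. N w \<le> N (w + t *\<^sub>R v)) \<Longrightarrow> f v = 0"
proof -
  interpret bounded_linear f using f by (rule has_derivative_bounded_linear)
  have lim: "((\<lambda>t. (N (w + t *\<^sub>R v) - N w) / t) \<longlongrightarrow> f v) (at_right 0)" for v
  proof -
    have "((\<lambda>t. N (w + t *\<^sub>R v)) has_derivative (\<lambda>t. f (t *\<^sub>R v))) (at 0)"
      by (rule has_derivative_compose[of "\<lambda>t. w + t *\<^sub>R v" "\<lambda>t. t *\<^sub>R v" 0 UNIV N])
         (auto intro!: derivative_eq_intros f)
    then have "((\<lambda>t. N (w + t *\<^sub>R v)) has_real_derivative f v) (at 0)"
      unfolding has_field_derivative_def
      by (rule has_derivative_eq_rhs) (simp add: fun_eq_iff scaleR)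
    then have "((\<lambda>t. (N (w + t *\<^sub>R v) - N w) / t) \<longlongrightarrow> f v) (at 0)"
      by (simp add: has_field_derivative_iff)
    then show ?thesis by (rule tendsto_within_subset) simp
  qed
  have pos: "eventually (\<lambda>t::real. t > 0) (at_right 0)" by (rule eventually_at_right_less)
  have "((\<lambda>t::real. N w) \<longlongrightarrow> f w) (at_right 0)"
  proof (rule Lim_transform_eventually[OF lim])
    show "eventually (\<lambda>t. (N (w + t *\<^sub>R w) - N w) / t = N w) (at_right 0)"
      using pos
    proof eventually_elim
      case (elim t)
      have "w + t *\<^sub>R w = (1 + t) *\<^sub>R w" by (simp add: scaleR_add_left)
      then have "N (w + t *\<^sub>R w) = (1 + t) * N w" using elim by (simp add: seminorm_scaleR[OF N])
      then show ?case using elim by (simp add: field_simps)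
    qed
  qed
  then show "f w = N w" by (simp add: tendsto_const_iff)
  have le: "f v \<le> N v" for v
  proof (rule tendsto_upperbound[OF lim])
    show "eventually (\<lambda>t. (N (w + t *\<^sub>R v) - N w) / t \<le> N v) (at_right 0)"
      using pos
    proof eventually_elim
      case (elim t)
      then show ?case
        using seminorm_triangle[OF N, of w "t *\<^sub>R v"] by (simp add: seminorm_scaleR[OF N] field_simps)
    qed
  qed simp
  show "\<bar>f v\<bar> \<le> N v" using le[of v] le[of "- v"] by (simp add: seminorm_minus[OF N] neg)
  have ge: "0 \<le> f v" if m: "\<And>t. N w \<le> N (w + t *\<^sub>R v)" for v
  proof (rule tendsto_lowerbound[OF lim])
    show "eventually (\<lambda>t. 0 \<le> (N (w + t *\<^sub>R v) - N w) / t) (at_right 0)"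
      using pos by eventually_elim (use m in simp)
  qed simp
  show "f v = 0" if m: "\<And>t. N w \<le> N (w + t *\<^sub>R v)"
    using ge[OF m] ge[of "- v"] m[of "- t" for t] by (simp add: neg)
qed

text \<open>
  The common kernel is not even finitely spanned: passing to the kernel of one further functional
  lowers the dimension by at most one.
\<close>

lemma common_zero_of_functionals:
  fixes U :: "('a::real_vector \<Rightarrow> real) set"
  assumes "finite U" and "\<And>f. f \<in> U \<Longrightarrow> linear f"
    and inf: "\<nexists>B::'a set. finite B \<and> span B = UNIV"
  obtains y where "y \<noteq> 0" "\<And>f. f \<in> U \<Longrightarrow> f y = 0"
proof -
  have "\<not> (\<exists>B. finite B \<and> {y. \<forall>f\<in>U. f y = 0} \<subseteq> span B)"
    using assms(1,2)
  proof (induction U)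
    case empty then show ?case using inf by auto
  next
    case (insert g U)
    show ?case
    proof
      assume "\<exists>B. finite B \<and> {y. \<forall>f\<in>insert g U. f y = 0} \<subseteq> span B"
      then obtain B where B: "finite B" "{y. \<forall>f\<in>insert g U. f y = 0} \<subseteq> span B" by blast
      have "\<exists>z. {y. \<forall>f\<in>U. f y = 0} \<subseteq> span (insert z B)"
      proof (cases "\<exists>z. (\<forall>f\<in>U. f z = 0) \<and> g z \<noteq> 0")
        case True
        then obtain z where z: "\<forall>f\<in>U. f z = 0" "g z \<noteq> 0" by blast
        have "y \<in> span (insert z B)" if y: "\<forall>f\<in>U. f y = 0" for y
        proof -
          have "f (y - (g y / g z) *\<^sub>R z) = 0" if "f \<in> insert g U" for f
            using insert.prems[OF that] that y z by (auto simp: linear_diff linear_scale)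
          then have "y - (g y / g z) *\<^sub>R z \<in> span B"
            using B(2) by blast
          then show ?thesis unfolding span_insert by blast
        qed
        then show ?thesis by blast
      next
        case False
        then have "{y. \<forall>f\<in>U. f y = 0} \<subseteq> span B" using B(2) by auto
        then show ?thesis using span_mono[of B "insert 0 B"] by blast
      qed
      then show False using insert.IH insert.prems B(1) by (meson finite_insert insertCI)
    qed
  qed
  then have "\<not> {y. \<forall>f\<in>U. f y = 0} \<subseteq> span {}" by blast
  then show ?thesis using that by auto
qed

text \<open>
  Mazur's construction of basic sequences. By compactness, finitely many norming functionals suffice to
  recover at least half of the norm of each vector of \<open>span B\<close>. A vector \<open>y\<close> killed by all of them
  satisfies \<open>N (y - e) \<ge> N e / 2\<close>; together with \<open>N (y - e) \<ge> 1 - N e\<close> this gives the constant \<open>1 / 3\<close>.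
\<close>

lemma mazur_almost_orthogonal:
  fixes N :: "'a::real_normed_vector \<Rightarrow> real" and U :: "('a \<Rightarrow> real) set"
  assumes N: "equivalent_norm N" and diff: "\<And>w. w \<noteq> 0 \<Longrightarrow> \<exists>f. (N has_derivative f) (at w)"
    and inf: "\<nexists>B::'a set. finite B \<and> span B = UNIV"
    and B: "finite B" and U: "finite U" "\<And>f. f \<in> U \<Longrightarrow> linear f"
  obtains y where "N y = 1" "\<And>f. f \<in> U \<Longrightarrow> f y = 0" "\<And>e. e \<in> span B \<Longrightarrow> 1 / 3 \<le> N (y - e)"
proof -
  note s = equivalent_norm_seminorm[OF N]
  obtain a where a: "a > 0" "\<And>x. a * norm x \<le> N x"
    using N by (auto simp: equivalent_norm_iff)
  define K where "K = span B \<inter> {x. N x = 1}"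
  have "closed {x. N x = 1}"
    by (intro closed_Collect_eq equivalent_norm_continuous[OF N] continuous_on_const)
  moreover have "norm x \<le> 1 / a" if "N x = 1" for x
    using a(1) a(2)[of x] that by (simp add: field_simps)
  then have "K = (span B \<inter> cball 0 (1 / a)) \<inter> {x. N x = 1}" by (auto simp: K_def)
  ultimately have "compact K" using compact_span_cball[OF B] by (simp add: compact_Int_closed)
  obtain F where F: "\<And>w. w \<noteq> 0 \<Longrightarrow> (N has_derivative F w) (at w)" using diff by metis
  have nz: "w \<noteq> 0" if "w \<in> K" for w using that equivalent_norm_zero[OF N] by (auto simp: K_def)
  have Fcont: "continuous_on UNIV (F w)" if "w \<in> K" for w
    using has_derivative_bounded_linear[OF F[OF nz[OF that]]] by (simp add: linear_continuous_on)
  have "\<exists>C'\<subseteq>K. finite C' \<and> K \<subseteq> (\<Union>w\<in>C'. {v. 1 / 2 < F w v})"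
  proof (rule compactE_image[OF \<open>compact K\<close>, of K "\<lambda>w. {v. 1 / 2 < F w v}"])
    show "open {v. 1 / 2 < F w v}" if "w \<in> K" for w
      using Fcont[OF that] by (intro open_Collect_less) (auto intro: continuous_on_const)
    show "K \<subseteq> (\<Union>w\<in>K. {v. 1 / 2 < F w v})"
      using norming_functional(1)[OF s F[OF nz]] by (auto simp: K_def)
  qed blast
  then obtain C where C: "C \<subseteq> K" "finite C" "K \<subseteq> (\<Union>w\<in>C. {v. 1 / 2 < F w v})" by blast
  have "linear f" if "f \<in> U \<union> F ` C" for f
    using that U(2) has_derivative_linear F nz C(1) by blast
  then obtain y where y: "y \<noteq> 0" "\<And>f. f \<in> U \<union> F ` C \<Longrightarrow> f y = 0"
    using common_zero_of_functionals[of "U \<union> F ` C"] inf U(1) C(2) by blast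
  define z where "z = (1 / N y) *\<^sub>R y"
  have Ny: "N y > 0" using equivalent_norm_pos[OF N y(1)] .
  have z1: "N z = 1" using Ny by (simp add: z_def seminorm_scaleR[OF s])
  have z0: "f z = 0" if "f \<in> U \<union> F ` C" for f
    using y(2)[OF that] \<open>\<And>f. f \<in> U \<union> F ` C \<Longrightarrow> linear f\<close>[OF that] by (simp add: z_def linear_scale)
  have "1 / 3 \<le> N (z - e)" if e: "e \<in> span B" for e
  proof -
    have "N e / 2 \<le> N (z - e)"
    proof (cases "e = 0")
      case True then show ?thesis using equivalent_norm_zero[OF N] z1 by simp
    next
      case False
      then have Ne: "N e > 0" by (rule equivalent_norm_pos[OF N])
      have "(1 / N e) *\<^sub>R e \<in> K"
        using e Ne by (simp add: K_def span_scale seminorm_scaleR[OF s])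
      then obtain w where w: "w \<in> C" "1 / 2 < F w ((1 / N e) *\<^sub>R e)" using C(3) by blast
      have "linear (F w)" using w(1) \<open>\<And>f. f \<in> U \<union> F ` C \<Longrightarrow> linear f\<close> by blast
      then have "F w (e - z) = F w e" "1 / 2 < F w e / N e"
        using w z0 by (auto simp: linear_diff linear_scale)
      then have "N e / 2 < F w (e - z)" using Ne by (simp add: field_simps)
      also have "\<dots> \<le> N (z - e)"
        using norming_functional(2)[OF s F[OF nz], of w "e - z"] w(1) C(1) seminorm_diff_commute[OF s, of z e]
        by force
      finally show ?thesis by simp
    qed
    moreover have "1 - N e \<le> N (z - e)"
      using seminorm_reverse_triangle[OF s, of z e] z1 by simp
    ultimately show ?thesis by linarith
  qed
  then show ?thesis using that z1 z0 by blast
qed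

text \<open>
  A substitute for the Hahn-Banach theorem in the presence of a differentiable norm. If \<open>e\<close> is a point
  of \<open>span B\<close> nearest to \<open>y\<close>, then \<open>N\<close> restricted to \<open>y - e + span B\<close> is minimal at \<open>y - e\<close>, hence its
  derivative there vanishes on \<open>span B\<close>, and it norms \<open>y - e\<close>.
\<close>

lemma annihilating_functional:
  fixes N :: "'a::real_normed_vector \<Rightarrow> real"
  assumes N: "equivalent_norm N" and diff: "\<And>w. w \<noteq> 0 \<Longrightarrow> \<exists>f. (N has_derivative f) (at w)"
    and B: "finite B" and c: "c > 0" "\<And>e. e \<in> span B \<Longrightarrow> c \<le> N (y - e)"
  obtains u where "bounded_linear u" "u y = 1" "\<And>e. e \<in> B \<Longrightarrow> u e = 0" "\<And>v. \<bar>u v\<bar> \<le> N v / c"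
proof -
  note s = equivalent_norm_seminorm[OF N]
  obtain e where e: "e \<in> span B" "\<And>e'. e' \<in> span B \<Longrightarrow> N (y - e) \<le> N (y - e')"
    using nearest_point_in_span[OF N B] by blast
  define w where "w = y - e"
  have w: "c \<le> N w" using c(2)[OF e(1)] by (simp add: w_def)
  then have "w \<noteq> 0" using c(1) equivalent_norm_zero[OF N] by force
  then obtain f where f: "(N has_derivative f) (at w)" using diff by blast
  interpret bounded_linear f using f by (rule has_derivative_bounded_linear)
  have f0: "f v = 0" if "v \<in> span B" for v
  proof (rule norming_functional(3)[OF s f])
    fix t
    show "N w \<le> N (w + t *\<^sub>R v)"
      using e(2)[of "e - t *\<^sub>R v"] e(1) that by (simp add: w_def span_diff span_scale algebra_simps)
  qed
  have "y = w + e" by (simp add: w_def)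
  then have fy: "f y = N w" using norming_functional(1)[OF s f] f0[OF e(1)] by (simp add: add)
  show ?thesis
  proof
    show "bounded_linear (\<lambda>v. f v / N w)"
      using bounded_linear_compose[OF bounded_linear_divide bounded_linear_axioms] .
    show "f y / N w = 1" using fy w c(1) by simp
    show "f e / N w = 0" if "e \<in> B" for e using f0 that by (simp add: span_base)
    fix v
    have "\<bar>f v / N w\<bar> \<le> N v / N w"
      using norming_functional(2)[OF s f, of v] w c(1) by (simp add: divide_right_mono)
    also have "\<dots> \<le> N v / c"
      using w c(1) seminorm_nonneg[OF s] by (intro divide_left_mono) auto
    finally show "\<bar>f v / N w\<bar> \<le> N v / c" .
  qed
qed

text \<open>
  The system is biorthogonal, and the functionals tend to 0 pointwise (weak-star) while they stay
  bounded away from 0 in norm.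
\<close>

locale null_biorthogonal_system =
  fixes N :: "'a::real_normed_vector \<Rightarrow> real" and e :: "nat \<Rightarrow> 'a" and u :: "nat \<Rightarrow> 'a \<Rightarrow> real"
  assumes norm: "equivalent_norm N"
    and linear: "bounded_linear (u j)"
    and bound: "\<bar>u j v\<bar> \<le> 3 * N v"
    and unit: "N (e j) = 1"
    and self: "u j (e j) = 1"
    and other: "i \<noteq> j \<Longrightarrow> u i (e j) = 0"
    and null: "(\<lambda>j. u j v) \<longlonglongrightarrow> 0"

text \<open>
  The pairs are chosen one after another. The functional \<open>u j\<close> vanishes on the earlier points and on the
  first \<open>j\<close> members of a dense sequence, which forces \<open>u j \<longlonglongrightarrow> 0\<close> because of the uniform bound; the point
  \<open>e j\<close> is killed by the earlier functionals.
\<close>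

lemma weak_star_null_biorthogonal_sequence:
  fixes N :: "'a::real_normed_vector \<Rightarrow> real"
  assumes N: "equivalent_norm N" and diff: "\<And>w. w \<noteq> 0 \<Longrightarrow> \<exists>f. (N has_derivative f) (at w)"
    and inf: "\<nexists>B::'a set. finite B \<and> span B = UNIV"
    and sep: "separable_space (euclidean :: 'a topology)"
  obtains e u where "null_biorthogonal_system N e u"
proof -
  note s = equivalent_norm_seminorm[OF N]
  have step: "\<exists>y u. N y = 1 \<and> bounded_linear u \<and> u y = 1 \<and> (\<forall>v. \<bar>u v\<bar> \<le> 3 * N v) \<and>
      (\<forall>e\<in>B. u e = 0) \<and> (\<forall>f\<in>U. f y = 0)"
    if "finite B" "finite U" "\<forall>f\<in>U. bounded_linear f" for B :: "'a set" and U :: "('a \<Rightarrow> real) set"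
  proof -
    have "linear f" if "f \<in> U" for f
      using \<open>\<forall>f\<in>U. bounded_linear f\<close> that bounded_linear.linear by blast
    from mazur_almost_orthogonal[OF N diff inf that(1,2) this]
    obtain y where y: "N y = 1" "\<And>f. f \<in> U \<Longrightarrow> f y = 0" "\<And>e. e \<in> span B \<Longrightarrow> 1 / 3 \<le> N (y - e)"
      by metis
    have "(0::real) < 1 / 3" by simp
    obtain u where "bounded_linear u" "u y = 1" "\<And>e. e \<in> B \<Longrightarrow> u e = 0" "\<And>v. \<bar>u v\<bar> \<le> N v / (1/3)"
      using annihilating_functional[OF N diff \<open>finite B\<close> \<open>0 < 1 / 3\<close> y(3)] by metis
    then have "\<forall>v. \<bar>u v\<bar> \<le> 3 * N v" by (simp add: mult.commute[of 3])
    with \<open>bounded_linear u\<close> \<open>u y = 1\<close> \<open>\<And>e. e \<in> B \<Longrightarrow> u e = 0\<close> y(1,2) show ?thesis by blast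
  qed
  obtain D :: "'a set" where D: "countable D" "closure D = UNIV"
    using sep unfolding separable_space_def by auto
  define d where "d = from_nat_into D"
  have "D \<noteq> {}" using D(2) by auto
  then have d: "range d = D" using D(1) unfolding d_def by (intro range_from_nat_into)
  \<comment> \<open>A state carries the finite set \<open>B\<close> that the functional \<open>u\<close> annihilates and the finite set \<open>U\<close> of
  functionals that annihilate the point \<open>y\<close>.\<close>
  define P where "P n = (\<lambda>(B, U, y, u). finite B \<and> finite U \<and> (\<forall>f\<in>U. bounded_linear f) \<and>
      N y = 1 \<and> bounded_linear u \<and> u y = 1 \<and> (\<forall>v. \<bar>u v\<bar> \<le> 3 * N v) \<and>
      (\<forall>e\<in>B. u e = 0) \<and> (\<forall>f\<in>U. f y = (0::real)))"
    for n :: nat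
  define Q where "Q n = (\<lambda>(B, U, y :: 'a, u :: 'a \<Rightarrow> real) (B', U', y' :: 'a, u' :: 'a \<Rightarrow> real). B' = insert (d n) (insert y B) \<and> U' = insert u U)"
    for n :: nat
  have ex: "\<exists>s. \<forall>n. P n (s n) \<and> Q n (s n) (s (Suc n))"
  proof (rule dependent_nat_choice)
    obtain y u where "N y = 1" "bounded_linear u" "u y = 1" "\<forall>v. \<bar>u v\<bar> \<le> 3 * N v"
      using step[of "{}" "{}"] by auto
    then have "P 0 ({}, {}, y, u)" by (simp add: P_def)
    then show "\<exists>s. P 0 s" by blast
  next
    fix s n assume P: "P n s"
    obtain B U y u where s: "s = (B, U, y, u)" by (metis prod_cases4)
    let ?B = "insert (d n) (insert y B)" and ?U = "insert u U"
    have "finite ?B" "finite ?U" "\<forall>f\<in>?U. bounded_linear f"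
      using P by (simp_all add: P_def s)
    from step[OF this] obtain y' u' where "N y' = 1 \<and> bounded_linear u' \<and> u' y' = 1 \<and>
      (\<forall>v. \<bar>u' v\<bar> \<le> 3 * N v) \<and> (\<forall>e\<in>?B. u' e = 0) \<and> (\<forall>f\<in>?U. f y' = 0)" by blast
    then have "P (Suc n) (?B, ?U, y', u')"
      using \<open>finite ?B\<close> \<open>finite ?U\<close> \<open>\<forall>f\<in>?U. bounded_linear f\<close> unfolding P_def prod.case by blast
    moreover have "Q n s (?B, ?U, y', u')" by (simp add: Q_def s)
    ultimately show "\<exists>s'. P (Suc n) s' \<and> Q n s s'" by blast
  qed
  then obtain s where s: "\<And>n. P n (s n)" "\<And>n. Q n (s n) (s (Suc n))" by blast
  define Bs Us e u where "Bs n = fst (s n)" and "Us n = fst (snd (s n))"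
    and "e n = fst (snd (snd (s n)))" and "u n = snd (snd (snd (s n)))" for n
  have seq: "s n = (Bs n, Us n, e n, u n)" for n by (simp add: Bs_def Us_def e_def u_def)
  have P': "N (e n) = 1" "bounded_linear (u n)" "u n (e n) = 1" "\<bar>u n v\<bar> \<le> 3 * N v"
     "x \<in> Bs n \<Longrightarrow> u n x = 0" "f \<in> Us n \<Longrightarrow> f (e n) = 0" for n v x f
    using s(1)[of n] by (auto simp: P_def seq)
  have Q': "Bs (Suc n) = insert (d n) (insert (e n) (Bs n))" "Us (Suc n) = insert (u n) (Us n)" for n
    using s(2)[of n] by (auto simp: Q_def seq)
  have mem: "d i \<in> Bs j \<and> e i \<in> Bs j \<and> u i \<in> Us j" if "i < j" for i j
    using that by (induction j) (auto simp: Q' less_Suc_eq)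
  have "(\<lambda>j. u j v) \<longlonglongrightarrow> 0" for v
  proof (rule LIMSEQ_I)
    fix \<epsilon> :: real assume "\<epsilon> > 0"
    obtain b where b: "b > 0" "\<And>x. N x \<le> b * norm x" using N by (auto simp: equivalent_norm_iff)
    have "v \<in> closure D" using D(2) by simp
    then obtain x where x: "x \<in> D" "dist x v < \<epsilon> / (3 * b)"
      unfolding closure_approachable using \<open>\<epsilon> > 0\<close> b(1) by (auto dest!: spec[of _ "\<epsilon> / (3 * b)"])
    obtain i where i: "x = d i" using x(1) d by blast
    have "norm (u j v - 0) < \<epsilon>" if "j \<ge> Suc i" for j
    proof -
      interpret bounded_linear "u j" by (rule P')
      have "u j v = u j (v - x)" using P'(5) mem[of i j] that i by (simp add: diff)
      then have "\<bar>u j v\<bar> \<le> 3 * N (v - x)" using P'(4)[of j "v - x"] by simp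
      also have "\<dots> \<le> 3 * (b * dist x v)" using b(2)[of "v - x"] by (simp add: dist_norm norm_minus_commute)
      also have "\<dots> < \<epsilon>" using x(2) b(1) by (simp add: field_simps)
      finally show ?thesis by simp
    qed
    then show "\<exists>no. \<forall>j\<ge>no. norm (u j v - 0) < \<epsilon>" by blast
  qed
  moreover have "u i (e j) = 0" if "i \<noteq> j" for i j
  proof (cases "i < j")
    case True then show ?thesis using mem[OF True] P'(6) by blast
  next
    case False then have "j < i" using that by simp
    then show ?thesis using mem P'(5) by blast
  qed
  ultimately have "null_biorthogonal_system N e u" using P'(1-4) by (intro null_biorthogonal_system.intro N)
  then show ?thesis by (rule that)
qed

section \<open>A calculus of smooth families of functions\<close>

text \<open>
  The index sets of the families below. All radii \<open>r\<close> occur, instead of \<open>r = 1\<close> only, so that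
  composing the arguments with a bounded linear map is a mere change of index.
\<close>

definition bounded_lists :: "real \<Rightarrow> nat \<Rightarrow> 'a::real_normed_vector list set" where
  "bounded_lists r j = {vs. length vs = j \<and> (\<forall>v\<in>set vs. norm v \<le> r)}"

lemma bounded_lists_Cons [simp]:
  "v # vs \<in> bounded_lists r (Suc j) \<longleftrightarrow> norm v \<le> r \<and> vs \<in> bounded_lists r j"
  by (auto simp: bounded_lists_def)

lemma bounded_lists_0 [simp]: "bounded_lists r 0 = {[]}"
  by (auto simp: bounded_lists_def)

lemma bounded_lists_SucE:
  assumes "ws \<in> bounded_lists r (Suc j)"
  obtains v vs where "ws = v # vs" "norm v \<le> r" "vs \<in> bounded_lists r j"
  using assms by (cases ws) (auto simp: bounded_lists_def)

lemma bounded_lists_mono: "r \<le> r' \<Longrightarrow> bounded_lists r j \<subseteq> bounded_lists r' j"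
  by (force simp: bounded_lists_def)

lemma ex_bounded_lists:
  assumes "length vs = j" obtains r where "vs \<in> bounded_lists r j"
proof
  have "norm v \<le> sum_list (map norm vs)" if "v \<in> set vs" for v
    using that by (intro member_le_sum_list) auto
  then show "vs \<in> bounded_lists (sum_list (map norm vs)) j"
    using assms by (simp add: bounded_lists_def)
qed

text \<open>
  With weight \<open>w = 1\<close> this is uniform convergence to 0, with \<open>w y = norm (y - x)\<close> it is the little-o
  of a derivative, uniformly in the index.
\<close>

definition uniformly_small :: "'i set \<Rightarrow> ('y \<Rightarrow> real) \<Rightarrow> 'y filter \<Rightarrow> ('y \<Rightarrow> 'i \<Rightarrow> real) \<Rightarrow> bool" where
  "uniformly_small I w F f \<longleftrightarrow> (\<forall>e>0. \<forall>\<^sub>F y in F. \<forall>i\<in>I. \<bar>f y i\<bar> \<le> e * w y)"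

lemma uniformly_small_add:
  assumes "uniformly_small I w F f" "uniformly_small I w F g"
  shows "uniformly_small I w F (\<lambda>y i. f y i + g y i)"
  unfolding uniformly_small_def
proof (intro allI impI)
  fix e :: real assume "e > 0"
  then have "e / 2 > 0" by simp
  with assms have "\<forall>\<^sub>F y in F. \<forall>i\<in>I. \<bar>f y i\<bar> \<le> e / 2 * w y" "\<forall>\<^sub>F y in F. \<forall>i\<in>I. \<bar>g y i\<bar> \<le> e / 2 * w y"
    unfolding uniformly_small_def by blast+
  then show "\<forall>\<^sub>F y in F. \<forall>i\<in>I. \<bar>f y i + g y i\<bar> \<le> e * w y"
  proof eventually_elim
    case (elim y)
    show ?case
    proof
      fix i assume "i \<in> I"
      with elim have "\<bar>f y i\<bar> \<le> e / 2 * w y" "\<bar>g y i\<bar> \<le> e / 2 * w y" by auto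
      then show "\<bar>f y i + g y i\<bar> \<le> e * w y" by (simp add: field_simps)
    qed
  qed
qed

text \<open>
  The weights multiply. This covers both kinds of term in the product rule: a remainder times a bounded
  factor, and an increment tending to 0 times a linear term of order \<open>norm (y - x)\<close>.
\<close>

lemma uniformly_small_times_bigO:
  assumes f: "uniformly_small I v F f" and k: "\<forall>\<^sub>F y in F. \<forall>i\<in>I. \<bar>k y i\<bar> \<le> C * w y"
    and v: "\<And>y. 0 \<le> v y" and w: "\<And>y. 0 \<le> w y"
  shows "uniformly_small I (\<lambda>y. v y * w y) F (\<lambda>y i. f y i * k y i)"
  unfolding uniformly_small_def
proof (intro allI impI)
  fix e :: real assume "e > 0"
  define d where "d = e / (\<bar>C\<bar> + 1)"
  have d: "d > 0" "d * \<bar>C\<bar> \<le> e" using \<open>e > 0\<close> by (auto simp: d_def field_simps)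
  from d(1) f have "\<forall>\<^sub>F y in F. \<forall>i\<in>I. \<bar>f y i\<bar> \<le> d * v y" by (auto simp: uniformly_small_def)
  with k show "\<forall>\<^sub>F y in F. \<forall>i\<in>I. \<bar>f y i * k y i\<bar> \<le> e * (v y * w y)"
  proof eventually_elim
    case (elim y)
    show ?case
    proof
      fix i assume "i \<in> I"
      with elim have fk: "\<bar>f y i\<bar> \<le> d * v y" "\<bar>k y i\<bar> \<le> C * w y" by auto
      have "C * w y \<le> \<bar>C\<bar> * w y" using w[of y] by (simp add: mult_right_mono)
      then have "\<bar>f y i * k y i\<bar> \<le> (d * v y) * (\<bar>C\<bar> * w y)"
        unfolding abs_mult using fk d(1) v[of y] by (intro mult_mono) auto
      also have "\<dots> = (d * \<bar>C\<bar>) * (v y * w y)" by simp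
      also have "\<dots> \<le> e * (v y * w y)" using d(2) v[of y] w[of y] by (simp add: mult_right_mono)
      finally show "\<bar>f y i * k y i\<bar> \<le> e * (v y * w y)" .
    qed
  qed
qed


definition family_bounded :: "nat \<Rightarrow> ('a::real_normed_vector list \<Rightarrow> 'a \<Rightarrow> real) \<Rightarrow> 'a \<Rightarrow> bool" where
  "family_bounded j g x \<longleftrightarrow> (\<forall>r. \<exists>C. \<forall>vs\<in>bounded_lists r j. \<bar>g vs x\<bar> \<le> C)"

definition family_continuous :: "nat \<Rightarrow> ('a::real_normed_vector list \<Rightarrow> 'a \<Rightarrow> real) \<Rightarrow> 'a \<Rightarrow> bool" where
  "family_continuous j g x \<longleftrightarrow>
     (\<forall>r. uniformly_small (bounded_lists r j) (\<lambda>_. 1) (nhds x) (\<lambda>y vs. g vs y - g vs x))"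

text \<open>
  A family \<open>g\<close> indexed by lists of length \<open>j\<close> has as its derivative a family indexed by lists of length
  \<open>j + 1\<close>, whose head is the direction of differentiation.
\<close>

definition family_derivative ::
  "nat \<Rightarrow> ('a::real_normed_vector list \<Rightarrow> 'a \<Rightarrow> real) \<Rightarrow> ('a list \<Rightarrow> 'a \<Rightarrow> real) \<Rightarrow> 'a \<Rightarrow> bool" where
  "family_derivative j g g' x \<longleftrightarrow>
     (\<forall>vs. length vs = j \<longrightarrow> linear (\<lambda>v. g' (v # vs) x)) \<and>
     (\<forall>r. uniformly_small (bounded_lists r j) (\<lambda>y. norm (y - x)) (nhds x)
       (\<lambda>y vs. g vs y - g vs x - g' ((y - x) # vs) x))"

text \<open>
  Linearity in the list arguments is demanded only of the newly added direction. It is therefore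
  possible to form products and to reindex; for the family of a single function, multilinearity of all
  derivatives is automatic (\<open>smooth_family_derivative_multilinear\<close>).
\<close>

primrec smooth_family ::
  "nat \<Rightarrow> nat \<Rightarrow> ('a::real_normed_vector list \<Rightarrow> 'a \<Rightarrow> real) \<Rightarrow> 'a set \<Rightarrow> bool" where
  "smooth_family 0 j g S \<longleftrightarrow> (\<forall>x\<in>S. family_bounded j g x \<and> family_continuous j g x)"
| "smooth_family (Suc n) j g S \<longleftrightarrow> (\<forall>x\<in>S. family_bounded j g x) \<and>
     (\<exists>g'. (\<forall>x\<in>S. family_derivative j g g' x) \<and> smooth_family n (Suc j) g' S)"

text \<open>
  Boundedness on bounded lists and linearity in the head give an estimate by the norm of the head.
\<close>

lemma family_derivative_bound:
  assumes b: "family_bounded (Suc j) g' x" and d: "family_derivative j g g' x"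
  obtains C where "C \<ge> 0" "\<And>v vs. vs \<in> bounded_lists r j \<Longrightarrow> \<bar>g' (v # vs) x\<bar> \<le> C * norm v"
proof -
  obtain C where C: "\<And>ws. ws \<in> bounded_lists (max r 1) (Suc j) \<Longrightarrow> \<bar>g' ws x\<bar> \<le> C"
    using b unfolding family_bounded_def by blast
  have "\<bar>g' (v # vs) x\<bar> \<le> \<bar>C\<bar> * norm v" if vs: "vs \<in> bounded_lists r j" for v vs
  proof -
    have l: "linear (\<lambda>v. g' (v # vs) x)"
      using d vs by (auto simp: family_derivative_def bounded_lists_def)
    have "sgn v # vs \<in> bounded_lists (max r 1) (Suc j)"
      using vs bounded_lists_mono[of r "max r 1" j] by (auto simp: norm_sgn)
    from C[OF this] have "\<bar>g' (sgn v # vs) x\<bar> \<le> \<bar>C\<bar>" by simp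
    moreover have "g' (v # vs) x = norm v * g' (sgn v # vs) x"
    proof -
      have "norm v *\<^sub>R sgn v = v" by (cases "v = 0") (simp_all add: sgn_div_norm)
      then show ?thesis using linear_scale[OF l, of "norm v" "sgn v"] by simp
    qed
    ultimately show ?thesis
      by (simp add: abs_mult mult.commute[of "norm v"] mult_right_mono)
  qed
  then show ?thesis using that[of "\<bar>C\<bar>"] by simp
qed

lemma eventually_norm_diff_le:
  fixes x :: "'a::real_normed_vector"
  assumes "e > 0" shows "\<forall>\<^sub>F y in nhds x. norm (y - x) \<le> e"
  unfolding eventually_nhds_metric using assms by (intro exI[of _ e]) (auto simp: dist_norm)

lemma family_derivative_continuous:
  assumes b: "family_bounded (Suc j) g' x" and d: "family_derivative j g g' x"
  shows "family_continuous j g x"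
  unfolding family_continuous_def uniformly_small_def
proof (intro allI impI)
  fix r e :: real assume "e > 0"
  obtain C where C: "C \<ge> 0" "\<And>v vs. vs \<in> bounded_lists r j \<Longrightarrow> \<bar>g' (v # vs) x\<bar> \<le> C * norm v"
    using family_derivative_bound[OF b d] by metis
  have "\<forall>\<^sub>F y in nhds x. \<forall>vs\<in>bounded_lists r j.
      \<bar>g vs y - g vs x - g' ((y - x) # vs) x\<bar> \<le> 1 * norm (y - x)"
    using d unfolding family_derivative_def uniformly_small_def by (meson zero_less_one)
  moreover have "\<forall>\<^sub>F y in nhds x. norm (y - x) \<le> e / (1 + C)"
    using \<open>e > 0\<close> C(1) by (intro eventually_norm_diff_le) simp
  ultimately show "\<forall>\<^sub>F y in nhds x. \<forall>vs\<in>bounded_lists r j. \<bar>g vs y - g vs x\<bar> \<le> e * 1"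
  proof eventually_elim
    case (elim y)
    show ?case
    proof
      fix vs :: "'a list" assume vs: "vs \<in> bounded_lists r j"
      have "\<bar>g vs y - g vs x\<bar> \<le> 1 * norm (y - x) + C * norm (y - x)"
        using bspec[OF elim(1) vs] C(2)[OF vs, of "y - x"] by linarith
      also have "\<dots> \<le> e * 1" using elim(2) C(1) by (simp add: field_simps)
      finally show "\<bar>g vs y - g vs x\<bar> \<le> e * 1" .
    qed
  qed
qed

lemma smooth_family_bounded: "smooth_family n j g S \<Longrightarrow> x \<in> S \<Longrightarrow> family_bounded j g x"
  by (cases n) auto

lemma smooth_family_continuous: "smooth_family n j g S \<Longrightarrow> x \<in> S \<Longrightarrow> family_continuous j g x"
proof (cases n)
  case (Suc m)
  assume "smooth_family n j g S" "x \<in> S"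
  then obtain g' where "family_derivative j g g' x" "smooth_family m (Suc j) g' S"
    using Suc by auto
  then show ?thesis using family_derivative_continuous smooth_family_bounded \<open>x \<in> S\<close> by blast
qed auto

lemma smooth_family_SucD: "smooth_family (Suc n) j g S \<Longrightarrow> smooth_family n j g S"
proof (induction n arbitrary: j g)
  case 0
  then obtain g' where g': "\<forall>x\<in>S. family_derivative j g g' x" "\<forall>x\<in>S. family_bounded (Suc j) g' x"
    by auto
  then have "family_continuous j g x" if "x \<in> S" for x
    using family_derivative_continuous that by blast
  then show ?case using 0 by simp
next
  case (Suc n)
  then obtain g' where "\<forall>x\<in>S. family_derivative j g g' x" "smooth_family (Suc n) (Suc j) g' S"
    by (metis smooth_family.simps(2))
  then have "smooth_family n (Suc j) g' S" using Suc.IH by blast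
  moreover have "\<forall>x\<in>S. family_bounded j g x" using Suc.prems by simp
  ultimately show ?case using \<open>\<forall>x\<in>S. family_derivative j g g' x\<close> by (metis smooth_family.simps(2))
qed

lemma smooth_family_le: "smooth_family n j g S \<Longrightarrow> m \<le> n \<Longrightarrow> smooth_family m j g S"
  by (induction n) (metis le_0_eq, metis le_Suc_eq smooth_family_SucD)

lemma smooth_family_subset: "smooth_family n j g S \<Longrightarrow> S' \<subseteq> S \<Longrightarrow> smooth_family n j g S'"
proof (induction n arbitrary: j g)
  case (Suc n)
  then obtain g' where "\<forall>x\<in>S. family_derivative j g g' x" "smooth_family n (Suc j) g' S"
    by auto
  then have "\<forall>x\<in>S'. family_derivative j g g' x" "smooth_family n (Suc j) g' S'"
    using Suc.IH Suc.prems(2) by blast+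
  then show ?case using Suc.prems by auto
qed auto

lemma smooth_family_const:
  "(\<forall>r. \<exists>C. \<forall>vs\<in>bounded_lists r j. \<bar>a vs\<bar> \<le> C) \<Longrightarrow> smooth_family n j (\<lambda>vs x. a vs) S"
proof (induction n arbitrary: j a)
  case 0
  then show ?case by (simp add: family_bounded_def family_continuous_def uniformly_small_def)
next
  case (Suc n)
  have "smooth_family n (Suc j) (\<lambda>ws x. 0) S" by (rule Suc.IH) (auto intro: exI[of _ 0])
  moreover have "family_derivative j (\<lambda>vs x. a vs) (\<lambda>ws x. 0) x" for x
    by (auto simp: family_derivative_def uniformly_small_def linear_zero)
  ultimately show ?case using Suc.prems by (auto simp: family_bounded_def)
qed

lemma family_bounded_add:
  assumes "family_bounded j g x" "family_bounded j k x"
  shows "family_bounded j (\<lambda>vs y. g vs y + k vs y) x"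
  unfolding family_bounded_def
proof
  fix r
  obtain C D where "\<forall>vs\<in>bounded_lists r j. \<bar>g vs x\<bar> \<le> C" "\<forall>vs\<in>bounded_lists r j. \<bar>k vs x\<bar> \<le> D"
    using assms unfolding family_bounded_def by blast
  then have "\<forall>vs\<in>bounded_lists r j. \<bar>g vs x + k vs x\<bar> \<le> C + D"
    by (auto intro!: order_trans[OF abs_triangle_ineq] add_mono)
  then show "\<exists>C. \<forall>vs\<in>bounded_lists r j. \<bar>g vs x + k vs x\<bar> \<le> C" by blast
qed

lemma family_bounded_mult:
  assumes "family_bounded j g x" "family_bounded j k x"
  shows "family_bounded j (\<lambda>vs y. g vs y * k vs y) x"
  unfolding family_bounded_def
proof
  fix r
  obtain C D where "\<forall>vs\<in>bounded_lists r j. \<bar>g vs x\<bar> \<le> C" "\<forall>vs\<in>bounded_lists r j. \<bar>k vs x\<bar> \<le> D"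
    using assms unfolding family_bounded_def by blast
  then have "\<forall>vs\<in>bounded_lists r j. \<bar>g vs x * k vs x\<bar> \<le> C * D"
    unfolding abs_mult by (auto intro!: mult_mono order_trans[OF abs_ge_zero])
  then show "\<exists>C. \<forall>vs\<in>bounded_lists r j. \<bar>g vs x * k vs x\<bar> \<le> C" by blast
qed

lemma smooth_family_add:
  "smooth_family n j g S \<Longrightarrow> smooth_family n j k S \<Longrightarrow> smooth_family n j (\<lambda>vs x. g vs x + k vs x) S"
proof (induction n arbitrary: j g k)
  case 0
  have "(\<lambda>y vs. g vs y + k vs y - (g vs x + k vs x)) = (\<lambda>y vs. (g vs y - g vs x) + (k vs y - k vs x))" for x
    by (simp add: algebra_simps)
  with 0 show ?case
    by (auto intro: family_bounded_add uniformly_small_add simp: family_continuous_def)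
next
  case (Suc n)
  obtain g' k' where d: "\<forall>x\<in>S. family_derivative j g g' x" "\<forall>x\<in>S. family_derivative j k k' x"
      and s: "smooth_family n (Suc j) g' S" "smooth_family n (Suc j) k' S"
    using Suc.prems by auto
  have "family_derivative j (\<lambda>vs x. g vs x + k vs x) (\<lambda>ws x. g' ws x + k' ws x) x" if "x \<in> S" for x
  proof -
    have "(\<lambda>y vs. g vs y + k vs y - (g vs x + k vs x) - (g' ((y - x) # vs) x + k' ((y - x) # vs) x))
       = (\<lambda>y vs. (g vs y - g vs x - g' ((y - x) # vs) x) + (k vs y - k vs x - k' ((y - x) # vs) x))"
      by (simp add: algebra_simps)
    with d that show ?thesis
      by (auto simp: family_derivative_def intro: linear_compose_add uniformly_small_add)
  qed
  with Suc.IH[OF s] Suc.prems show ?case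
    by (auto intro: family_bounded_add)
qed

text \<open>
  Chain rule for a linear inner map, combined with a change of index. The two are proved together
  since differentiation turns the first into the second: the new direction \<open>v\<close> becomes the index entry
  \<open>P v\<close>.
\<close>

lemma smooth_family_precompose:
  fixes P :: "'a::real_normed_vector \<Rightarrow> 'b::real_normed_vector"
  assumes "bounded_linear P"
  shows "smooth_family n j g S \<Longrightarrow> P ` S' \<subseteq> S \<Longrightarrow>
    (\<And>r. \<exists>r'. \<forall>vs\<in>bounded_lists r j'. \<rho> vs \<in> bounded_lists r' j) \<Longrightarrow>
    smooth_family n j' (\<lambda>vs x. g (\<rho> vs) (P x)) S'"
proof (induction n arbitrary: j j' g \<rho>)
  interpret P: bounded_linear P by fact
  have nhds: "filterlim P (nhds (P x)) (nhds x)" for x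
    using P.isCont[OF continuous_ident, of x] by (simp add: continuous_at tendsto_at_iff_tendsto_nhds)
  case 0
  have "family_bounded j' (\<lambda>vs x. g (\<rho> vs) (P x)) x" "family_continuous j' (\<lambda>vs x. g (\<rho> vs) (P x)) x"
    if "x \<in> S'" for x
  proof -
    have x: "family_bounded j g (P x)" "family_continuous j g (P x)"
      using 0(1,2) that by auto
    show "family_bounded j' (\<lambda>vs x. g (\<rho> vs) (P x)) x"
      using x(1) 0(3) unfolding family_bounded_def by meson
    show "family_continuous j' (\<lambda>vs x. g (\<rho> vs) (P x)) x"
      unfolding family_continuous_def uniformly_small_def
    proof (intro allI impI)
      fix r e :: real assume "e > 0"
      obtain r' where r': "\<forall>vs\<in>bounded_lists r j'. \<rho> vs \<in> bounded_lists r' j" using 0(3) by blast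
      have "\<forall>\<^sub>F y in nhds (P x). \<forall>vs\<in>bounded_lists r' j. \<bar>g vs y - g vs (P x)\<bar> \<le> e * 1"
        using x(2) \<open>e > 0\<close> unfolding family_continuous_def uniformly_small_def by blast
      from eventually_compose_filterlim[OF this nhds]
      show "\<forall>\<^sub>F y in nhds x. \<forall>vs\<in>bounded_lists r j'. \<bar>g (\<rho> vs) (P y) - g (\<rho> vs) (P x)\<bar> \<le> e * 1"
        by eventually_elim (use r' in blast)
    qed
  qed
  then show ?case by simp
next
  interpret P: bounded_linear P by fact
  have nhds: "filterlim P (nhds (P x)) (nhds x)" for x
    using P.isCont[OF continuous_ident, of x] by (simp add: continuous_at tendsto_at_iff_tendsto_nhds)
  obtain K where K: "K \<ge> 0" "\<And>v. norm (P v) \<le> norm v * K" using P.nonneg_bounded by blast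
  case (Suc n)
  obtain g' where d: "\<forall>x\<in>S. family_derivative j g g' x" and s: "smooth_family n (Suc j) g' S"
    using Suc.prems(1) by auto
  have len: "length (\<rho> vs) = j" if len: "length vs = j'" for vs
  proof -
    obtain r where r: "vs \<in> bounded_lists r j'" using ex_bounded_lists[OF len] by blast
    obtain r' where "\<forall>vs\<in>bounded_lists r j'. \<rho> vs \<in> bounded_lists r' j" using Suc.prems(3) by blast
    with r show ?thesis by (auto simp: bounded_lists_def)
  qed
  let ?g' = "\<lambda>ws x. g' (P (hd ws) # \<rho> (tl ws)) (P x)"
  have "smooth_family n (Suc j') ?g' S'"
  proof (rule Suc.IH[OF s Suc.prems(2)])
    fix r
    obtain r' where r': "\<forall>vs\<in>bounded_lists r j'. \<rho> vs \<in> bounded_lists r' j" using Suc.prems(3) by blast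
    have "P (hd ws) # \<rho> (tl ws) \<in> bounded_lists (max r' (r * K)) (Suc j)"
      if ws: "ws \<in> bounded_lists r (Suc j')" for ws
    proof -
      obtain v vs where v: "ws = v # vs" "norm v \<le> r" "vs \<in> bounded_lists r j'"
        using ws by (rule bounded_lists_SucE)
      have "norm (P v) \<le> r * K" using K(2)[of v] v(2) K(1) by (meson mult_right_mono order_trans)
      then show ?thesis
        using v r' bounded_lists_mono[of r' "max r' (r * K)" j] by auto
    qed
    then show "\<exists>r'. \<forall>ws\<in>bounded_lists r (Suc j'). P (hd ws) # \<rho> (tl ws) \<in> bounded_lists r' (Suc j)"
      by blast
  qed
  moreover have "family_bounded j' (\<lambda>vs x. g (\<rho> vs) (P x)) x"
    "family_derivative j' (\<lambda>vs x. g (\<rho> vs) (P x)) ?g' x" if "x \<in> S'" for x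
  proof -
    have x: "family_bounded j g (P x)" "family_derivative j g g' (P x)"
      using Suc.prems(1,2) d that by auto
    show "family_bounded j' (\<lambda>vs x. g (\<rho> vs) (P x)) x"
      using x(1) Suc.prems(3) unfolding family_bounded_def by meson
    have "linear (\<lambda>v. g' (P v # \<rho> vs) (P x))" if "length vs = j'" for vs
      using x(2) len[OF that] linear_compose[OF P.linear, of "\<lambda>v. g' (v # \<rho> vs) (P x)"]
      by (simp add: family_derivative_def o_def)
    moreover have "\<forall>\<^sub>F y in nhds x. \<forall>vs\<in>bounded_lists r j'.
        \<bar>g (\<rho> vs) (P y) - g (\<rho> vs) (P x) - g' (P (y - x) # \<rho> vs) (P x)\<bar> \<le> e * norm (y - x)"
      if "e > 0" for r e :: real
    proof -
      obtain r' where r': "\<forall>vs\<in>bounded_lists r j'. \<rho> vs \<in> bounded_lists r' j" using Suc.prems(3) by blast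
      have "e / (K + 1) > 0" using \<open>e > 0\<close> K(1) by simp
      then have "\<forall>\<^sub>F y in nhds (P x). \<forall>vs\<in>bounded_lists r' j.
          \<bar>g vs y - g vs (P x) - g' ((y - P x) # vs) (P x)\<bar> \<le> e / (K + 1) * norm (y - P x)"
        using x(2) unfolding family_derivative_def uniformly_small_def by blast
      from eventually_compose_filterlim[OF this nhds]
      show ?thesis
      proof eventually_elim
        case (elim y)
        have "e / (K + 1) * norm (P y - P x) \<le> e / (K + 1) * (norm (y - x) * K)"
          using K(2)[of "y - x"] \<open>e / (K + 1) > 0\<close> by (intro mult_left_mono) (simp_all add: P.diff)
        also have "\<dots> = (e * norm (y - x)) * (K / (K + 1))" by simp
        also have "\<dots> \<le> e * norm (y - x)" using K(1) \<open>e > 0\<close> by (intro mult_left_le) auto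
        finally have le: "e / (K + 1) * norm (P y - P x) \<le> e * norm (y - x)" .
        show ?case
        proof
          fix vs :: "'a list" assume "vs \<in> bounded_lists r j'"
          with r' elim have "\<bar>g (\<rho> vs) (P y) - g (\<rho> vs) (P x) - g' ((P y - P x) # \<rho> vs) (P x)\<bar>
              \<le> e / (K + 1) * norm (P y - P x)" by blast
          with le show "\<bar>g (\<rho> vs) (P y) - g (\<rho> vs) (P x) - g' (P (y - x) # \<rho> vs) (P x)\<bar> \<le> e * norm (y - x)"
            by (simp add: P.diff)
        qed
      qed
    qed
    ultimately show "family_derivative j' (\<lambda>vs x. g (\<rho> vs) (P x)) ?g' x"
      by (simp add: family_derivative_def uniformly_small_def)
  qed
  ultimately show ?case by auto
qed

lemma smooth_family_tl:
  assumes "smooth_family n j g S"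
  shows "smooth_family n (Suc j) (\<lambda>ws. g (tl ws)) S"
proof (rule smooth_family_precompose[OF bounded_linear_ident assms])
  show "\<exists>r'. \<forall>ws\<in>bounded_lists r (Suc j). tl ws \<in> bounded_lists r' j" for r
    by (intro exI[of _ r]) (auto elim!: bounded_lists_SucE)
qed simp

lemma eventually_family_bounded:
  assumes "family_bounded j k x" "family_continuous j k x"
  obtains C where "\<forall>\<^sub>F y in nhds x. \<forall>vs\<in>bounded_lists r j. \<bar>k vs y\<bar> \<le> C * 1"
proof -
  obtain C where C: "\<forall>vs\<in>bounded_lists r j. \<bar>k vs x\<bar> \<le> C"
    using assms(1) unfolding family_bounded_def by blast
  have "\<forall>\<^sub>F y in nhds x. \<forall>vs\<in>bounded_lists r j. \<bar>k vs y - k vs x\<bar> \<le> 1 * 1"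
    using assms(2) unfolding family_continuous_def uniformly_small_def by (meson zero_less_one)
  then have "\<forall>\<^sub>F y in nhds x. \<forall>vs\<in>bounded_lists r j. \<bar>k vs y\<bar> \<le> (C + 1) * 1"
    by eventually_elim (use C in \<open>force simp: abs_le_iff\<close>)
  then show ?thesis using that by blast
qed

text \<open>
  The derivative is a sum of products of families that are smooth of one order less, in which the
  undifferentiated factor ignores the head of the list; so induction on the order applies.
\<close>

lemma smooth_family_mult:
  "smooth_family n j g S \<Longrightarrow> smooth_family n j k S \<Longrightarrow> smooth_family n j (\<lambda>vs x. g vs x * k vs x) S"
proof (induction n arbitrary: j g k)
  case 0
  have "family_continuous j (\<lambda>vs x. g vs x * k vs x) x" if "x \<in> S" for x
    unfolding family_continuous_def
  proof
    fix r
    have x: "family_bounded j g x" "family_bounded j k x" "family_continuous j g x" "family_continuous j k x"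
      using 0 that by auto
    obtain C where C: "\<forall>\<^sub>F y in nhds x. \<forall>vs\<in>bounded_lists r j. \<bar>k vs y\<bar> \<le> C * 1"
      using eventually_family_bounded[OF x(2,4)] by blast
    obtain D where "\<forall>vs\<in>bounded_lists r j. \<bar>g vs x\<bar> \<le> D" using x(1) by (auto simp: family_bounded_def)
    then have D: "\<forall>\<^sub>F y in nhds x. \<forall>vs\<in>bounded_lists r j. \<bar>g vs x\<bar> \<le> D * 1" by simp
    have "uniformly_small (bounded_lists r j) (\<lambda>_. 1 * 1) (nhds x)
        (\<lambda>y vs. (g vs y - g vs x) * k vs y + (k vs y - k vs x) * g vs x)"
      using x(3,4) unfolding family_continuous_def
      by (intro uniformly_small_add uniformly_small_times_bigO[OF _ C] uniformly_small_times_bigO[OF _ D]) auto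
    moreover have "(\<lambda>y vs. (g vs y - g vs x) * k vs y + (k vs y - k vs x) * g vs x) =
        (\<lambda>y vs. g vs y * k vs y - g vs x * k vs x)" by (simp add: algebra_simps)
    ultimately show "uniformly_small (bounded_lists r j) (\<lambda>_. 1) (nhds x)
        (\<lambda>y vs. g vs y * k vs y - g vs x * k vs x)" by simp
  qed
  with 0 show ?case by (auto intro: family_bounded_mult)
next
  case (Suc n)
  obtain g' k' where d: "\<forall>x\<in>S. family_derivative j g g' x" "\<forall>x\<in>S. family_derivative j k k' x"
      and s: "smooth_family n (Suc j) g' S" "smooth_family n (Suc j) k' S"
    using Suc.prems by auto
  let ?p = "\<lambda>ws x. g' ws x * k (tl ws) x + g (tl ws) x * k' ws x"
  have "smooth_family n (Suc j) ?p S"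
    by (intro smooth_family_add Suc.IH s smooth_family_tl Suc.prems[THEN smooth_family_SucD])
  moreover have "family_derivative j (\<lambda>vs x. g vs x * k vs x) ?p x" if "x \<in> S" for x
    unfolding family_derivative_def
  proof (intro conjI allI impI)
    have lin: "linear (\<lambda>v. g' (v # vs) x)" "linear (\<lambda>v. k' (v # vs) x)" if "length vs = j" for vs
      using d that \<open>x \<in> S\<close> by (auto simp: family_derivative_def)
    show "linear (\<lambda>v. g' (v # vs) x * k (tl (v # vs)) x + g (tl (v # vs)) x * k' (v # vs) x)"
      if "length vs = j" for vs
      using lin[OF that] by (auto simp: linear_iff algebra_simps)
    fix r
    have b: "family_bounded j g x" "family_bounded j k x" "family_continuous j k x"
        "family_bounded (Suc j) g' x"
      using Suc.prems(1)[THEN smooth_family_bounded, OF that] Suc.prems(2)[THEN smooth_family_bounded, OF that]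
        Suc.prems(2)[THEN smooth_family_continuous, OF that] s(1)[THEN smooth_family_bounded, OF that]
      by blast+
    have dx: "family_derivative j g g' x" "family_derivative j k k' x" using d that by auto
    obtain C where C: "\<forall>\<^sub>F y in nhds x. \<forall>vs\<in>bounded_lists r j. \<bar>k vs y\<bar> \<le> C * 1"
      using eventually_family_bounded[OF b(2,3)] by blast
    obtain D where "\<forall>vs\<in>bounded_lists r j. \<bar>g vs x\<bar> \<le> D" using b(1) by (auto simp: family_bounded_def)
    then have D: "\<forall>\<^sub>F y in nhds x. \<forall>vs\<in>bounded_lists r j. \<bar>g vs x\<bar> \<le> D * 1" by simp
    obtain E where "\<And>v vs. vs \<in> bounded_lists r j \<Longrightarrow> \<bar>g' (v # vs) x\<bar> \<le> E * norm v"
      using family_derivative_bound[OF b(4) dx(1)] by metis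
    then have E: "\<forall>\<^sub>F y in nhds x. \<forall>vs\<in>bounded_lists r j. \<bar>g' ((y - x) # vs) x\<bar> \<le> E * norm (y - x)"
      by simp
    \<comment> \<open>The remainder of the product: two remainders times bounded factors, and one mixed term.\<close>
    let ?f = "\<lambda>y vs. (g vs y - g vs x - g' ((y - x) # vs) x) * k vs y"
    let ?h = "\<lambda>y vs. (k vs y - k vs x - k' ((y - x) # vs) x) * g vs x"
    let ?m = "\<lambda>y vs. (k vs y - k vs x) * g' ((y - x) # vs) x"
    have f: "uniformly_small (bounded_lists r j) (\<lambda>y. norm (y - x) * 1) (nhds x) ?f"
      by (rule uniformly_small_times_bigO[OF _ C]) (use dx in \<open>auto simp: family_derivative_def\<close>)
    have h: "uniformly_small (bounded_lists r j) (\<lambda>y. norm (y - x) * 1) (nhds x) ?h"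
      by (rule uniformly_small_times_bigO[OF _ D]) (use dx in \<open>auto simp: family_derivative_def\<close>)
    have m: "uniformly_small (bounded_lists r j) (\<lambda>y. 1 * norm (y - x)) (nhds x) ?m"
      by (rule uniformly_small_times_bigO[OF _ E]) (use b(3) in \<open>auto simp: family_continuous_def\<close>)
    have eq: "(\<lambda>y vs. g vs y * k vs y - g vs x * k vs x
          - (g' ((y - x) # vs) x * k (tl ((y - x) # vs)) x + g (tl ((y - x) # vs)) x * k' ((y - x) # vs) x))
        = (\<lambda>y vs. (?f y vs + ?h y vs) + ?m y vs)"
      by (simp add: fun_eq_iff algebra_simps)
    show "uniformly_small (bounded_lists r j) (\<lambda>y. norm (y - x)) (nhds x)
       (\<lambda>y vs. g vs y * k vs y - g vs x * k vs x
          - (g' ((y - x) # vs) x * k (tl ((y - x) # vs)) x + g (tl ((y - x) # vs)) x * k' ((y - x) # vs) x))"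
      unfolding eq using f h m by (intro uniformly_small_add) simp_all
  qed
  ultimately show ?case using Suc.prems by (auto intro: family_bounded_mult)
qed

lemma family_derivative_has_derivative:
  assumes b: "family_bounded (Suc j) g' x" and d: "family_derivative j g g' x" and l: "length vs = j"
  shows "(g vs has_derivative (\<lambda>v. g' (v # vs) x)) (at x)"
proof -
  obtain r where r: "vs \<in> bounded_lists r j" using ex_bounded_lists[OF l] by blast
  obtain C where C: "\<And>v vs. vs \<in> bounded_lists r j \<Longrightarrow> \<bar>g' (v # vs) x\<bar> \<le> C * norm v"
    using family_derivative_bound[OF b d] by metis
  have lin: "linear (\<lambda>v. g' (v # vs) x)" using d l by (auto simp: family_derivative_def)
  have "bounded_linear (\<lambda>v. g' (v # vs) x)"
    using lin C[OF r] by (intro bounded_linear.intro bounded_linear_axioms.intro) (auto simp: mult.commute)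
  moreover have "\<exists>d>0. \<forall>y. norm (y - x) < d \<longrightarrow> norm (g vs y - g vs x - g' ((y - x) # vs) x) \<le> e * norm (y - x)"
    if "e > 0" for e
  proof -
    have "\<forall>\<^sub>F y in nhds x. \<forall>vs\<in>bounded_lists r j. \<bar>g vs y - g vs x - g' ((y - x) # vs) x\<bar> \<le> e * norm (y - x)"
      using d that unfolding family_derivative_def uniformly_small_def by blast
    then show ?thesis using r unfolding eventually_nhds_metric by (auto simp: dist_norm)
  qed
  ultimately show ?thesis unfolding has_derivative_at_alt by blast
qed

lemma family_derivative_0I:
  assumes "(g [] has_derivative (\<lambda>v. g' [v] x)) (at x)"
  shows "family_derivative 0 g g' x"
proof -
  have "\<forall>\<^sub>F y in nhds x. \<bar>g [] y - g [] x - g' [y - x] x\<bar> \<le> e * norm (y - x)" if "e > 0" for e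
    using assms that unfolding has_derivative_at_alt eventually_nhds_metric by (auto simp: dist_norm)
  then show ?thesis
    using has_derivative_linear[OF assms] by (simp add: family_derivative_def uniformly_small_def)
qed

lemma family_continuous_0: "family_continuous 0 g x \<longleftrightarrow> isCont (g []) x"
  unfolding continuous_at tendsto_at_iff_tendsto_nhds
proof
  assume c: "family_continuous 0 g x"
  show "(g [] \<longlongrightarrow> g [] x) (nhds x)"
  proof (rule tendstoI)
    fix e :: real assume "e > 0"
    then have "e / 2 > 0" by simp
    moreover have "\<forall>e>0. \<forall>\<^sub>F y in nhds x. \<bar>g [] y - g [] x\<bar> \<le> e"
      using c unfolding family_continuous_def uniformly_small_def by simp
    ultimately have "\<forall>\<^sub>F y in nhds x. \<bar>g [] y - g [] x\<bar> \<le> e / 2" by blast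
    then show "\<forall>\<^sub>F y in nhds x. dist (g [] y) (g [] x) < e"
      by eventually_elim (use \<open>e > 0\<close> in \<open>simp add: dist_real_def\<close>)
  qed
next
  assume c: "(g [] \<longlongrightarrow> g [] x) (nhds x)"
  have "\<forall>\<^sub>F y in nhds x. \<bar>g [] y - g [] x\<bar> \<le> e" if "e > 0" for e
    using tendstoD[OF c that] by eventually_elim (simp add: dist_real_def)
  then show "family_continuous 0 g x"
    by (simp add: family_continuous_def uniformly_small_def)
qed

text \<open>
  Chain rule for an outer real function, given with all its derivatives \<open>\<phi> i\<close>. The derivative of
  \<open>\<phi> i \<circ> f\<close> is the product of \<open>\<phi> (i + 1) \<circ> f\<close> and the derivative of \<open>f\<close>; to have the induction hypothesis
  for the first factor the claim is made for all \<open>i\<close> simultaneously.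
\<close>

lemma smooth_family_compose_real:
  fixes f :: "'a::real_normed_vector \<Rightarrow> real"
  assumes \<phi>: "\<And>i t. t \<in> T \<Longrightarrow> (\<phi> i has_real_derivative \<phi> (Suc i) t) (at t)"
    and fT: "f ` S \<subseteq> T"
  shows "smooth_family n 0 (\<lambda>_. f) S \<Longrightarrow> smooth_family n 0 (\<lambda>_ x. \<phi> i (f x)) S"
proof (induction n arbitrary: i)
  case 0
  have "isCont (\<lambda>x. \<phi> i (f x)) x" if "x \<in> S" for x
  proof (rule isCont_o2[where g = "\<phi> i" and f = f])
    show "isCont f x" using 0 that by (simp add: family_continuous_0)
    show "isCont (\<phi> i) (f x)" using \<phi>[of "f x" i] fT that by (blast intro: DERIV_isCont)
  qed
  then show ?case by (auto simp: family_continuous_0 family_bounded_def)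
next
  case (Suc n)
  obtain f' where d: "\<forall>x\<in>S. family_derivative 0 (\<lambda>_. f) f' x" and s: "smooth_family n (Suc 0) f' S"
    using Suc.prems by auto
  let ?d = "\<lambda>ws x. \<phi> (Suc i) (f x) * f' ws x"
  have "smooth_family n (Suc 0) ?d S"
    using smooth_family_tl[OF Suc.IH[OF smooth_family_SucD[OF Suc.prems]], of "Suc i"] s
    by (rule smooth_family_mult)
  moreover have "family_derivative 0 (\<lambda>_ x. \<phi> i (f x)) ?d x" if "x \<in> S" for x
  proof (rule family_derivative_0I)
    have "(f has_derivative (\<lambda>v. f' [v] x)) (at x)"
      using family_derivative_has_derivative[of 0 f' x "\<lambda>_. f" "[]"] d s that smooth_family_bounded by blast
    moreover have "(\<phi> i has_derivative (\<lambda>v. \<phi> (Suc i) (f x) * v)) (at (f x))"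
      using \<phi>[of "f x" i] fT that unfolding has_field_derivative_def by blast
    ultimately show "((\<lambda>x. \<phi> i (f x)) has_derivative (\<lambda>v. \<phi> (Suc i) (f x) * f' [v] x)) (at x)"
      by (rule has_derivative_compose)
  qed
  ultimately show ?case by (auto simp: family_bounded_def)
qed

lemma smooth_family_cong:
  assumes "open S"
  shows "smooth_family n j g S \<Longrightarrow> (\<And>x vs. x \<in> S \<Longrightarrow> length vs = j \<Longrightarrow> h vs x = g vs x) \<Longrightarrow>
    smooth_family n j h S"
proof -
  assume g: "smooth_family n j g S" and h: "\<And>x vs. x \<in> S \<Longrightarrow> length vs = j \<Longrightarrow> h vs x = g vs x"
  have len: "length vs = j" if "vs \<in> bounded_lists r j" for vs r using that by (simp add: bounded_lists_def)
  have ev: "\<forall>\<^sub>F y in nhds x. y \<in> S" if "x \<in> S" for x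
    using assms that by (rule eventually_nhds_in_open)
  have b: "family_bounded j h x" if "x \<in> S" for x
    using smooth_family_bounded[OF g that] h[OF that] len
    unfolding family_bounded_def by (metis (no_types, lifting))
  show ?thesis
  proof (cases n)
    case 0
    have "family_continuous j h x" if "x \<in> S" for x
      unfolding family_continuous_def uniformly_small_def
    proof (intro allI impI)
      fix r e :: real assume "e > 0"
      then have "\<forall>\<^sub>F y in nhds x. \<forall>vs\<in>bounded_lists r j. \<bar>g vs y - g vs x\<bar> \<le> e * 1"
        using smooth_family_continuous[OF g that] unfolding family_continuous_def uniformly_small_def by blast
      with ev[OF that] show "\<forall>\<^sub>F y in nhds x. \<forall>vs\<in>bounded_lists r j. \<bar>h vs y - h vs x\<bar> \<le> e * 1"
        by eventually_elim (simp add: h that len)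
    qed
    then show ?thesis using 0 b by simp
  next
    case (Suc m)
    then obtain g' where d: "\<forall>x\<in>S. family_derivative j g g' x" and s: "smooth_family m (Suc j) g' S"
      using g by auto
    have "family_derivative j h g' x" if "x \<in> S" for x
      unfolding family_derivative_def uniformly_small_def
    proof (intro conjI allI impI)
      show "linear (\<lambda>v. g' (v # vs) x)" if "length vs = j" for vs
        using d that \<open>x \<in> S\<close> by (auto simp: family_derivative_def)
      fix r e :: real assume "e > 0"
      then have "\<forall>\<^sub>F y in nhds x. \<forall>vs\<in>bounded_lists r j.
          \<bar>g vs y - g vs x - g' ((y - x) # vs) x\<bar> \<le> e * norm (y - x)"
        using d that unfolding family_derivative_def uniformly_small_def by blast
      with ev[OF that] show "\<forall>\<^sub>F y in nhds x. \<forall>vs\<in>bounded_lists r j.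
          \<bar>h vs y - h vs x - g' ((y - x) # vs) x\<bar> \<le> e * norm (y - x)"
        by eventually_elim (simp add: h that len)
    qed
    then show ?thesis using Suc b s by auto
  qed
qed

text \<open>
  Derivatives chosen on the members of an open cover agree where the members overlap, because
  derivatives are unique.
\<close>

lemma smooth_family_local:
  assumes "open S"
  shows "(\<And>x. x \<in> S \<Longrightarrow> \<exists>U. open U \<and> x \<in> U \<and> smooth_family n j g U) \<Longrightarrow> smooth_family n j g S"
proof (induction n arbitrary: j g)
  case 0
  then show ?case by (metis smooth_family.simps(1))
next
  case (Suc n)
  then obtain U where U: "\<And>x. x \<in> S \<Longrightarrow> open (U x) \<and> x \<in> U x \<and> smooth_family (Suc n) j g (U x)" by metis
  then have "\<forall>x\<in>S. \<exists>G. (\<forall>y\<in>U x. family_derivative j g G y) \<and> smooth_family n (Suc j) G (U x)" by auto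
  then obtain G where G: "\<And>x y. x \<in> S \<Longrightarrow> y \<in> U x \<Longrightarrow> family_derivative j g (G x) y"
      "\<And>x. x \<in> S \<Longrightarrow> smooth_family n (Suc j) (G x) (U x)" by metis
  \<comment> \<open>On \<open>U x\<close> this coincides with \<open>G x\<close>, by uniqueness.\<close>
  define g' where "g' ws x = G x ws x" for ws x
  have hd: "(g vs has_derivative (\<lambda>v. G x (v # vs) y)) (at y)" if "x \<in> S" "y \<in> U x" "length vs = j" for x y vs
    using family_derivative_has_derivative[OF _ G(1)] smooth_family_bounded[OF G(2)] that by blast
  have eq: "g' ws y = G x ws y" if "x \<in> S" "y \<in> U x \<inter> S" "length ws = Suc j" for x y ws
  proof -
    have "length ws = Suc j" by fact
    then obtain v vs where ws: "ws = v # vs" "length vs = j" by (auto simp: length_Suc_conv)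
    have "(\<lambda>v. G x (v # vs) y) = (\<lambda>v. G y (v # vs) y)"
      using hd[of x y vs] hd[of y y vs] that U ws(2) by (intro has_derivative_unique) auto
    then show ?thesis unfolding g'_def ws(1) by metis
  qed
  have "smooth_family n (Suc j) g' S"
  proof (rule Suc.IH)
    fix x assume x: "x \<in> S"
    have "smooth_family n (Suc j) (G x) (U x \<inter> S)"
      using smooth_family_subset[OF G(2)[OF x]] by blast
    then have "smooth_family n (Suc j) g' (U x \<inter> S)"
      using eq[OF x] U[OF x] assms by (intro smooth_family_cong[of "U x \<inter> S" n "Suc j" "G x" g']) auto
    then show "\<exists>V. open V \<and> x \<in> V \<and> smooth_family n (Suc j) g' V"
      using U[OF x] x assms by (intro exI[of _ "U x \<inter> S"]) auto
  qed
  moreover have "family_derivative j g g' x" if "x \<in> S" for x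
    using G(1)[OF that] U[OF that] unfolding family_derivative_def g'_def by blast
  moreover have "family_bounded j g x" if "x \<in> S" for x
    using U[OF that] smooth_family_bounded by blast
  ultimately show ?case by auto
qed

section \<open>Smooth families and iterated derivatives\<close>

definition multilinear :: "nat \<Rightarrow> ('a::real_vector list \<Rightarrow> real) \<Rightarrow> bool" where
  "multilinear j A \<longleftrightarrow> (\<forall>vs. length vs = j \<longrightarrow> (\<forall>i<j. linear (\<lambda>v. A (vs[i := v]))))"

lemma multilinear_Cons:
  assumes "multilinear (Suc j) A"
  shows "multilinear j (\<lambda>vs. A (v # vs))"
  unfolding multilinear_def
proof (intro allI impI)
  fix vs :: "'a list" and i assume "length vs = j" "i < j"
  then have "linear (\<lambda>w. A ((v # vs)[Suc i := w]))"
    using assms unfolding multilinear_def by (metis Suc_less_eq length_Cons)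
  then show "linear (\<lambda>w. A (v # vs[i := w]))" by simp
qed

lemma multilinear_hd:
  assumes "multilinear (Suc j) A" "length vs = j"
  shows "linear (\<lambda>v. A (v # vs))"
proof -
  have "linear (\<lambda>v. A ((0 # vs)[0 := v]))"
    using assms unfolding multilinear_def by (metis length_Cons zero_less_Suc)
  then show ?thesis by simp
qed

text \<open>
  Normalise the arguments one by one.
\<close>

lemma multilinear_le_prod_norm:
  assumes "multilinear j A" and "\<And>vs. vs \<in> bounded_lists 1 j \<Longrightarrow> \<bar>A vs\<bar> \<le> C" and "length vs = j"
  shows "\<bar>A vs\<bar> \<le> C * prod_list (map norm vs)"
  using assms
proof (induction j arbitrary: A vs)
  case 0
  then show ?case by simp
next
  case (Suc j)
  obtain v ws where vs: "vs = v # ws" "length ws = j" using Suc.prems(3) by (auto simp: length_Suc_conv)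
  have "\<bar>A (sgn v # ws)\<bar> \<le> C * prod_list (map norm ws)"
  proof (rule Suc.IH[OF multilinear_Cons[OF Suc.prems(1)] _ vs(2)])
    show "\<bar>A (sgn v # us)\<bar> \<le> C" if "us \<in> bounded_lists 1 j" for us
      using that by (intro Suc.prems(2)) (simp add: norm_sgn)
  qed
  moreover have "norm v *\<^sub>R sgn v = v" by (cases "v = 0") (simp_all add: sgn_div_norm)
  then have "A vs = norm v * A (sgn v # ws)"
    using linear_scale[OF multilinear_hd[OF Suc.prems(1) vs(2)], of "norm v" "sgn v"] vs(1) by simp
  then have "\<bar>A vs\<bar> = norm v * \<bar>A (sgn v # ws)\<bar>" by (simp add: abs_mult)
  ultimately have "\<bar>A vs\<bar> \<le> norm v * (C * prod_list (map norm ws))"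
    by (simp add: mult_left_mono)
  then show ?case by (simp add: vs(1) mult.left_commute)
qed

lemma prod_norm_le:
  "vs \<in> bounded_lists r j \<Longrightarrow> prod_list (map norm vs) \<le> (max 1 r) ^ j"
proof (induction j arbitrary: vs)
  case (Suc j)
  obtain v ws where vs: "vs = v # ws" "norm v \<le> r" "ws \<in> bounded_lists r j"
    using Suc.prems by (rule bounded_lists_SucE)
  have "norm v * prod_list (map norm ws) \<le> max 1 r * (max 1 r) ^ j"
    using vs Suc.IH[OF vs(3)] by (intro mult_mono) (auto intro!: prod_list_nonneg)
  then show ?case by (simp add: vs(1))
qed simp

lemma multilinear_norm_le:
  assumes "\<And>vs. vs \<in> bounded_lists 1 j \<Longrightarrow> \<bar>A vs\<bar> \<le> e"
  shows "multilinear_norm j A \<le> e" and "0 \<le> multilinear_norm j A"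
proof -
  have I: "{vs. length vs = j \<and> (\<forall>v\<in>set vs. norm v \<le> 1)} = (bounded_lists 1 j :: 'a list set)"
    by (simp add: bounded_lists_def)
  have ne: "replicate j (0::'a) \<in> bounded_lists 1 j" by (simp add: bounded_lists_def)
  show "multilinear_norm j A \<le> e"
    unfolding multilinear_norm_def I using ne assms by (intro cSUP_least) auto
  have "bdd_above ((\<lambda>vs. \<bar>A vs\<bar>) ` bounded_lists 1 j)" using assms by (auto intro!: bdd_aboveI2)
  from cSUP_upper[OF ne this] show "0 \<le> multilinear_norm j A"
    unfolding multilinear_norm_def I by linarith
qed

lemma multilinear_norm_ge:
  assumes "bounded_multilinear_form j A" "length vs = j"
  shows "\<bar>A vs\<bar> \<le> multilinear_norm j A * prod_list (map norm vs)"
proof (rule multilinear_le_prod_norm[OF _ _ assms(2)])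
  show "multilinear j A" using assms(1) by (simp add: bounded_multilinear_form_def multilinear_def)
  obtain C where C: "\<And>vs. length vs = j \<Longrightarrow> \<bar>A vs\<bar> \<le> C * prod_list (map norm vs)"
    using assms(1) unfolding bounded_multilinear_form_def by blast
  have I: "{vs. length vs = j \<and> (\<forall>v\<in>set vs. norm v \<le> 1)} = (bounded_lists 1 j :: 'a list set)"
    by (simp add: bounded_lists_def)
  have "\<bar>A vs\<bar> \<le> \<bar>C\<bar>" if "vs \<in> bounded_lists 1 j" for vs
  proof -
    have "\<bar>A vs\<bar> \<le> C * prod_list (map norm vs)" using C that by (simp add: bounded_lists_def)
    also have "\<dots> \<le> \<bar>C\<bar> * prod_list (map norm vs)"
      by (intro mult_right_mono) (auto intro!: prod_list_nonneg)
    also have "\<dots> \<le> \<bar>C\<bar> * 1"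
      using prod_norm_le[OF that] by (intro mult_left_mono) simp_all
    finally show ?thesis by simp
  qed
  then have "bdd_above ((\<lambda>vs. \<bar>A vs\<bar>) ` bounded_lists 1 j)" by (auto intro!: bdd_aboveI2)
  then show "\<bar>A vs\<bar> \<le> multilinear_norm j A" if "vs \<in> bounded_lists 1 j" for vs
    unfolding multilinear_norm_def I using that by (intro cSUP_upper)
qed

text \<open>
  In the old arguments the derivative inherits linearity from \<open>g\<close>, as the derivative of a sum and of a
  multiple; in the new one it is linear by definition.
\<close>

lemma smooth_family_derivative_multilinear:
  assumes S: "open S" "x \<in> S" and b: "family_bounded (Suc j) g' x" and d: "family_derivative j g g' x"
    and m: "\<And>y. y \<in> S \<Longrightarrow> multilinear j (\<lambda>vs. g vs y)"
  shows "multilinear (Suc j) (\<lambda>ws. g' ws x)"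
  unfolding multilinear_def
proof (intro allI impI)
  fix ws :: "'a list" and i assume "length ws = Suc j" "i < Suc j"
  then obtain v vs where ws: "ws = v # vs" "length vs = j" by (auto simp: length_Suc_conv)
  have hd: "(g us has_derivative (\<lambda>v. g' (v # us) x)) (at x)" if "length us = j" for us
    by (rule family_derivative_has_derivative[OF b d that])
  show "linear (\<lambda>w. g' (ws[i := w]) x)"
  proof (cases i)
    case 0
    then show ?thesis using d ws by (simp add: family_derivative_def)
  next
    case (Suc k)
    with \<open>i < Suc j\<close> have k: "k < j" by simp
    have lin: "linear (\<lambda>w. g (vs[k := w]) y)" if "y \<in> S" for y
      using m[OF that] k ws(2) by (simp add: multilinear_def)
    have "g' (v # vs[k := a + c]) x = g' (v # vs[k := a]) x + g' (v # vs[k := c]) x" for a c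
    proof -
      have "((\<lambda>y. g (vs[k := a]) y + g (vs[k := c]) y) has_derivative
          (\<lambda>v. g' (v # vs[k := a]) x + g' (v # vs[k := c]) x)) (at x)"
        using ws(2) by (intro has_derivative_add hd) simp_all
      then have "(g (vs[k := a + c]) has_derivative
          (\<lambda>v. g' (v # vs[k := a]) x + g' (v # vs[k := c]) x)) (at x)"
        by (rule has_derivative_transform_within_open[OF _ S]) (simp add: linear_add[OF lin])
      from has_derivative_unique[OF hd this] ws(2) show ?thesis by (simp add: fun_eq_iff)
    qed
    moreover have "g' (v # vs[k := t *\<^sub>R c]) x = t *\<^sub>R g' (v # vs[k := c]) x" for t c
    proof -
      have "((\<lambda>y. t *\<^sub>R g (vs[k := c]) y) has_derivative (\<lambda>v. t *\<^sub>R g' (v # vs[k := c]) x)) (at x)"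
        using ws(2) by (intro has_derivative_scaleR_right hd) simp_all
      then have "(g (vs[k := t *\<^sub>R c]) has_derivative (\<lambda>v. t *\<^sub>R g' (v # vs[k := c]) x)) (at x)"
        by (rule has_derivative_transform_within_open[OF _ S]) (simp add: linear_scale[OF lin])
      from has_derivative_unique[OF hd this] ws(2) show ?thesis by (simp add: fun_eq_iff)
    qed
    ultimately show ?thesis unfolding ws(1) Suc by (intro linearI) simp_all
  qed
qed

lemma bounded_multilinear_formI:
  assumes "multilinear j (\<lambda>vs. g vs x)" "family_bounded j g x"
  shows "bounded_multilinear_form j (\<lambda>vs. g vs x)"
proof -
  obtain C where "\<And>vs. vs \<in> bounded_lists 1 j \<Longrightarrow> \<bar>g vs x\<bar> \<le> C"
    using assms(2) unfolding family_bounded_def by blast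
  from multilinear_le_prod_norm[OF assms(1) this] assms(1) show ?thesis
    unfolding bounded_multilinear_form_def multilinear_def by blast
qed

lemma uniformly_small_imp_multilinear_norm_tendsto:
  assumes "uniformly_small (bounded_lists 1 j) w F A" and w: "\<forall>\<^sub>F y in F. 0 < w y"
  shows "((\<lambda>y. multilinear_norm j (A y) / w y) \<longlongrightarrow> 0) F"
proof (rule tendstoI)
  fix e :: real assume "e > 0"
  then have "e / 2 > 0" by simp
  with assms(1) have "\<forall>\<^sub>F y in F. \<forall>vs\<in>bounded_lists 1 j. \<bar>A y vs\<bar> \<le> e / 2 * w y"
    unfolding uniformly_small_def by blast
  with w show "\<forall>\<^sub>F y in F. dist (multilinear_norm j (A y) / w y) 0 < e"
  proof eventually_elim
    case (elim y)
    then have "multilinear_norm j (A y) \<le> e / 2 * w y" "0 \<le> multilinear_norm j (A y)"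
      by (intro multilinear_norm_le; blast)+
    moreover have "e / 2 * w y < e * w y" using elim(1) \<open>e > 0\<close> by simp
    ultimately show ?case using elim(1) by (simp add: dist_real_def field_simps)
  qed
qed

lemma uniformly_small_mono_filter:
  "uniformly_small I w F f \<Longrightarrow> F' \<le> F \<Longrightarrow> uniformly_small I w F' f"
  unfolding uniformly_small_def by (meson filter_leD)

lemma has_multilinear_derivativeI:
  assumes d: "family_derivative j g g' x" and b: "bounded_multilinear_form (Suc j) (\<lambda>ws. g' ws x)"
  shows "has_multilinear_derivative j (\<lambda>x vs. g vs x) (\<lambda>ws. g' ws x) x"
  unfolding has_multilinear_derivative_def
proof
  have "uniformly_small (bounded_lists 1 j) (\<lambda>y. norm (y - x)) (nhds x)
      (\<lambda>y vs. g vs y - g vs x - g' ((y - x) # vs) x)"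
    using d by (simp add: family_derivative_def)
  moreover have "at x \<le> nhds x" by (simp add: at_within_def)
  ultimately have "uniformly_small (bounded_lists 1 j) (\<lambda>y. norm (y - x)) (at x)
      (\<lambda>y vs. g vs y - g vs x - g' ((y - x) # vs) x)" by (rule uniformly_small_mono_filter)
  moreover have "\<forall>\<^sub>F y in at x. 0 < norm (y - x)" by (simp add: eventually_at_filter)
  ultimately have "((\<lambda>y. multilinear_norm j (\<lambda>vs. g vs y - g vs x - g' ((y - x) # vs) x) / norm (y - x)) \<longlongrightarrow> 0) (at x)"
    by (rule uniformly_small_imp_multilinear_norm_tendsto)
  from LIM_offset_zero[OF this]
  show "((\<lambda>h. multilinear_norm j (\<lambda>vs. g vs (x + h) - g vs x - g' (h # vs) x) / norm h) \<longlongrightarrow> 0) (at 0)"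
    by simp
qed (fact b)

lemma smooth_family_imp_derivatives:
  assumes "open S"
  shows "smooth_family n j g S \<Longrightarrow> (\<And>x. x \<in> S \<Longrightarrow> multilinear j (\<lambda>vs. g vs x)) \<Longrightarrow>
    \<exists>F. F 0 = (\<lambda>x vs. g vs x) \<and>
      (\<forall>i\<le>n. \<forall>x\<in>S. bounded_multilinear_form (j + i) (F i x)) \<and>
      (\<forall>i<n. \<forall>x\<in>S. has_multilinear_derivative (j + i) (F i) (F (Suc i) x) x) \<and>
      (\<forall>x\<in>S. ((\<lambda>y. multilinear_norm (j + n) (\<lambda>vs. F n y vs - F n x vs)) \<longlongrightarrow> 0) (at x))"
proof (induction n arbitrary: j g)
  case 0
  have "((\<lambda>y. multilinear_norm j (\<lambda>vs. g vs y - g vs x)) \<longlongrightarrow> 0) (at x)" if "x \<in> S" for x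
  proof -
    have "uniformly_small (bounded_lists 1 j) (\<lambda>_. 1) (nhds x) (\<lambda>y vs. g vs y - g vs x)"
      using 0(1) that by (simp add: family_continuous_def)
    moreover have "at x \<le> nhds x" by (simp add: at_within_def)
    ultimately have "uniformly_small (bounded_lists 1 j) (\<lambda>_. 1) (at x) (\<lambda>y vs. g vs y - g vs x)"
      by (rule uniformly_small_mono_filter)
    from uniformly_small_imp_multilinear_norm_tendsto[OF this] show ?thesis by simp
  qed
  with 0 show ?case
    by (intro exI[of _ "\<lambda>i x vs. g vs x"]) (auto intro: bounded_multilinear_formI)
next
  case (Suc n)
  obtain g' where d: "\<And>x. x \<in> S \<Longrightarrow> family_derivative j g g' x" and s: "smooth_family n (Suc j) g' S"
    using Suc.prems(1) by auto
  have m': "multilinear (Suc j) (\<lambda>ws. g' ws x)" if "x \<in> S" for x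
    using smooth_family_derivative_multilinear[OF assms that smooth_family_bounded[OF s that] d[OF that] Suc.prems(2)] .
  obtain F where FF: "F 0 = (\<lambda>x vs. g' vs x) \<and>
      (\<forall>i\<le>n. \<forall>x\<in>S. bounded_multilinear_form (Suc j + i) (F i x)) \<and>
      (\<forall>i<n. \<forall>x\<in>S. has_multilinear_derivative (Suc j + i) (F i) (F (Suc i) x) x) \<and>
      (\<forall>x\<in>S. ((\<lambda>y. multilinear_norm (Suc j + n) (\<lambda>vs. F n y vs - F n x vs)) \<longlongrightarrow> 0) (at x))"
    using Suc.IH[OF s m'] by (rule exE)
  note F = conjunct1[OF FF] conjunct1[OF conjunct2[OF FF], rule_format]
    conjunct1[OF conjunct2[OF conjunct2[OF FF]], rule_format]
    conjunct2[OF conjunct2[OF conjunct2[OF FF]], rule_format]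
  define F' where "F' i = (case i of 0 \<Rightarrow> (\<lambda>x vs. g vs x) | Suc i \<Rightarrow> F i)" for i
  have F'_simps: "F' 0 = (\<lambda>x vs. g vs x)" "F' (Suc i) = F i" for i by (simp_all add: F'_def)
  have "bounded_multilinear_form (j + i) (F' i x)" if "i \<le> Suc n" "x \<in> S" for i x
  proof (cases i)
    case 0
    then show ?thesis
      using bounded_multilinear_formI[OF Suc.prems(2)[OF that(2)] smooth_family_bounded[OF Suc.prems(1) that(2)]]
      by (simp add: F'_simps)
  next
    case (Suc k)
    then show ?thesis using F(2)[of k x] that by (simp add: F'_simps)
  qed
  moreover have "has_multilinear_derivative (j + i) (F' i) (F' (Suc i) x) x" if "i < Suc n" "x \<in> S" for i x
  proof (cases i)
    case 0
    have "has_multilinear_derivative j (\<lambda>x vs. g vs x) (\<lambda>ws. g' ws x) x"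
      using has_multilinear_derivativeI[OF d[OF that(2)]]
        bounded_multilinear_formI[OF m'[OF that(2)] smooth_family_bounded[OF s that(2)]] by blast
    then show ?thesis using 0 by (simp add: F'_simps F(1))
  next
    case (Suc k)
    then show ?thesis using F(3)[of k x] that by (simp add: F'_simps)
  qed
  moreover have "((\<lambda>y. multilinear_norm (j + Suc n) (\<lambda>vs. F' (Suc n) y vs - F' (Suc n) x vs)) \<longlongrightarrow> 0) (at x)"
    if "x \<in> S" for x
    using F(4)[OF that] by (simp add: F'_simps)
  ultimately show ?case using F'_simps(1) by blast
qed

lemma uniformly_small_of_multilinear_norm:
  fixes A :: "'y \<Rightarrow> 'a::real_normed_vector list \<Rightarrow> real"
  assumes lim: "((\<lambda>y. multilinear_norm j (A y) / w y) \<longlongrightarrow> 0) F"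
    and A: "\<forall>\<^sub>F y in F. bounded_multilinear_form j (A y)" and w: "\<forall>\<^sub>F y in F. 0 < w y"
  shows "uniformly_small (bounded_lists r j) w F A"
  unfolding uniformly_small_def
proof (intro allI impI)
  fix e :: real assume "e > 0"
  let ?R = "(max 1 r) ^ j"
  have R: "?R > 0" by simp
  then have "e / ?R > 0" using \<open>e > 0\<close> by simp
  from order_tendstoD(2)[OF lim this] A w
  show "\<forall>\<^sub>F y in F. \<forall>vs\<in>bounded_lists r j. \<bar>A y vs\<bar> \<le> e * w y"
  proof eventually_elim
    case (elim y)
    show ?case
    proof
      fix vs :: "'a list" assume vs: "vs \<in> bounded_lists r j"
      have "\<bar>A y vs\<bar> \<le> multilinear_norm j (A y) * prod_list (map norm vs)"
        using multilinear_norm_ge[OF elim(2)] vs by (simp add: bounded_lists_def)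
      also have "\<dots> \<le> (e / ?R * w y) * ?R"
        using elim(1,3) prod_norm_le[OF vs] \<open>e / ?R > 0\<close>
        by (intro mult_mono) (auto simp: field_simps intro!: prod_list_nonneg)
      also have "\<dots> = e * w y" using R by simp
      finally show "\<bar>A y vs\<bar> \<le> e * w y" .
    qed
  qed
qed

lemma bounded_multilinear_form_diff:
  assumes "bounded_multilinear_form j A" "bounded_multilinear_form j B"
  shows "bounded_multilinear_form j (\<lambda>vs. A vs - B vs)"
proof -
  obtain C D where C: "\<And>vs. length vs = j \<Longrightarrow> \<bar>A vs\<bar> \<le> C * prod_list (map norm vs)"
      "\<And>vs. length vs = j \<Longrightarrow> \<bar>B vs\<bar> \<le> D * prod_list (map norm vs)"
    using assms unfolding bounded_multilinear_form_def by metis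
  have "\<bar>A vs - B vs\<bar> \<le> (C + D) * prod_list (map norm vs)" if "length vs = j" for vs
    using C[OF that] by (simp add: distrib_right)
  moreover have "linear (\<lambda>v. A (vs[i := v]) - B (vs[i := v]))" if "length vs = j" "i < j" for vs i
    using assms that unfolding bounded_multilinear_form_def by (intro linear_compose_sub) auto
  ultimately show ?thesis unfolding bounded_multilinear_form_def by blast
qed

lemma bounded_multilinear_form_Cons:
  assumes "bounded_multilinear_form (Suc j) A"
  shows "bounded_multilinear_form j (\<lambda>vs. A (v # vs))"
proof -
  have "multilinear (Suc j) A" using assms by (simp add: bounded_multilinear_form_def multilinear_def)
  from multilinear_Cons[OF this]
  have "\<forall>vs. length vs = j \<longrightarrow> (\<forall>i<j. linear (\<lambda>w. A (v # vs[i := w])))"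
    by (simp add: multilinear_def)
  moreover obtain C where C: "\<And>vs. length vs = Suc j \<Longrightarrow> \<bar>A vs\<bar> \<le> C * prod_list (map norm vs)"
    using assms unfolding bounded_multilinear_form_def by blast
  have "\<bar>A (v # vs)\<bar> \<le> (C * norm v) * prod_list (map norm vs)" if "length vs = j" for vs
    using C[of "v # vs"] that by (simp add: mult.assoc)
  ultimately show ?thesis unfolding bounded_multilinear_form_def by blast
qed

lemma family_boundedI:
  assumes "bounded_multilinear_form j (\<lambda>vs. g vs x)" shows "family_bounded j g x"
  unfolding family_bounded_def
proof
  fix r
  have "\<bar>g vs x\<bar> \<le> \<bar>multilinear_norm j (\<lambda>vs. g vs x)\<bar> * (max 1 r) ^ j" if "vs \<in> bounded_lists r j" for vs
  proof -
    have "\<bar>g vs x\<bar> \<le> multilinear_norm j (\<lambda>vs. g vs x) * prod_list (map norm vs)"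
      using multilinear_norm_ge[OF assms] that by (simp add: bounded_lists_def)
    also have "\<dots> \<le> \<bar>multilinear_norm j (\<lambda>vs. g vs x)\<bar> * (max 1 r) ^ j"
      using prod_norm_le[OF that] by (intro mult_mono) (auto intro!: prod_list_nonneg)
    finally show ?thesis .
  qed
  then show "\<exists>C. \<forall>vs\<in>bounded_lists r j. \<bar>g vs x\<bar> \<le> C" by blast
qed

lemma uniformly_small_nhdsI:
  assumes "uniformly_small I w (at x) A" and "\<And>i. i \<in> I \<Longrightarrow> A x i = 0" and "w x \<ge> 0"
  shows "uniformly_small I w (nhds x) A"
  using assms unfolding uniformly_small_def eventually_nhds_conv_at by simp

lemma family_derivativeI:
  assumes S: "open S" "x \<in> S" and b: "\<And>y. y \<in> S \<Longrightarrow> bounded_multilinear_form j (F y)"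
    and d: "has_multilinear_derivative j F G x"
  shows "family_derivative j (\<lambda>vs y. F y vs) (\<lambda>ws _. G ws) x"
  unfolding family_derivative_def
proof (intro conjI allI impI)
  have G: "bounded_multilinear_form (Suc j) G" using d by (simp add: has_multilinear_derivative_def)
  then have m: "multilinear (Suc j) G" by (simp add: bounded_multilinear_form_def multilinear_def)
  show lin: "linear (\<lambda>v. G (v # vs))" if "length vs = j" for vs by (rule multilinear_hd[OF m that])
  fix r
  have "((\<lambda>h. multilinear_norm j (\<lambda>vs. F (x + h) vs - F x vs - G (h # vs)) / norm h) \<longlongrightarrow> 0) (at 0)"
    using d by (simp add: has_multilinear_derivative_def)
  then have "((\<lambda>y. multilinear_norm j (\<lambda>vs. F y vs - F x vs - G ((y - x) # vs)) / norm (y - x)) \<longlongrightarrow> 0) (at x)"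
    by (intro LIM_offset_zero_cancel[of _ x]) simp
  moreover have "\<forall>\<^sub>F y in at x. y \<in> S" using S by (rule eventually_at_in_open')
  then have "\<forall>\<^sub>F y in at x. bounded_multilinear_form j (\<lambda>vs. F y vs - F x vs - G ((y - x) # vs))"
    by eventually_elim (intro bounded_multilinear_form_diff bounded_multilinear_form_Cons[OF G] b S(2))
  moreover have "\<forall>\<^sub>F y in at x. 0 < norm (y - x)"
    by (simp add: eventually_at_filter)
  ultimately have "uniformly_small (bounded_lists r j) (\<lambda>y. norm (y - x)) (at x)
      (\<lambda>y vs. F y vs - F x vs - G ((y - x) # vs))"
    by (rule uniformly_small_of_multilinear_norm)
  then show "uniformly_small (bounded_lists r j) (\<lambda>y. norm (y - x)) (nhds x)
      (\<lambda>y vs. F y vs - F x vs - G ((y - x) # vs))"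
    by (rule uniformly_small_nhdsI) (use linear_0[OF lin] in \<open>auto simp: bounded_lists_def\<close>)
qed

text \<open>
  On multilinear forms, uniformity on bounded lists is convergence in the norm of forms, by
  homogeneity; so both sides express the same conditions on the iterated derivatives.
\<close>

lemma times_cont_frechet_iff_smooth_family:
  assumes S: "open S"
  shows "times_cont_frechet_differentiable_on n f S \<longleftrightarrow> smooth_family n 0 (\<lambda>_. f) S"
proof
  assume "times_cont_frechet_differentiable_on n f S"
  then obtain F where FF: "(\<forall>x\<in>S. F 0 x [] = f x) \<and>
      (\<forall>j\<le>n. \<forall>x\<in>S. bounded_multilinear_form j (F j x)) \<and>
      (\<forall>j<n. \<forall>x\<in>S. has_multilinear_derivative j (F j) (F (Suc j) x) x) \<and>
      (\<forall>x\<in>S. ((\<lambda>y. multilinear_norm n (\<lambda>vs. F n y vs - F n x vs)) \<longlongrightarrow> 0) (at x))"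
    unfolding times_cont_frechet_differentiable_on_def by (rule exE)
  note F = conjunct1[OF FF, rule_format] conjunct1[OF conjunct2[OF FF], rule_format]
    conjunct1[OF conjunct2[OF conjunct2[OF FF]], rule_format]
    conjunct2[OF conjunct2[OF conjunct2[OF FF]], rule_format]
  have b: "family_bounded j (\<lambda>vs x. F j x vs) x" if "j \<le> n" "x \<in> S" for j x
    using F(2)[OF that] by (intro family_boundedI)
  have "smooth_family m (n - m) (\<lambda>vs x. F (n - m) x vs) S" if "m \<le> n" for m
    using that
  proof (induction m)
    case 0
    have "family_continuous n (\<lambda>vs x. F n x vs) x" if x: "x \<in> S" for x
      unfolding family_continuous_def
    proof
      fix r
      have "((\<lambda>y. multilinear_norm n (\<lambda>vs. F n y vs - F n x vs) / 1) \<longlongrightarrow> 0) (at x)"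
        using F(4)[OF x] by simp
      moreover have "\<forall>\<^sub>F y in at x. y \<in> S" using S x by (rule eventually_at_in_open')
      then have "\<forall>\<^sub>F y in at x. bounded_multilinear_form n (\<lambda>vs. F n y vs - F n x vs)"
        by eventually_elim (intro bounded_multilinear_form_diff F(2) x order_refl)
      ultimately have "uniformly_small (bounded_lists r n) (\<lambda>_. 1) (at x) (\<lambda>y vs. F n y vs - F n x vs)"
        by (rule uniformly_small_of_multilinear_norm) simp
      then show "uniformly_small (bounded_lists r n) (\<lambda>_. 1) (nhds x) (\<lambda>y vs. F n y vs - F n x vs)"
        by (rule uniformly_small_nhdsI) simp_all
    qed
    then show ?case using b[of n] by simp
  next
    case (Suc m)
    define j where "j = n - Suc m"
    have j: "n - m = Suc j" "j < n" using Suc.prems by (auto simp: j_def)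
    have "family_derivative j (\<lambda>vs x. F j x vs) (\<lambda>vs x. F (Suc j) x vs) x" if x: "x \<in> S" for x
      using family_derivativeI[OF S x F(2) F(3)[OF j(2) x]] j(2)
      unfolding family_derivative_def by simp
    then show ?case
      using Suc b[of j] j by (auto simp: j_def[symmetric])
  qed
  from this[of n] have s: "smooth_family n 0 (\<lambda>vs x. F 0 x vs) S" by simp
  show "smooth_family n 0 (\<lambda>_. f) S"
    by (rule smooth_family_cong[OF S s]) (simp add: F(1))
next
  assume s: "smooth_family n 0 (\<lambda>_. f) S"
  have m: "multilinear 0 (\<lambda>_. f x)" for x :: 'a by (simp add: multilinear_def)
  obtain F where FF: "F 0 = (\<lambda>x _. f x) \<and>
      (\<forall>i\<le>n. \<forall>x\<in>S. bounded_multilinear_form (0 + i) (F i x)) \<and>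
      (\<forall>i<n. \<forall>x\<in>S. has_multilinear_derivative (0 + i) (F i) (F (Suc i) x) x) \<and>
      (\<forall>x\<in>S. ((\<lambda>y. multilinear_norm (0 + n) (\<lambda>vs. F n y vs - F n x vs)) \<longlongrightarrow> 0) (at x))"
    using smooth_family_imp_derivatives[OF S s m] by (rule exE)
  have "\<forall>x\<in>S. F 0 x [] = f x" using conjunct1[OF FF] by simp
  with conjunct2[OF FF] show "times_cont_frechet_differentiable_on n f S"
    unfolding times_cont_frechet_differentiable_on_def add_0 by blast
qed

section \<open>Smooth real-valued functions\<close>

text \<open>
  A single function is a family indexed by the empty list.
\<close>

abbreviation Ck_on :: "nat \<Rightarrow> ('a::real_normed_vector \<Rightarrow> real) \<Rightarrow> 'a set \<Rightarrow> bool" where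
  "Ck_on n f S \<equiv> smooth_family n 0 (\<lambda>_. f) S"

lemma Ck_on_const: "Ck_on n (\<lambda>x. c) S"
  using smooth_family_const[of 0 "\<lambda>_. c"] by auto

lemma Ck_on_cmult: "Ck_on n f S \<Longrightarrow> Ck_on n (\<lambda>x. c * f x) S"
  using smooth_family_mult[OF Ck_on_const] .

lemma Ck_on_diff:
  assumes "Ck_on n f S" "Ck_on n g S" shows "Ck_on n (\<lambda>x. f x - g x) S"
  using smooth_family_add[OF assms(1) Ck_on_cmult[OF assms(2), of "-1"]] by simp

lemma Ck_on_linear:
  assumes "bounded_linear u" shows "Ck_on n u S"
proof (cases n)
  interpret bounded_linear u by fact
  case 0
  have "isCont u x" for x using isCont[OF continuous_ident] .
  then show ?thesis using 0 by (auto simp: family_bounded_def family_continuous_0)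
next
  interpret bounded_linear u by fact
  case (Suc m)
  obtain K where K: "\<And>x. norm (u x) \<le> norm x * K" using bounded by blast
  have "smooth_family m (Suc 0) (\<lambda>ws x. u (hd ws)) S"
  proof (rule smooth_family_const, intro allI)
    fix r
    have "\<bar>u (hd ws)\<bar> \<le> r * \<bar>K\<bar>" if ws: "ws \<in> bounded_lists r (Suc 0)" for ws
    proof -
      obtain v where v: "ws = [v]" "norm v \<le> r" using bounded_lists_SucE[OF ws] by auto
      have "\<bar>u v\<bar> \<le> norm v * \<bar>K\<bar>" using K[of v] mult_left_mono[OF abs_ge_self[of K] norm_ge_zero[of v]] by simp
      also have "\<dots> \<le> r * \<bar>K\<bar>" using v(2) by (intro mult_right_mono) auto
      finally show ?thesis using v(1) by simp
    qed
    then show "\<exists>C. \<forall>ws\<in>bounded_lists r (Suc 0). \<bar>u (hd ws)\<bar> \<le> C" by blast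
  qed
  moreover have "family_derivative 0 (\<lambda>_. u) (\<lambda>ws x. u (hd ws)) x" for x
    by (rule family_derivative_0I) (simp add: bounded_linear_imp_has_derivative[OF assms])
  ultimately show ?thesis using Suc by (auto simp: family_bounded_def)
qed

lemma Ck_on_precompose:
  assumes "bounded_linear P" "Ck_on n f S" "P ` S' \<subseteq> S"
  shows "Ck_on n (\<lambda>x. f (P x)) S'"
  using smooth_family_precompose[OF assms, where j' = 0 and \<rho> = "\<lambda>_. []"] by auto

lemma Ck_on_inverse:
  assumes "Ck_on n f S" "\<And>x. x \<in> S \<Longrightarrow> f x \<noteq> 0"
  shows "Ck_on n (\<lambda>x. inverse (f x)) S"
proof -
  let ?\<phi> = "\<lambda>i t. (-1) ^ i * fact i * inverse t ^ Suc i :: real"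
  have "Ck_on n (\<lambda>x. ?\<phi> 0 (f x)) S"
  proof (rule smooth_family_compose_real[where T = "- {0}" and \<phi> = ?\<phi>, OF _ _ assms(1)])
    fix i and t :: real assume "t \<in> - {0}"
    then show "(?\<phi> i has_real_derivative ?\<phi> (Suc i) t) (at t)"
      using DERIV_cmult[OF DERIV_power[OF DERIV_inverse, of t "Suc i" UNIV], of "(-1) ^ i * fact i"]
      by (simp add: algebra_simps)
  qed (use assms(2) in auto)
  then show ?thesis by simp
qed

lemma Ck_on_abs:
  assumes "Ck_on n f S" "\<And>x. x \<in> S \<Longrightarrow> f x \<noteq> 0"
  shows "Ck_on n (\<lambda>x. \<bar>f x\<bar>) S"
proof -
  let ?\<phi> = "\<lambda>(i::nat) t. if i = 0 then \<bar>t\<bar> else if i = 1 then sgn t else (0::real)"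
  have "Ck_on n (\<lambda>x. ?\<phi> 0 (f x)) S"
  proof (rule smooth_family_compose_real[where T = "- {0}" and \<phi> = ?\<phi>, OF _ _ assms(1)])
    fix i and t :: real assume t: "t \<in> - {0}"
    have "(sgn has_real_derivative 0) (at t)"
    proof (cases "t > 0")
      case True
      show ?thesis
        by (rule has_field_derivative_transform_within_open[OF DERIV_const[of 1] open_greaterThan[of 0]])
          (use True in auto)
    next
      case False
      show ?thesis
        by (rule has_field_derivative_transform_within_open[OF DERIV_const[of "-1"] open_lessThan[of 0]])
          (use False t in auto)
    qed
    moreover have "(abs has_real_derivative sgn t) (at t)"
    proof (cases "t > 0")
      case True
      have "((\<lambda>t. t) has_real_derivative sgn t) (at t)" using True by simp
      then show ?thesis
        by (rule has_field_derivative_transform_within_open[OF _ open_greaterThan[of 0]])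
          (use True in auto)
    next
      case False
      have "((\<lambda>t. - t) has_real_derivative sgn t) (at t)"
        using False t by (auto intro!: derivative_eq_intros)
      then show ?thesis
        by (rule has_field_derivative_transform_within_open[OF _ open_lessThan[of 0]])
          (use False t in auto)
    qed
    ultimately show "(?\<phi> i has_real_derivative ?\<phi> (Suc i) t) (at t)"
      by (cases "i = 0"; cases "i = 1") simp_all
  qed (use assms(2) in auto)
  then show ?thesis by simp
qed

text \<open>
  These functions are closed under differentiation. They contain the flat function
  \<open>t \<mapsto> exp (- 1 / t)\<close>, extended by 0, as the case \<open>p = 1\<close>.
\<close>

definition flat_poly :: "real poly \<Rightarrow> real \<Rightarrow> real" where
  "flat_poly p t = (if t > 0 then poly p (inverse t) * exp (- inverse t) else 0)"

lemma poly_times_exp_tendsto_0: "((\<lambda>y::real. poly p y * exp (- y)) \<longlongrightarrow> 0) at_top"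
proof -
  have "((\<lambda>y::real. \<Sum>i\<le>degree p. coeff p i * (y ^ i / exp y)) \<longlongrightarrow> (\<Sum>i\<le>degree p. coeff p i * 0)) at_top"
    by (intro tendsto_intros tendsto_power_div_exp_0)
  then show ?thesis
    by (simp add: poly_altdef sum_distrib_right exp_minus divide_inverse mult.assoc)
qed

text \<open>
  At 0 the difference quotient is \<open>y p(y) exp (- y)\<close> with \<open>y = 1 / t \<rightarrow> \<infinity>\<close>, and the exponential wins.
\<close>

lemma flat_poly_deriv:
  "(flat_poly p has_real_derivative flat_poly ([:0, 0, 1:] * (p - pderiv p)) t) (at t)"
proof -
  consider "t > 0" | "t < 0" | "t = 0" by linarith
  then show ?thesis
  proof cases
    case 1
    have "((\<lambda>t. poly p (inverse t) * exp (- inverse t)) has_real_derivative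
        flat_poly ([:0, 0, 1:] * (p - pderiv p)) t) (at t)"
      using 1 by (auto intro!: derivative_eq_intros poly_DERIV[THEN DERIV_chain2]
        simp: flat_poly_def power2_eq_square algebra_simps)
    then show ?thesis
      by (rule has_field_derivative_transform_within_open[OF _ open_greaterThan[of 0]])
        (use 1 in \<open>auto simp: flat_poly_def\<close>)
  next
    case 2
    have "((\<lambda>t. 0) has_real_derivative flat_poly ([:0, 0, 1:] * (p - pderiv p)) t) (at t)"
      using 2 by (simp add: flat_poly_def)
    then show ?thesis
      by (rule has_field_derivative_transform_within_open[OF _ open_lessThan[of 0]])
        (use 2 in \<open>auto simp: flat_poly_def\<close>)
  next
    case 3
    have "((\<lambda>h. flat_poly p h / h) \<longlongrightarrow> 0) (at 0)"
    proof (rule filterlim_split_at)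
      have "eventually (\<lambda>h::real. h < 0) (at_left 0)" by (simp add: eventually_at_filter)
      then have "eventually (\<lambda>h. 0 = flat_poly p h / h) (at_left 0)"
        by eventually_elim (simp add: flat_poly_def)
      then show "((\<lambda>h. flat_poly p h / h) \<longlongrightarrow> 0) (at_left 0)"
        by (rule Lim_transform_eventually[OF tendsto_const])
      have "((\<lambda>h. poly (pCons 0 p) (inverse h) * exp (- inverse h)) \<longlongrightarrow> 0) (at_right (0::real))"
        by (rule filterlim_compose[OF poly_times_exp_tendsto_0 filterlim_inverse_at_top_right])
      moreover have "eventually (\<lambda>h::real. h > 0) (at_right 0)" by (rule eventually_at_right_less)
      then have "eventually (\<lambda>h. poly (pCons 0 p) (inverse h) * exp (- inverse h) = flat_poly p h / h) (at_right 0)"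
        by eventually_elim (simp add: flat_poly_def divide_inverse)
      ultimately show "((\<lambda>h. flat_poly p h / h) \<longlongrightarrow> 0) (at_right 0)"
        by (rule Lim_transform_eventually)
    qed
    then show ?thesis using 3 by (simp add: has_field_derivative_iff flat_poly_def)
  qed
qed

definition flat :: "real \<Rightarrow> real" where
  "flat t = (if t > 0 then exp (- inverse t) else 0)"

lemma Ck_on_flat:
  assumes "Ck_on n f S" shows "Ck_on n (\<lambda>x. flat (f x)) S"
proof -
  let ?\<phi> = "\<lambda>i. flat_poly (((\<lambda>p. [:0, 0, 1:] * (p - pderiv p)) ^^ i) 1)"
  have "Ck_on n (\<lambda>x. ?\<phi> 0 (f x)) S"
    by (rule smooth_family_compose_real[where T = UNIV and \<phi> = ?\<phi>, OF _ _ assms]) (simp_all add: flat_poly_deriv del: mult_pCons_left)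
  moreover have "flat_poly 1 = flat" by (simp add: fun_eq_iff flat_def flat_poly_def)
  ultimately show ?thesis by simp
qed

lemma flat_bounds: "0 \<le> flat t" "flat t \<le> 1"
  by (auto simp: flat_def)

section \<open>A smooth maximum of two seminorms\<close>

text \<open>
  For \<open>b > a > 0\<close> this is \<open>a + (b - a) exp (- \<epsilon> a / (b - a)) / (1 + \<epsilon>)\<close>. The dilation of the flat function
  by \<open>\<epsilon> a\<close> makes the expression homogeneous of degree 1; the factor \<open>1 / (1 + \<epsilon>)\<close> makes it monotone in
  \<open>a\<close>. For \<open>a = b = 0\<close> it takes the value 0, through division by zero.
\<close>

definition smooth_max :: "real \<Rightarrow> real \<Rightarrow> real \<Rightarrow> real" where
  "smooth_max \<epsilon> a b = a + (b - a) * flat ((b - a) / (\<epsilon> * a)) / (1 + \<epsilon>)"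

lemma smooth_max_absorb:
  assumes "\<epsilon> > 0" "0 \<le> a" "b \<le> a" shows "smooth_max \<epsilon> a b = a"
proof -
  have "(b - a) / (\<epsilon> * a) \<le> 0" using assms by (intro divide_nonpos_nonneg) auto
  then show ?thesis by (simp add: smooth_max_def flat_def)
qed

lemma smooth_max_ge_left:
  assumes "\<epsilon> > 0" "0 \<le> a" shows "a \<le> smooth_max \<epsilon> a b"
proof (cases "b \<le> a")
  case True then show ?thesis using smooth_max_absorb[OF assms True] by simp
next
  case False then show ?thesis using assms(1) flat_bounds by (simp add: smooth_max_def)
qed

lemma smooth_max_le:
  assumes "\<epsilon> > 0" "0 \<le> a" "a \<le> c" "b \<le> c" shows "smooth_max \<epsilon> a b \<le> c"
proof (cases "b \<le> a")
  case True then show ?thesis using smooth_max_absorb[OF assms(1,2) True] assms by simp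
next
  case False
  let ?f = "flat ((b - a) / (\<epsilon> * a))"
  have "(b - a) * ?f / (1 + \<epsilon>) \<le> (b - a) * ?f"
  proof -
    have "0 \<le> (b - a) * ?f" using False flat_bounds by simp
    moreover from this have "(b - a) * ?f \<le> (b - a) * ?f * (1 + \<epsilon>)"
      using mult_left_mono[of 1 "1 + \<epsilon>" "(b - a) * ?f"] assms(1) by simp
    ultimately show ?thesis using assms(1) by (simp add: divide_le_eq)
  qed
  also have "\<dots> \<le> b - a" using False flat_bounds by (simp add: mult_left_le)
  finally show ?thesis using assms(4) by (simp add: smooth_max_def)
qed

text \<open>
  The inequality \<open>exp (- w') \<ge> exp (- w) (1 + w - w')\<close>, that is the tangent of the exponential at \<open>- w\<close>,
  for \<open>w' = \<epsilon> a / d\<close> and multiplied by \<open>d\<close>. The right-hand side is linear in \<open>(d, a)\<close> for fixed \<open>w\<close>.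
\<close>

lemma flat_ge_tangent:
  assumes "\<epsilon> > 0" "0 \<le> a" "a = 0 \<Longrightarrow> d = 0" "0 \<le> w"
  shows "exp (- w) * ((1 + w) * d - \<epsilon> * a) \<le> d * flat (d / (\<epsilon> * a))"
proof (cases "d > 0")
  case True
  then have a: "a > 0" using assms by (cases "a = 0") auto
  define w' where "w' = \<epsilon> * a / d"
  have "1 + w - w' \<le> exp (w - w')" using exp_ge_add_one_self[of "w - w'"] by linarith
  then have "exp (- w) * (1 + w - w') \<le> exp (- w) * exp (w - w')" by simp
  also have "\<dots> = exp (- w')" by (simp add: exp_add[symmetric])
  finally have "d * (exp (- w) * (1 + w - w')) \<le> d * exp (- w')" using True by simp
  moreover have "d * w' = \<epsilon> * a" using True by (simp add: w'_def)
  then have "d * (exp (- w) * (1 + w - w')) = exp (- w) * ((1 + w) * d - \<epsilon> * a)"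
    by (simp add: algebra_simps)
  moreover have "d / (\<epsilon> * a) > 0" using True a assms(1) by simp
  then have "flat (d / (\<epsilon> * a)) = exp (- w')" by (simp add: flat_def w'_def)
  ultimately show ?thesis by simp
next
  case False
  have "(1 + w) * d \<le> 0" using False assms(4) by (intro mult_nonneg_nonpos) auto
  moreover have "0 \<le> \<epsilon> * a" using assms by simp
  ultimately have "exp (- w) * ((1 + w) * d - \<epsilon> * a) \<le> 0" by (intro mult_nonneg_nonpos) auto
  moreover have "\<not> d / (\<epsilon> * a) > 0" using False assms by (simp add: divide_nonpos_nonneg not_less)
  ultimately show ?thesis by (simp add: flat_def)
qed

text \<open>
  The tangent at \<open>w = 0\<close>.
\<close>

lemma smooth_max_ge_right:
  assumes \<epsilon>: "\<epsilon> > 0" and "0 \<le> a" "a = 0 \<Longrightarrow> b = 0" "0 \<le> b"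
  shows "b / (1 + \<epsilon>) \<le> smooth_max \<epsilon> a b"
proof -
  have "(b - a) - \<epsilon> * a \<le> (b - a) * flat ((b - a) / (\<epsilon> * a))"
    using flat_ge_tangent[of \<epsilon> a "b - a" 0] assms by simp
  then have "((b - a) - \<epsilon> * a) / (1 + \<epsilon>) \<le> (b - a) * flat ((b - a) / (\<epsilon> * a)) / (1 + \<epsilon>)"
    using \<epsilon> by (intro divide_right_mono) auto
  moreover have "((b - a) - \<epsilon> * a) / (1 + \<epsilon>) = b / (1 + \<epsilon>) - a" using \<epsilon> by (simp add: field_simps)
  ultimately show ?thesis by (simp add: smooth_max_def)
qed

text \<open>
  The smooth maximum is a maximum of nonnegative linear forms in its arguments: the tangents of the
  exponential, and the form \<open>a\<close> where \<open>b \<le> a\<close>. This contains convexity, monotonicity and the triangle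
  inequality for \<open>smooth_max \<epsilon> (p x) (q x)\<close>.
\<close>

lemma smooth_max_supporting_form:
  assumes \<epsilon>: "\<epsilon> > 0" and a: "0 \<le> a" and b: "a = 0 \<Longrightarrow> b = 0"
  obtains \<alpha> \<beta> where "0 \<le> \<alpha>" "0 \<le> \<beta>" "smooth_max \<epsilon> a b = \<alpha> * b + \<beta> * a"
    "\<And>a' b'. 0 \<le> a' \<Longrightarrow> (a' = 0 \<Longrightarrow> b' = 0) \<Longrightarrow> \<alpha> * b' + \<beta> * a' \<le> smooth_max \<epsilon> a' b'"
proof (cases "b \<le> a")
  case True
  then show ?thesis
    using that[of 0 1] smooth_max_absorb[OF \<epsilon> a True] smooth_max_ge_left[OF \<epsilon>] by simp
next
  case False
  then have a0: "a > 0" using a b by (cases "a = 0") auto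
  define w where "w = \<epsilon> * a / (b - a)"
  define l where "l = exp (- w) / (1 + \<epsilon>)"
  have w: "w > 0" using a0 \<epsilon> False by (simp add: w_def)
  have l: "l > 0" using \<epsilon> by (simp add: l_def)
  have "1 + w + \<epsilon> \<le> (1 + \<epsilon>) * (1 + w)" using w \<epsilon> by (simp add: algebra_simps)
  also have "\<dots> \<le> (1 + \<epsilon>) * exp w" using exp_ge_add_one_self[of w] \<epsilon> by (intro mult_left_mono) auto
  finally have "l * (1 + w + \<epsilon>) \<le> l * ((1 + \<epsilon>) * exp w)" using l by simp
  also have "\<dots> = 1" using \<epsilon> by (simp add: l_def exp_minus)
  finally have le1: "l * (1 + w + \<epsilon>) \<le> 1" .
  \<comment> \<open>The supporting form, rewritten as the tangent expression of \<open>flat_ge_tangent\<close>.\<close>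
  have form: "l * (1 + w) * y + (1 - l * (1 + w + \<epsilon>)) * x
      = x + exp (- w) * ((1 + w) * (y - x) - \<epsilon> * x) / (1 + \<epsilon>)" for x y
  proof -
    have "exp (- w) * ((1 + w) * (y - x) - \<epsilon> * x) / (1 + \<epsilon>) = l * ((1 + w) * (y - x) - \<epsilon> * x)"
      by (simp add: l_def)
    then show ?thesis by (simp only:) (simp add: algebra_simps)
  qed
  show ?thesis
  proof
    show "0 \<le> l * (1 + w)" "0 \<le> 1 - l * (1 + w + \<epsilon>)" using l w le1 by auto
    have "(b - a) / (\<epsilon> * a) > 0" using False a0 \<epsilon> by simp
    then have "flat ((b - a) / (\<epsilon> * a)) = exp (- w)" by (simp add: flat_def w_def)
    moreover have "w * (b - a) = \<epsilon> * a" using False by (simp add: w_def)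
    then have "(1 + w) * (b - a) - \<epsilon> * a = b - a" by (simp add: algebra_simps)
    ultimately show "smooth_max \<epsilon> a b = l * (1 + w) * b + (1 - l * (1 + w + \<epsilon>)) * a"
      unfolding form smooth_max_def by simp
    fix a' b' :: real assume "0 \<le> a'" "a' = 0 \<Longrightarrow> b' = 0"
    then have "exp (- w) * ((1 + w) * (b' - a') - \<epsilon> * a') \<le> (b' - a') * flat ((b' - a') / (\<epsilon> * a'))"
      using w by (intro flat_ge_tangent \<epsilon>) auto
    then show "l * (1 + w) * b' + (1 - l * (1 + w + \<epsilon>)) * a' \<le> smooth_max \<epsilon> a' b'"
      unfolding form smooth_max_def using \<epsilon> by (simp add: divide_right_mono)
  qed
qed

lemma smooth_max_scale:
  assumes "c \<ge> 0" shows "smooth_max \<epsilon> (c * a) (c * b) = c * smooth_max \<epsilon> a b"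
proof (cases "c = 0")
  case False
  then have "(c * b - c * a) / (\<epsilon> * (c * a)) = (b - a) / (\<epsilon> * a)"
    by (simp add: right_diff_distrib[symmetric] mult.left_commute[of \<epsilon>])
  then show ?thesis by (simp add: smooth_max_def right_diff_distrib[symmetric] distrib_left)
qed (simp add: smooth_max_def)

lemma seminorm_smooth_max:
  assumes \<epsilon>: "\<epsilon> > 0" and p: "seminorm p" and q: "seminorm q" and z: "\<And>x. p x = 0 \<Longrightarrow> q x = 0"
  shows "seminorm (\<lambda>x. smooth_max \<epsilon> (p x) (q x))"
  unfolding seminorm_def
proof (intro conjI allI)
  fix x y c
  show "0 \<le> smooth_max \<epsilon> (p x) (q x)"
    using smooth_max_ge_left[OF \<epsilon> seminorm_nonneg[OF p]] seminorm_nonneg[OF p] order_trans by blast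
  show "smooth_max \<epsilon> (p (c *\<^sub>R x)) (q (c *\<^sub>R x)) = \<bar>c\<bar> * smooth_max \<epsilon> (p x) (q x)"
    by (simp add: seminorm_scaleR[OF p] seminorm_scaleR[OF q] smooth_max_scale)
  obtain \<alpha> \<beta> where ab: "0 \<le> \<alpha>" "0 \<le> \<beta>" "smooth_max \<epsilon> (p (x + y)) (q (x + y)) = \<alpha> * q (x + y) + \<beta> * p (x + y)"
    "\<And>a' b'. 0 \<le> a' \<Longrightarrow> (a' = 0 \<Longrightarrow> b' = 0) \<Longrightarrow> \<alpha> * b' + \<beta> * a' \<le> smooth_max \<epsilon> a' b'"
    using smooth_max_supporting_form[OF \<epsilon> seminorm_nonneg[OF p] z] by metis
  have "\<alpha> * q (x + y) + \<beta> * p (x + y) \<le> \<alpha> * (q x + q y) + \<beta> * (p x + p y)"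
    using ab(1,2) seminorm_triangle[OF p] seminorm_triangle[OF q] by (intro add_mono mult_left_mono)
  also have "\<dots> = (\<alpha> * q x + \<beta> * p x) + (\<alpha> * q y + \<beta> * p y)" by (simp add: algebra_simps)
  also have "\<dots> \<le> smooth_max \<epsilon> (p x) (q x) + smooth_max \<epsilon> (p y) (q y)"
    using z seminorm_nonneg[OF p] by (intro add_mono ab(4)) auto
  finally show "smooth_max \<epsilon> (p (x + y)) (q (x + y)) \<le> smooth_max \<epsilon> (p x) (q x) + smooth_max \<epsilon> (p y) (q y)"
    unfolding ab(3) .
qed

text \<open>
  Where \<open>q < p\<close> the smooth maximum is \<open>p\<close>, so \<open>q\<close> has to be smooth only near points with \<open>p \<le> q\<close>.
\<close>

lemma Ck_on_smooth_max:
  assumes S: "open S" and p: "Ck_on n p S" "\<And>x. x \<in> S \<Longrightarrow> 0 < p x" and \<epsilon>: "\<epsilon> > 0"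
    and cont: "continuous_on S p" "continuous_on S q"
    and q: "\<And>x. x \<in> S \<Longrightarrow> p x \<le> q x \<Longrightarrow> \<exists>U. open U \<and> x \<in> U \<and> Ck_on n q U"
  shows "Ck_on n (\<lambda>x. smooth_max \<epsilon> (p x) (q x)) S"
proof (rule smooth_family_local[OF S])
  fix x assume x: "x \<in> S"
  show "\<exists>U. open U \<and> x \<in> U \<and> Ck_on n (\<lambda>x. smooth_max \<epsilon> (p x) (q x)) U"
  proof (cases "p x \<le> q x")
    case True
    obtain U where U: "open U" "x \<in> U" "Ck_on n q U" using q[OF x True] by blast
    have pU: "Ck_on n p (S \<inter> U)" by (rule smooth_family_subset[OF p(1)]) simp
    have qU: "Ck_on n q (S \<inter> U)" by (rule smooth_family_subset[OF U(3)]) simp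
    have d: "Ck_on n (\<lambda>x. q x - p x) (S \<inter> U)" using qU pU by (rule Ck_on_diff)
    have "Ck_on n (\<lambda>x. inverse (p x)) (S \<inter> U)"
    proof (rule Ck_on_inverse[OF pU])
      show "p x \<noteq> 0" if "x \<in> S \<inter> U" for x using p(2)[of x] that by simp
    qed
    from Ck_on_flat[OF Ck_on_cmult[OF smooth_family_mult[OF d this], of "1 / \<epsilon>"]]
    have "Ck_on n (\<lambda>x. flat ((1 / \<epsilon>) * ((q x - p x) * inverse (p x)))) (S \<inter> U)" .
    from smooth_family_add[OF pU Ck_on_cmult[OF smooth_family_mult[OF d this], of "1 / (1 + \<epsilon>)"]]
    have "Ck_on n (\<lambda>x. p x + 1 / (1 + \<epsilon>) * ((q x - p x) * flat ((1 / \<epsilon>) * ((q x - p x) * inverse (p x))))) (S \<inter> U)" .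
    moreover have "p x + 1 / (1 + \<epsilon>) * ((q x - p x) * flat ((1 / \<epsilon>) * ((q x - p x) * inverse (p x))))
        = smooth_max \<epsilon> (p x) (q x)" for x
    proof -
      have "(1 / \<epsilon>) * ((q x - p x) * inverse (p x)) = (q x - p x) / (\<epsilon> * p x)"
        by (simp add: divide_inverse)
      then show ?thesis unfolding smooth_max_def by (simp only:) simp
    qed
    ultimately have "Ck_on n (\<lambda>x. smooth_max \<epsilon> (p x) (q x)) (S \<inter> U)" by (simp only:)
    then show ?thesis using S U x by (intro exI[of _ "S \<inter> U"]) auto
  next
    case False
    have "open (S \<inter> (\<lambda>x. p x - q x) -` {0<..})"
      by (rule continuous_open_preimage[OF continuous_on_diff[OF cont] S open_greaterThan])
    moreover have "S \<inter> (\<lambda>x. p x - q x) -` {0<..} = {y \<in> S. q y < p y}" by auto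
    ultimately have o: "open {y \<in> S. q y < p y}" by simp
    have "Ck_on n p {y \<in> S. q y < p y}" by (rule smooth_family_subset[OF p(1)]) auto
    then have "Ck_on n (\<lambda>x. smooth_max \<epsilon> (p x) (q x)) {y \<in> S. q y < p y}"
    proof (rule smooth_family_cong[OF o])
      fix y :: 'a and vs :: "'a list" assume "y \<in> {y \<in> S. q y < p y}"
      then show "smooth_max \<epsilon> (p y) (q y) = p y"
        using p(2)[of y] by (intro smooth_max_absorb[OF \<epsilon>]) auto
    qed
    then show ?thesis using o x False by (intro exI[of _ "{y \<in> S. q y < p y}"]) auto
  qed
qed

section \<open>The limit norm of a system of cones\<close>

lemma gateaux_quotient_scale:
  assumes L: "seminorm L" and m: "m > 0"
  shows "gateaux_quotient L ((1 / m) *\<^sub>R x) h (t / m) = gateaux_quotient L x h t"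
proof -
  have eq: "(1 / m) *\<^sub>R x + (t / m) *\<^sub>R h = (1 / m) *\<^sub>R (x + t *\<^sub>R h)"
    "(1 / m) *\<^sub>R x - (t / m) *\<^sub>R h = (1 / m) *\<^sub>R (x - t *\<^sub>R h)"
    by (simp_all add: scaleR_add_right scaleR_diff_right)
  have "gateaux_quotient L ((1 / m) *\<^sub>R x) h (t / m)
      = (L (x + t *\<^sub>R h) / m + L (x - t *\<^sub>R h) / m - 2 * (L x / m)) / (t / m)"
    unfolding gateaux_quotient_def eq using m by (simp add: seminorm_scaleR[OF L])
  also have "\<dots> = gateaux_quotient L x h t"
    using m by (cases "t = 0") (simp_all add: gateaux_quotient_def field_simps)
  finally show ?thesis .
qed

lemma convex_seminorm_ball:
  assumes L: "seminorm L" shows "convex {x. L x \<le> (1::real)}"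
proof (rule convexI)
  fix x y and s t :: real
  assume xy: "x \<in> {x. L x \<le> 1}" "y \<in> {x. L x \<le> 1}" and st: "0 \<le> s" "0 \<le> t" "s + t = 1"
  have "L (s *\<^sub>R x + t *\<^sub>R y) \<le> s * L x + t * L y"
    using seminorm_triangle[OF L, of "s *\<^sub>R x" "t *\<^sub>R y"] st by (simp add: seminorm_scaleR[OF L])
  also have "\<dots> \<le> s * 1 + t * 1" using xy st by (intro add_mono mult_left_mono) auto
  finally show "s *\<^sub>R x + t *\<^sub>R y \<in> {x. L x \<le> 1}" using st by simp
qed

context null_biorthogonal_system
begin

lemmas sN = equivalent_norm_seminorm[OF norm]

definition tol :: "nat \<Rightarrow> real" where "tol j = inverse (real (Suc j))"

lemma tol: "0 < tol j" "tol j \<le> 1" "tol \<longlonglongrightarrow> 0"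
  using LIMSEQ_inverse_real_of_nat by (simp_all add: tol_def[abs_def] field_simps)

definition rest :: "nat \<Rightarrow> 'a \<Rightarrow> 'a" where "rest j v = v - u j v *\<^sub>R e j"

lemma rest_linear: "bounded_linear (rest j)"
  unfolding rest_def
  by (intro bounded_linear_sub bounded_linear_ident bounded_linear_compose[OF bounded_linear_scaleR_left linear])

text \<open>
  The factor exceeds 2 by enough that even after the loss of a factor \<open>1 + tol j\<close> in the smooth maximum
  the result is larger than \<open>2 \<bar>u j v\<bar>\<close>, the value of the cone gauge on its axis.
\<close>

definition slab :: "nat \<Rightarrow> 'a \<Rightarrow> real" where "slab j v = 2 * (1 + tol j)\<^sup>2 * \<bar>u j v\<bar>"

definition cone_gauge :: "nat \<Rightarrow> 'a \<Rightarrow> real" where "cone_gauge j v = 2 * \<bar>u j v\<bar> + N (rest j v) / 2"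

text \<open>
  The slab is inserted before the cone: it smooths the tip of the latter.
\<close>

primrec stage :: "nat \<Rightarrow> 'a \<Rightarrow> real" where
  "stage 0 = N"
| "stage (Suc j) = (\<lambda>v. smooth_max (tol j) (smooth_max (tol j) (stage j v) (slab j v)) (cone_gauge j v))"

definition limit_norm :: "'a \<Rightarrow> real" where "limit_norm v = lim (\<lambda>j. stage j v)"

abbreviation mid :: "nat \<Rightarrow> 'a \<Rightarrow> real" where "mid j v \<equiv> smooth_max (tol j) (stage j v) (slab j v)"

lemma seminorm_slab: "seminorm (slab j)"
proof -
  interpret U: bounded_linear "u j" by (rule linear)
  show ?thesis unfolding seminorm_def slab_def
  proof (intro conjI allI)
    fix x y c
    show "2 * (1 + tol j)\<^sup>2 * \<bar>u j (c *\<^sub>R x)\<bar> = \<bar>c\<bar> * (2 * (1 + tol j)\<^sup>2 * \<bar>u j x\<bar>)"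
      by (simp add: U.scaleR abs_mult)
    have "2 * (1 + tol j)\<^sup>2 * \<bar>u j (x + y)\<bar> \<le> 2 * (1 + tol j)\<^sup>2 * (\<bar>u j x\<bar> + \<bar>u j y\<bar>)"
      by (intro mult_left_mono) (simp_all add: U.add)
    then show "2 * (1 + tol j)\<^sup>2 * \<bar>u j (x + y)\<bar> \<le> 2 * (1 + tol j)\<^sup>2 * \<bar>u j x\<bar> + 2 * (1 + tol j)\<^sup>2 * \<bar>u j y\<bar>"
      by (simp add: distrib_left)
  qed simp
qed

lemma seminorm_cone: "seminorm (cone_gauge j)"
proof -
  interpret U: bounded_linear "u j" by (rule linear)
  interpret R: bounded_linear "rest j" by (rule rest_linear)
  show ?thesis unfolding seminorm_def cone_gauge_def
  proof (intro conjI allI)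
    fix x y c
    show "0 \<le> 2 * \<bar>u j x\<bar> + N (rest j x) / 2" by (simp add: seminorm_nonneg[OF sN])
    show "2 * \<bar>u j (c *\<^sub>R x)\<bar> + N (rest j (c *\<^sub>R x)) / 2 = \<bar>c\<bar> * (2 * \<bar>u j x\<bar> + N (rest j x) / 2)"
      by (simp add: U.scaleR R.scaleR abs_mult seminorm_scaleR[OF sN] algebra_simps)
    show "2 * \<bar>u j (x + y)\<bar> + N (rest j (x + y)) / 2
        \<le> 2 * \<bar>u j x\<bar> + N (rest j x) / 2 + (2 * \<bar>u j y\<bar> + N (rest j y) / 2)"
      unfolding U.add R.add
    proof -
      have "2 * A + B / 2 \<le> 2 * a + b / 2 + (2 * c + d / 2)" if "A \<le> a + c" "B \<le> b + d"
        for A B a b c d :: real using that by simp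
      then show "2 * \<bar>u j x + u j y\<bar> + N (rest j x + rest j y) / 2
          \<le> 2 * \<bar>u j x\<bar> + N (rest j x) / 2 + (2 * \<bar>u j y\<bar> + N (rest j y) / 2)"
        using seminorm_triangle[OF sN] abs_triangle_ineq by blast
    qed
  qed
qed

lemma N_rest_le: "N (rest j v) \<le> N v + \<bar>u j v\<bar>"
  using seminorm_triangle_diff[OF sN, of v "u j v *\<^sub>R e j"]
  by (simp add: rest_def seminorm_scaleR[OF sN] unit)

lemma N_rest_ge: "N v - \<bar>u j v\<bar> \<le> N (rest j v)"
  using seminorm_reverse_triangle[OF sN, of v "u j v *\<^sub>R e j"]
  by (simp add: rest_def seminorm_scaleR[OF sN] unit)

lemma slab_le: "slab j v \<le> 8 * \<bar>u j v\<bar>"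
proof -
  have "(1 + tol j)\<^sup>2 \<le> 2\<^sup>2" using tol(1,2)[of j] by (intro power_mono) auto
  then have "2 * (1 + tol j)\<^sup>2 * \<bar>u j v\<bar> \<le> 8 * \<bar>u j v\<bar>" by (intro mult_right_mono) auto
  then show ?thesis by (simp add: slab_def)
qed

lemma slab_cone_le: "slab j v \<le> 24 * N v" "cone_gauge j v \<le> 24 * N v"
  using slab_le[of j v] bound[of j v] N_rest_le[of j v] seminorm_nonneg[OF sN, of v]
  by (simp_all add: cone_gauge_def)

text \<open>
  When \<open>\<bar>u j v\<bar>\<close> is small, the cone gauge is not much larger than \<open>N v / 2\<close>.
\<close>

lemma slab_cone_inactive:
  assumes "\<bar>u j v\<bar> \<le> N v / 8" shows "slab j v \<le> N v" "cone_gauge j v \<le> N v"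
  using assms slab_le[of j v] N_rest_le[of j v] by (simp_all add: cone_gauge_def)

lemma stage_seminorm_ge: "seminorm (stage j) \<and> (\<forall>v. N v \<le> stage j v)"
proof (induction j)
  case 0
  then show ?case by (simp add: sN)
next
  case (Suc j)
  then have s: "seminorm (stage j)" and ge: "\<And>v. N v \<le> stage j v" by auto
  have ge': "N v \<le> mid j v" for v
    using smooth_max_ge_left[OF tol(1), of "stage j v" j "slab j v"] seminorm_nonneg[OF s, of v] ge[of v]
    by linarith
  have z: "v = 0" if "N v \<le> 0" for v using equivalent_norm_pos[OF norm, of v] that by force
  have m: "seminorm (mid j)"
  proof (rule seminorm_smooth_max[OF tol(1) s seminorm_slab])
    show "slab j x = 0" if "stage j x = 0" for x
      using z[of x] ge[of x] that seminorm_zero[OF seminorm_slab] by simp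
  qed
  have "seminorm (stage (Suc j))"
    unfolding stage.simps
  proof (rule seminorm_smooth_max[OF tol(1) m seminorm_cone])
    show "cone_gauge j x = 0" if "mid j x = 0" for x
      using z[of x] ge'[of x] that seminorm_zero[OF seminorm_cone] by simp
  qed
  moreover have "N v \<le> stage (Suc j) v" for v
    using smooth_max_ge_left[OF tol(1), of "mid j v" j "cone_gauge j v"] seminorm_nonneg[OF m, of v] ge'[of v]
    by simp
  ultimately show ?case by blast
qed

lemma seminorm_stage: "seminorm (stage j)" and N_le_stage: "N v \<le> stage j v"
  using stage_seminorm_ge by auto

lemma stage_nonneg: "0 \<le> stage j v" using seminorm_nonneg[OF seminorm_stage] .

lemma stage_le_mid: "stage j v \<le> mid j v"
  by (rule smooth_max_ge_left[OF tol(1) stage_nonneg])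

lemma N_le_mid: "N v \<le> mid j v" using stage_le_mid N_le_stage order_trans by blast

lemma mid_nonneg: "0 \<le> mid j v" using stage_le_mid stage_nonneg order_trans by blast

lemma zero_if_N_le_0: "N v \<le> 0 \<Longrightarrow> v = 0"
  using equivalent_norm_pos[OF norm, of v] by force

lemma seminorm_mid: "seminorm (mid j)"
proof (rule seminorm_smooth_max[OF tol(1) seminorm_stage seminorm_slab])
  show "slab j x = 0" if "stage j x = 0" for x
    using zero_if_N_le_0[of x] N_le_stage[of x j] that seminorm_zero[OF seminorm_slab] by simp
qed

lemma mid_le_stage_Suc: "mid j v \<le> stage (Suc j) v"
  using smooth_max_ge_left[OF tol(1) mid_nonneg] by simp

lemma stage_mono: "i \<le> j \<Longrightarrow> stage i v \<le> stage j v"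
proof (induction j rule: dec_induct)
  case (step n)
  then show ?case using stage_le_mid[of n v] mid_le_stage_Suc[of n v] by linarith
qed simp

lemma stage_le:
  assumes "N v \<le> c" "\<And>i. slab i v \<le> c" "\<And>i. cone_gauge i v \<le> c" shows "stage j v \<le> c"
proof (induction j)
  case (Suc j)
  have "mid j v \<le> c" by (rule smooth_max_le[OF tol(1) stage_nonneg Suc assms(2)])
  then show ?case using smooth_max_le[OF tol(1) mid_nonneg _ assms(3)] by simp
qed (simp add: assms(1))

lemma stage_le_N: "stage j v \<le> 24 * N v"
  using slab_cone_le seminorm_nonneg[OF sN, of v] by (intro stage_le) auto

lemma mid_le_N: "mid j v \<le> 24 * N v"
  using mid_le_stage_Suc stage_le_N order_trans by blast

lemma slab_le_mid: "slab j v / (1 + tol j) \<le> mid j v"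
proof (rule smooth_max_ge_right[OF tol(1) stage_nonneg])
  show "slab j v = 0" if "stage j v = 0"
    using zero_if_N_le_0[of v] N_le_stage[of v j] that seminorm_zero[OF seminorm_slab] by simp
qed (rule seminorm_nonneg[OF seminorm_slab])

lemma cone_le_stage: "cone_gauge j v / (1 + tol j) \<le> stage (Suc j) v"
  unfolding stage.simps
proof (rule smooth_max_ge_right[OF tol(1) mid_nonneg])
  show "cone_gauge j v = 0" if "mid j v = 0"
    using zero_if_N_le_0[of v] N_le_mid[of v j] that seminorm_zero[OF seminorm_cone] by simp
qed (rule seminorm_nonneg[OF seminorm_cone])

lemma stage_Suc_inactive:
  assumes "\<bar>u j v\<bar> \<le> N v / 8" shows "stage (Suc j) v = stage j v"
proof -
  have "mid j v = stage j v"
    using slab_cone_inactive(1)[OF assms] N_le_stage[of v j]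
    by (intro smooth_max_absorb[OF tol(1) stage_nonneg]) linarith
  moreover have "smooth_max (tol j) (stage j v) (cone_gauge j v) = stage j v"
    using slab_cone_inactive(2)[OF assms] N_le_stage[of v j]
    by (intro smooth_max_absorb[OF tol(1) stage_nonneg]) linarith
  ultimately show ?thesis by simp
qed

text \<open>
  Since the \<open>u j\<close> are equi-Lipschitz and tend to 0 at \<open>x\<close>, from some index on they are small compared to
  \<open>N\<close> on a whole neighbourhood of \<open>x\<close>.
\<close>

lemma stage_locally_constant:
  assumes "x \<noteq> 0"
  obtains U n where "open U" "x \<in> U" "\<And>y j. y \<in> U \<Longrightarrow> n \<le> j \<Longrightarrow> stage j y = stage n y"
proof -
  \<comment> \<open>On the \<open>d\<close>-ball around \<open>x\<close> one has \<open>\<bar>u j y\<bar> \<le> d + 3 d\<close> and \<open>N y \<ge> 49 d\<close>; the ratio has to be at most \<open>1 / 8\<close>.\<close>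
  define d where "d = N x / 50"
  have d: "d > 0" using equivalent_norm_pos[OF norm assms] by (simp add: d_def)
  obtain n where n: "\<And>j. n \<le> j \<Longrightarrow> \<bar>u j x\<bar> < d" using LIMSEQ_D[OF null[of x] d] by auto
  define U where "U = {y. N (y - x) < d}"
  have "open U"
    unfolding U_def
    by (intro open_Collect_less continuous_on_const
        continuous_on_compose2[OF equivalent_norm_continuous[OF norm, of UNIV]] continuous_intros) auto
  moreover have "x \<in> U" using d by (simp add: U_def equivalent_norm_zero[OF norm])
  moreover have "stage j y = stage n y" if y: "y \<in> U" and "n \<le> j" for y j
    using \<open>n \<le> j\<close>
  proof (induction j rule: dec_induct)
    case (step i)
    interpret bounded_linear "u i" by (rule linear)
    have "u i y = u i x + u i (y - x)" by (simp add: diff)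
    then have "\<bar>u i y\<bar> \<le> 4 * d" using n[OF step(1)] bound[of i "y - x"] y by (simp add: U_def)
    moreover have "49 * d \<le> N y"
      using seminorm_reverse_triangle[OF sN, of x y] seminorm_diff_commute[OF sN, of x y] y
      by (simp add: U_def d_def)
    ultimately have "\<bar>u i y\<bar> \<le> N y / 8" using d by linarith
    from stage_Suc_inactive[OF this] step.IH show ?case by (simp only:)
  qed simp
  ultimately show ?thesis using that by blast
qed

lemma limit_norm_eq:
  assumes "\<And>j. n \<le> j \<Longrightarrow> stage j x = stage n x" shows "limit_norm x = stage n x"
  unfolding limit_norm_def
  by (intro limI tendsto_eventually eventually_sequentiallyI[of n] assms)

lemma limit_norm_attained: "\<exists>n. \<forall>j\<ge>n. stage j x = limit_norm x"
proof (cases "x = 0")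
  case True
  then have c: "stage j x = stage 0 x" for j
    using seminorm_zero[OF seminorm_stage, of j] seminorm_zero[OF seminorm_stage, of 0] by (simp only:)
  have eq: "limit_norm x = stage 0 x" by (rule limit_norm_eq) (rule c)
  have "stage j x = limit_norm x" for j by (rule trans[OF c eq[symmetric]])
  then show ?thesis by blast
next
  case False
  from stage_locally_constant[OF False] obtain U n where
    "x \<in> U" "\<And>y j. y \<in> U \<Longrightarrow> n \<le> j \<Longrightarrow> stage j y = stage n y" by metis
  then have c: "stage j x = stage n x" if "n \<le> j" for j using that by blast
  have eq: "limit_norm x = stage n x" by (rule limit_norm_eq) (rule c)
  have "stage j x = limit_norm x" if "n \<le> j" for j by (rule trans[OF c[OF that] eq[symmetric]])
  then show ?thesis by blast
qed

lemma stage_le_limit_norm: "stage j x \<le> limit_norm x"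
proof -
  obtain n where n: "\<And>j. n \<le> j \<Longrightarrow> stage j x = limit_norm x" using limit_norm_attained[of x] by blast
  show ?thesis using stage_mono[of j "max n j" x] n[of "max n j"] by simp
qed

lemma limit_norm_le:
  assumes "\<And>j. stage j x \<le> c" shows "limit_norm x \<le> c"
proof -
  obtain n where "stage n x = limit_norm x" using limit_norm_attained[of x] by blast
  with assms[of n] show ?thesis by simp
qed

lemma cone_le_limit_norm: "cone_gauge j v \<le> (1 + tol j) * limit_norm v"
proof -
  have "cone_gauge j v / (1 + tol j) \<le> limit_norm v"
    using cone_le_stage stage_le_limit_norm order_trans by blast
  then show ?thesis using tol(1)[of j] by (simp add: divide_le_eq mult.commute)
qed

lemma seminorm_limit_norm: "seminorm limit_norm"
  unfolding seminorm_def
proof (intro conjI allI)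
  fix x y c
  obtain n1 where n1: "\<And>j. n1 \<le> j \<Longrightarrow> stage j x = limit_norm x" using limit_norm_attained[of x] by blast
  obtain n2 where n2: "\<And>j. n2 \<le> j \<Longrightarrow> stage j y = limit_norm y" using limit_norm_attained[of y] by blast
  obtain n3 where n3: "\<And>j. n3 \<le> j \<Longrightarrow> stage j (x + y) = limit_norm (x + y)"
    using limit_norm_attained[of "x + y"] by blast
  obtain n4 where n4: "\<And>j. n4 \<le> j \<Longrightarrow> stage j (c *\<^sub>R x) = limit_norm (c *\<^sub>R x)"
    using limit_norm_attained[of "c *\<^sub>R x"] by blast
  let ?j = "n1 + n2 + n3 + n4"
  show "0 \<le> limit_norm x" using stage_nonneg[of 0 x] stage_le_limit_norm[of 0 x] by linarith
  show "limit_norm (c *\<^sub>R x) = \<bar>c\<bar> * limit_norm x"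
    using seminorm_scaleR[OF seminorm_stage, of ?j c x] n1[of ?j] n4[of ?j] by simp
  show "limit_norm (x + y) \<le> limit_norm x + limit_norm y"
    using seminorm_triangle[OF seminorm_stage, of ?j x y] n1[of ?j] n2[of ?j] n3[of ?j] by simp
qed

lemma equivalent_limit_norm: "equivalent_norm limit_norm"
proof -
  obtain a b where ab: "a > 0" "b > 0" "\<And>x. a * norm x \<le> N x" "\<And>x. N x \<le> b * norm x"
    using norm unfolding equivalent_norm_iff by blast
  have "a * norm x \<le> limit_norm x" for x
    using ab(3)[of x] stage_le_limit_norm[of 0 x] by simp
  moreover have "limit_norm x \<le> (24 * b) * norm x" for x
    using limit_norm_le[OF stage_le_N, of x] ab(4)[of x] by simp
  ultimately show ?thesis
    unfolding equivalent_norm_iff using seminorm_limit_norm ab(1,2)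
    by (intro conjI exI[of _ a] exI[of _ "24 * b"]) auto
qed

lemma continuous_if_le_N:
  assumes "seminorm p" "\<And>v. p v \<le> 24 * N v" shows "continuous_on S p"
proof -
  obtain b where b: "\<And>x. N x \<le> b * norm x" using norm unfolding equivalent_norm_iff by blast
  have "p x \<le> (24 * b) * norm x" for x
    using assms(2)[of x] b[of x] by simp
  then show ?thesis by (rule seminorm_continuous[OF assms(1)])
qed

text \<open>
  At each insertion the new seminorm is smooth wherever it is not below the current one. For the slab
  this holds since it is positive there. The cone gauge fails to be smooth on \<open>u j = 0\<close>, where it is
  \<open>N / 2\<close>, and on the axis \<open>rest j = 0\<close>, where it is \<open>2 \<bar>u j\<bar>\<close> and the slab exceeds it; in both cases the
  current norm is strictly larger.
\<close>

lemma Ck_on_stage: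
  assumes N: "Ck_on m N (- {0})"
  shows "Ck_on m (stage j) (- {0})"
proof (induction j)
  case 0
  then show ?case using N by simp
next
  case (Suc j)
  have ouj: "open {y. u j y \<noteq> 0}"
    using linear_continuous_on[OF linear, of UNIV j] by (intro open_Collect_neq continuous_on_const) auto
  have orj: "open {y. rest j y \<noteq> 0}"
    using linear_continuous_on[OF rest_linear, of UNIV j] by (intro open_Collect_neq continuous_on_const) auto
  have abs: "Ck_on m (\<lambda>y. \<bar>u j y\<bar>) {y. u j y \<noteq> 0}"
    by (rule Ck_on_abs[OF Ck_on_linear[OF linear]]) simp
  have pos: "0 < N x" if "x \<in> - {0}" for x using equivalent_norm_pos[OF norm] that by simp
  have mid: "Ck_on m (mid j) (- {0})"
  proof (rule Ck_on_smooth_max[OF _ Suc _ tol(1)])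
    show "open (- {0::'a})" by (rule open_Compl[OF closed_singleton])
    show pos_stage: "0 < stage j x" if "x \<in> - {0}" for x
      using pos[OF that] N_le_stage[of x j] by linarith
    show "continuous_on (- {0}) (stage j)" by (rule continuous_if_le_N[OF seminorm_stage stage_le_N])
    show "continuous_on (- {0}) (slab j)" by (rule continuous_if_le_N[OF seminorm_slab slab_cone_le(1)])
    fix x assume x: "x \<in> - {0}" "stage j x \<le> slab j x"
    then have "0 < slab j x" using pos_stage[OF x(1)] by linarith
    then have "u j x \<noteq> 0" by (auto simp: slab_def)
    moreover have "Ck_on m (slab j) {y. u j y \<noteq> 0}" unfolding slab_def by (rule Ck_on_cmult[OF abs])
    ultimately show "\<exists>U. open U \<and> x \<in> U \<and> Ck_on m (slab j) U" using ouj by blast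
  qed
  show ?case
    unfolding stage.simps
  proof (rule Ck_on_smooth_max[OF _ mid _ tol(1)])
    show "open (- {0::'a})" by (rule open_Compl[OF closed_singleton])
    show "0 < mid j x" if "x \<in> - {0}" for x using pos[OF that] N_le_mid[of x j] by linarith
    show "continuous_on (- {0}) (mid j)" by (rule continuous_if_le_N[OF seminorm_mid mid_le_N])
    show "continuous_on (- {0}) (cone_gauge j)" by (rule continuous_if_le_N[OF seminorm_cone slab_cone_le(2)])
    fix x assume x: "x \<in> - {0}" "mid j x \<le> cone_gauge j x"
    have ux: "u j x \<noteq> 0"
    proof
      assume "u j x = 0"
      then have "cone_gauge j x = N x / 2" by (simp add: cone_gauge_def rest_def)
      then show False using x(2) N_le_mid[of x j] pos[OF x(1)] by linarith
    qed
    have rx: "rest j x \<noteq> 0"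
    proof
      assume "rest j x = 0"
      then have "cone_gauge j x = 2 * \<bar>u j x\<bar>" by (simp add: cone_gauge_def equivalent_norm_zero[OF norm])
      also have "\<dots> < 2 * (1 + tol j) * \<bar>u j x\<bar>" using ux tol(1)[of j] by simp
      also have "\<dots> = slab j x / (1 + tol j)" using tol(1)[of j] by (simp add: slab_def power2_eq_square)
      also have "\<dots> \<le> mid j x" by (rule slab_le_mid)
      finally show False using x(2) by simp
    qed
    let ?U = "{y. u j y \<noteq> 0} \<inter> {y. rest j y \<noteq> 0}"
    have a: "Ck_on m (\<lambda>y. \<bar>u j y\<bar>) ?U" by (rule smooth_family_subset[OF abs]) auto
    have "Ck_on m (\<lambda>y. N (rest j y)) ?U" by (rule Ck_on_precompose[OF rest_linear N]) auto
    from smooth_family_add[OF Ck_on_cmult[OF a, of 2] Ck_on_cmult[OF this, of "1 / 2"]]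
    have "Ck_on m (cone_gauge j) ?U" by (simp add: cone_gauge_def[abs_def])
    then show "\<exists>U. open U \<and> x \<in> U \<and> Ck_on m (cone_gauge j) U"
      using ux rx ouj orj by (intro exI[of _ ?U]) auto
  qed
qed

lemma Ck_on_limit_norm:
  assumes "Ck_on m N (- {0})" shows "Ck_on m limit_norm (- {0})"
proof (rule smooth_family_local)
  fix x :: 'a assume "x \<in> - {0}"
  then have "x \<noteq> 0" by simp
  from stage_locally_constant[OF this] obtain U n where U: "open U" "x \<in> U"
    "\<And>y j. y \<in> U \<Longrightarrow> n \<le> j \<Longrightarrow> stage j y = stage n y" by metis
  have o: "open (U \<inter> - {0})" using U(1) by auto
  have "Ck_on m (stage n) (U \<inter> - {0})" by (rule smooth_family_subset[OF Ck_on_stage[OF assms]]) simp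
  then have "Ck_on m limit_norm (U \<inter> - {0})"
  proof (rule smooth_family_cong[OF o])
    fix y and vs :: "'a list" assume "y \<in> U \<inter> - {0}"
    then show "limit_norm y = stage n y" using limit_norm_eq[of n y] U(3) by blast
  qed
  then show "\<exists>V. open V \<and> x \<in> V \<and> Ck_on m limit_norm V"
    using o U(2) \<open>x \<noteq> 0\<close> by (intro exI[of _ "U \<inter> - {0}"]) auto
qed (rule open_Compl[OF closed_singleton])

lemma rest_apex: "rest j (e j) = 0" by (simp add: rest_def self)

text \<open>
  By biorthogonality, at \<open>e j\<close> the slab with index \<open>j\<close> dominates all other seminorms.
\<close>

lemma limit_norm_apex: "limit_norm (e j) \<le> 2 * (1 + tol j)\<^sup>2"
proof (rule limit_norm_le, rule stage_le)
  have one: "1 \<le> (1 + tol j)\<^sup>2" using tol(1)[of j] by (simp add: one_le_power)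
  show "N (e j) \<le> 2 * (1 + tol j)\<^sup>2" using one by (simp add: unit)
  fix i
  show "slab i (e j) \<le> 2 * (1 + tol j)\<^sup>2"
    using one by (cases "i = j") (auto simp: slab_def self other)
  show "cone_gauge i (e j) \<le> 2 * (1 + tol j)\<^sup>2"
    using one by (cases "i = j") (auto simp: cone_gauge_def rest_def self other unit equivalent_norm_zero[OF norm])
qed

text \<open>
  The limit norm is nearly bounded below by the cone gauge, and nearly equal to it at the apex, where the
  gauge has a corner: its second difference there is at least \<open>\<tau> N (rest j h)\<close>.
\<close>

lemma second_difference_at_apex:
  assumes "\<tau> > 0"
  shows "(4 + \<tau> * (N h - \<bar>u j h\<bar>)) / (1 + tol j) - 4 * (1 + tol j)\<^sup>2
    \<le> limit_norm (e j + \<tau> *\<^sub>R h) + limit_norm (e j - \<tau> *\<^sub>R h) - 2 * limit_norm (e j)"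
proof -
  interpret U: bounded_linear "u j" by (rule linear)
  interpret R: bounded_linear "rest j" by (rule rest_linear)
  have cones: "cone_gauge j (e j + \<tau> *\<^sub>R h) = 2 * \<bar>1 + \<tau> * u j h\<bar> + \<tau> * N (rest j h) / 2"
    "cone_gauge j (e j - \<tau> *\<^sub>R h) = 2 * \<bar>1 - \<tau> * u j h\<bar> + \<tau> * N (rest j h) / 2"
    using assms
    by (simp_all add: cone_gauge_def U.add U.diff U.scaleR R.add R.diff R.scaleR self rest_apex
        seminorm_minus[OF sN] seminorm_scaleR[OF sN])
  have "4 + r \<le> (2 * \<bar>1 + s\<bar> + r / 2) + (2 * \<bar>1 - s\<bar> + r / 2)" for r s :: real
    by (auto simp: abs_if)
  then have "4 + \<tau> * N (rest j h) \<le> cone_gauge j (e j + \<tau> *\<^sub>R h) + cone_gauge j (e j - \<tau> *\<^sub>R h)"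
    unfolding cones .
  moreover have "\<tau> * (N h - \<bar>u j h\<bar>) \<le> \<tau> * N (rest j h)"
    using N_rest_ge assms by (intro mult_left_mono) auto
  ultimately have "4 + \<tau> * (N h - \<bar>u j h\<bar>) \<le> cone_gauge j (e j + \<tau> *\<^sub>R h) + cone_gauge j (e j - \<tau> *\<^sub>R h)"
    by linarith
  also have "\<dots> \<le> (1 + tol j) * (limit_norm (e j + \<tau> *\<^sub>R h) + limit_norm (e j - \<tau> *\<^sub>R h))"
    using cone_le_limit_norm by (simp add: distrib_left add_mono)
  finally have "(4 + \<tau> * (N h - \<bar>u j h\<bar>)) / (1 + tol j)
      \<le> limit_norm (e j + \<tau> *\<^sub>R h) + limit_norm (e j - \<tau> *\<^sub>R h)"
    using tol(1)[of j] by (simp add: divide_le_eq mult.commute)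
  then show ?thesis using limit_norm_apex[of j] by linarith
qed

text \<open>
  For a fixed step \<open>\<tau>\<close> the second differences at \<open>e j\<close> tend to at least \<open>\<tau> N h\<close> as \<open>j \<rightarrow> \<infinity>\<close>, whereas
  uniformity would bound them by \<open>\<tau> N h / 4\<close> once \<open>\<tau>\<close> is small.
\<close>

lemma limit_norm_not_uniformly_gateaux:
  assumes "h \<noteq> 0" shows "\<not> uniformly_gateaux_in_direction limit_norm h"
proof
  assume "uniformly_gateaux_in_direction limit_norm h"
  then obtain M where M: "equivalent_norm M"
    and lim: "uniform_limit {x. M x = 1} (\<lambda>t x. gateaux_quotient limit_norm x h t) (\<lambda>x. 0) (at 0)"
    unfolding uniformly_gateaux_in_direction_def by blast
  have Nh: "N h > 0" by (rule equivalent_norm_pos[OF norm assms])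
  then have "N h / 4 > 0" by simp
  from uniform_limitD[OF lim this] obtain d where d: "d > 0"
    "\<And>t x. t \<noteq> 0 \<Longrightarrow> \<bar>t\<bar> < d \<Longrightarrow> M x = 1 \<Longrightarrow> \<bar>gateaux_quotient limit_norm x h t\<bar> < N h / 4"
    unfolding eventually_at by (auto simp: dist_real_def)
  obtain a where a: "a > 0" "\<And>x. a * norm x \<le> M x" using M unfolding equivalent_norm_iff by blast
  obtain b where b: "b > 0" "\<And>x. N x \<le> b * norm x" using norm unfolding equivalent_norm_iff by blast
  have Me: "a / b \<le> M (e j)" for j
  proof -
    have "1 / b \<le> norm (e j)" using b(2)[of "e j"] b(1) by (simp add: unit divide_le_eq mult.commute)
    then have "a * (1 / b) \<le> a * norm (e j)" using a(1) by (intro mult_left_mono) auto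
    then show ?thesis using a(2)[of "e j"] by simp
  qed
  have c: "a / b > 0" using a(1) b(1) by simp
  \<comment> \<open>The points \<open>e j\<close> have to be rescaled to the unit sphere of \<open>M\<close>; \<open>a / b\<close> bounds \<open>M (e j)\<close> from below, so this
  step stays below \<open>d\<close> after rescaling, for all \<open>j\<close>.\<close>
  define \<tau> where "\<tau> = d * (a / b) / 2"
  have \<tau>: "\<tau> > 0" using d(1) a(1) b(1) by (simp add: \<tau>_def)
  have small: "(4 + \<tau> * (N h - \<bar>u j h\<bar>)) / (1 + tol j) - 4 * (1 + tol j)\<^sup>2 \<le> \<tau> * N h / 4" for j
  proof -
    let ?m = "M (e j)"
    have m: "?m > 0" using Me[of j] c by linarith
    have "\<tau> / ?m \<le> \<tau> / (a / b)" using Me[of j] c \<tau> m by (intro divide_left_mono mult_pos_pos) linarith+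
    also have "\<dots> = d / 2" using a(1) b(1) by (simp add: \<tau>_def)
    finally have "\<tau> / ?m \<le> d / 2" .
    moreover have "0 < \<tau> / ?m" using \<tau> m by simp
    ultimately have "\<bar>\<tau> / ?m\<bar> < d" using d(1) by (subst abs_of_pos) linarith+
    moreover have "M ((1 / ?m) *\<^sub>R e j) = 1"
      using m by (simp add: seminorm_scaleR[OF equivalent_norm_seminorm[OF M]])
    ultimately have "\<bar>gateaux_quotient limit_norm ((1 / ?m) *\<^sub>R e j) h (\<tau> / ?m)\<bar> < N h / 4"
      using \<tau> m by (intro d(2)) auto
    then have "gateaux_quotient limit_norm (e j) h \<tau> < N h / 4"
      using gateaux_quotient_scale[OF seminorm_limit_norm m] by simp
    then have "limit_norm (e j + \<tau> *\<^sub>R h) + limit_norm (e j - \<tau> *\<^sub>R h) - 2 * limit_norm (e j) < \<tau> * N h / 4"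
      using \<tau> by (simp add: gateaux_quotient_def divide_less_eq mult.commute)
    with second_difference_at_apex[OF \<tau>] show ?thesis by (rule order_trans[OF _ less_imp_le])
  qed
  have "(\<lambda>j. (4 + \<tau> * (N h - \<bar>u j h\<bar>)) / (1 + tol j) - 4 * (1 + tol j)\<^sup>2)
      \<longlonglongrightarrow> (4 + \<tau> * (N h - \<bar>0\<bar>)) / (1 + 0) - 4 * (1 + 0)\<^sup>2"
    by (intro tendsto_intros null tol(3)) simp
  then have "(4 + \<tau> * (N h - \<bar>0\<bar>)) / (1 + 0) - 4 * (1 + 0)\<^sup>2 \<le> \<tau> * N h / 4"
    by (rule LIMSEQ_le_const2) (use small in blast)
  then show False using mult_pos_pos[OF \<tau> Nh] by simp
qed

text \<open>
  On the ball the cone gauge is at most \<open>1 + tol j\<close>. If \<open>u j\<close> is nearly as large as this permits, the other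
  summand \<open>N (rest j x)\<close> of the gauge is small.
\<close>

lemma diameter_slice_at_apex:
  assumes a0: "0 < a"
    and xy: "limit_norm x \<le> 1" "u j x > a" "limit_norm y \<le> 1" "u j y > a"
  shows "N (x - y) \<le> 5 * (1 + tol j - 2 * a)"
proof -
  have *: "2 * u j z + N (rest j z) / 2 \<le> 1 + tol j" if "limit_norm z \<le> 1" "u j z > a" for z
  proof -
    have "(1 + tol j) * limit_norm z \<le> (1 + tol j) * 1"
      using that(1) tol(1)[of j] by (intro mult_left_mono) auto
    then show ?thesis using cone_le_limit_norm[of j z] that(2) a0 by (simp add: cone_gauge_def)
  qed
  have "x - y = (u j x - u j y) *\<^sub>R e j + (rest j x - rest j y)"
    by (simp add: rest_def algebra_simps)
  then have "N (x - y) \<le> \<bar>u j x - u j y\<bar> + N (rest j x - rest j y)"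
    using seminorm_triangle[OF sN, of "(u j x - u j y) *\<^sub>R e j" "rest j x - rest j y"]
    by (simp add: seminorm_scaleR[OF sN] unit)
  also have "\<dots> \<le> \<bar>u j x - u j y\<bar> + (N (rest j x) + N (rest j y))"
    using seminorm_triangle_diff[OF sN, of "rest j x" "rest j y"] by simp
  also have "\<dots> \<le> 5 * (1 + tol j - 2 * a)"
  proof -
    have "\<bar>p - q\<bar> + (m + n) \<le> 5 * (1 + t - 2 * b)"
      if "2 * p + m / 2 \<le> 1 + t" "2 * q + n / 2 \<le> 1 + t" "b < p" "b < q" "0 \<le> m" "0 \<le> n"
      for p q m n t b :: real
      using that by (cases "p \<le> q") (simp_all add: abs_if)
    then show ?thesis
      using *[OF xy(1,2)] *[OF xy(3,4)] xy(2,4) seminorm_nonneg[OF sN] by blast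
  qed
  finally show ?thesis .
qed

lemma dentable_limit_ball: "dentable {x. limit_norm x \<le> 1}"
  unfolding dentable_def
proof (intro conjI exI[of _ N] allI impI)
  show "convex {x. limit_norm x \<le> 1}" by (rule convex_seminorm_ball[OF seminorm_limit_norm])
  show "equivalent_norm N" by (rule norm)
  fix \<epsilon> :: real assume "\<epsilon> > 0"
  \<comment> \<open>At the normalised apex \<open>u j\<close> is at least \<open>1 / (2 (1 + tol j)\<^sup>2)\<close>; the third power puts the apex strictly inside
  the slice.\<close>
  define a where "a j = 1 / (2 * (1 + tol j) ^ 3)" for j
  have "(\<lambda>j. 5 * (1 + tol j - 2 * a j)) \<longlonglongrightarrow> 5 * (1 + 0 - 2 * (1 / (2 * (1 + 0) ^ 3)))"
    unfolding a_def by (intro tendsto_intros tol(3)) simp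
  then have "(\<lambda>j. 5 * (1 + tol j - 2 * a j)) \<longlonglongrightarrow> 0" by simp
  from eventually_happens'[OF sequentially_bot order_tendstoD(2)[OF this \<open>\<epsilon> > 0\<close>]]
  obtain j where j: "5 * (1 + tol j - 2 * a j) < \<epsilon>" by blast
  have f: "blinfun_apply (Blinfun (u j)) = u j" by (rule bounded_linear_Blinfun_apply[OF linear])
  let ?S = "slice {x. limit_norm x \<le> 1} (Blinfun (u j)) (a j)"
  interpret U: bounded_linear "u j" by (rule linear)
  let ?l = "limit_norm (e j)"
  have "e j \<noteq> 0" using unit[of j] equivalent_norm_zero[OF norm] by auto
  then have l: "?l > 0" by (rule equivalent_norm_pos[OF equivalent_limit_norm])
  have t: "1 + tol j > 1" using tol(1)[of j] by simp
  then have a0: "a j > 0" by (simp add: a_def)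
  have "?l \<le> 2 * (1 + tol j)\<^sup>2" by (rule limit_norm_apex)
  also have "\<dots> < 2 * (1 + tol j) ^ 3" using power_strict_increasing[OF _ t, of 2 3] by simp
  finally have "a j < 1 / ?l" unfolding a_def using l t by (intro divide_strict_left_mono) auto
  then have "(1 / ?l) *\<^sub>R e j \<in> ?S"
    using l by (simp add: slice_def f U.scaleR self seminorm_scaleR[OF seminorm_limit_norm])
  then have "?S \<noteq> {}" by blast
  moreover have "diameter_in_norm N ?S \<le> ereal (5 * (1 + tol j - 2 * a j))"
    unfolding diameter_in_norm_def
  proof (intro SUP_least)
    fix x y assume "x \<in> ?S" "y \<in> ?S"
    then have "N (x - y) \<le> 5 * (1 + tol j - 2 * a j)"
      using diameter_slice_at_apex[OF a0, of x j y] by (simp add: slice_def f)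
    then show "ereal (N (x - y)) \<le> ereal (5 * (1 + tol j - 2 * a j))" by (simp only: ereal_less_eq)
  qed
  then have "diameter_in_norm N ?S < ereal \<epsilon>"
    by (rule le_less_trans) (use j in \<open>simp only: less_ereal.simps\<close>)
  ultimately show "\<exists>f a. a > 0 \<and> slice {x. limit_norm x \<le> 1} f a \<noteq> {} \<and>
      diameter_in_norm N (slice {x. limit_norm x \<le> 1} f a) < ereal \<epsilon>" using a0 by blast
qed

end

lemma Ck_on_has_derivative:
  assumes "Ck_on (Suc n) f S" "x \<in> S" shows "\<exists>D. (f has_derivative D) (at x)"
proof -
  obtain f' where "\<forall>x\<in>S. family_derivative 0 (\<lambda>_. f) f' x" "smooth_family n (Suc 0) f' S"
    using assms(1) by auto
  then have "(f has_derivative (\<lambda>v. f' [v] x)) (at x)"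
    using family_derivative_has_derivative[of 0 f' x "\<lambda>_. f" "[]"] smooth_family_bounded assms(2)
    by blast
  then show ?thesis by blast
qed

theorem theorem1:
  fixes k :: enat
    and N :: "'a::banach \<Rightarrow> real"
  assumes "1 \<le> k"
    and "separable_space (euclidean :: 'a topology)"
    and "\<nexists>B :: 'a set. finite B \<and> span B = UNIV"
    and "equivalent_norm N"
    and "Ck_smooth_norm k N"
  shows "\<exists>N' :: 'a \<Rightarrow> real.
           equivalent_norm N' \<and> Ck_smooth_norm k N' \<and>
           (\<forall>h. h \<noteq> 0 \<longrightarrow> \<not> uniformly_gateaux_in_direction N' h) \<and>
           dentable {x. N' x \<le> 1}"
proof -
  have iff: "times_cont_frechet_differentiable_on n f (- {0}) \<longleftrightarrow> Ck_on n f (- {0})" for n and f :: "'a \<Rightarrow> real"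
    by (rule times_cont_frechet_iff_smooth_family[OF open_Compl[OF closed_singleton]])
  have "Ck_on (Suc 0) N (- {0})"
  proof (cases k)
    case (enat n)
    with assms(1) have "Suc 0 \<le> n" by (simp add: one_enat_def)
    have "times_cont_frechet_differentiable_on n N (- {0})"
      using assms(5) enat by (simp add: Ck_smooth_norm_def)
    then show ?thesis unfolding iff using \<open>Suc 0 \<le> n\<close> by (rule smooth_family_le)
  next
    case infinity
    then have "times_cont_frechet_differentiable_on (Suc 0) N (- {0})"
      using assms(5) by (simp add: Ck_smooth_norm_def)
    then show ?thesis unfolding iff .
  qed
  then have diff: "\<exists>f. (N has_derivative f) (at w)" if "w \<noteq> 0" for w
    using Ck_on_has_derivative that by blast
  obtain e :: "nat \<Rightarrow> 'a" and u where "null_biorthogonal_system N e u"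
    by (rule weak_star_null_biorthogonal_sequence[OF assms(4) diff assms(3,2)])
  then interpret null_biorthogonal_system N e u .
  have "times_cont_frechet_differentiable_on n limit_norm (- {0})"
    if "times_cont_frechet_differentiable_on n N (- {0})" for n
    using that unfolding iff by (rule Ck_on_limit_norm)
  then have "Ck_smooth_norm k limit_norm"
    using assms(5) by (cases k) (simp_all add: Ck_smooth_norm_def)
  then show ?thesis
    using equivalent_limit_norm limit_norm_not_uniformly_gateaux dentable_limit_ball by blast
qed

end
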